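(* Let $\alpha,\beta<0$, $\rho:=\log_2(|\alpha|+|\beta|)$ (so $\alpha+\beta=-2^\rho$), and let $f,g,\varphi,P_0$ be as in the context. Then the following are equivalent: (i) $n^{-\rho}f(n)=P(\log_2 n)+o(1)$ as $n\to\infty$ over the integers, for some continuous $1$-antiperiodic $P$; (ii) $x^{-\rho}f(x)=P(\log_2x)+o(1)$ as $x\to\infty$, for some continuous $1$-antiperiodic $P$; (iii) $x^{-\rho}f(x)=P(\log_2x)+o(1)$ as $x\to\infty$, for some $1$-antiperiodic $P$; (iv) the series $Q(x):=\sum_{m\ge1}(-2^{-\rho})^mg(2^mx)=\sum_{m\ge1}(\alpha+\beta)^{-m}g(2^mx)$ converges uniformly for $x\in[1,2]$. When these hold, $Q(x)$ is defined for all $x>0$, $Q(x)=o(x^\rho)$, and $f(x)=x^\rho P(\log_2x)-Q(x)$ for $x\ge1$, where the continuous $1$-antiperiodic $P$ is $$P(t)=\sum_{m\in\mathbb{Z}}(-1)^m2^{-\rho(m+t)}g(2^{m+t})+f(1)P_0(t),\qquad t\in\mathbb{R}.$$ Moreover, with $\chi'_k:=\frac{(2k+1)\pi}{\log2}i$ and $\widehat P(k+\tfrac12):=\int_0^1P(t)e^{-(2k+1)\pi it}\,dt$: (a) if (iv) holds, then for all $k\in\mathbb{Z}$, $$\widehat P(k+\tfrac12)=\frac1{\log2}\int_1^\infty\frac{g(u)}{u^{\rho+\chi'_k+1}}\,du+\frac{f(1)}{\log2}\int_0^1\frac{1+(\alpha+\beta-1)\varphi(u)}{(1+u)^{\rho+\chi'_k+1}}\,du,$$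 with the first integral (at least) conditionally convergent; (b) if $\sum_{m\ge0}2^{-\rho m}A_m<\infty$ with $A_m:=\max_{2^m\le n\le2^{m+1}}|g(n)|$, this formula holds with absolutely convergent integrals; (c) if $|\alpha|+|\beta|>1$ and $\sum_{m\ge0}2^{(1-\rho)m}B_m<\infty$ with $B_m:=\max_{2^m\le n<2^{m+1}}|g(n+1)-g(n)|$, then $P(t)=\sum_{k\in\mathbb{Z}}\widehat P(k+\frac12)e^{(2k+1)\pi it}$ with an absolutely convergent Fourier series, the coefficients being given by the formula above with absolutely convergent integrals. If moreover $\alpha=\beta$ and (iv) holds, then $$\widehat P(k+\tfrac12)=\frac{1}{(\rho+\chi'_k)(\rho-1+\chi'_k)\log2}\Bigl(D(\rho-1+\chi'_k)+\frac{(2\alpha-1)(\alpha-1)}{\alpha}f(1)\Bigr),$$ where $D(s):=\sum_{n\ge2}g(n)\bigl((n-1)^{-s}-2n^{-s}+(n+1)^{-s}\bigr)$ for complex $s$ for which the series converges.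
   Context: Let $\alpha,\beta<0$. Let $(f(n))_{n\ge1}$, $(g(n))_{n\ge2}$ be real sequences with $f(n)=\alpha f(\lfloor n/2\rfloor)+\beta f(\lceil n/2\rceil)+g(n)$ for $n\ge2$; set $g(1):=0$. Let $\varphi=\varphi_{\alpha,\beta}:=\varphi_{|\alpha|,|\beta|}$, where for $a,b>0$, $\varphi_{a,b}$ is the unique continuous function on $[0,1]$ with $\varphi(0)=0$, $\varphi(1)=1$, $\varphi(t)=\frac{b}{a+b}\varphi(2t)$ on $[0,\frac12]$ and $\varphi(t)=\frac{a}{a+b}\varphi(2t-1)+\frac{b}{a+b}$ on $[\frac12,1]$. Extend $f,g$ to real $x\ge1$ by $f(n+t):=(1-\varphi(t))f(n)+\varphi(t)f(n+1)$, $g(n+t):=(1-\varphi(t))g(n)+\varphi(t)g(n+1)$ ($n\ge1$ integer, $t\in[0,1]$), and set $g(x):=0$ for $0\le x<1$. Let $\{t\}:=t-\lfloor t\rfloor$ and $P_0(t):=(-1)^{\lfloor t\rfloor}\bigl(1+(\alpha+\beta-1)\varphi(2^{\{t\}}-1)\bigr)2^{-\rho\{t\}}$. A function $P$ on $\mathbb{R}$ is $1$-antiperiodic if $P(t+1)=-P(t)$ for all $t$. *)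

theory Defs
  imports "HOL-Analysis.Analysis" "HOL-Library.Landau_Symbols"
begin

definition is_phi :: "real \<Rightarrow> real \<Rightarrow> (real \<Rightarrow> real) \<Rightarrow> bool" where
  "is_phi a b \<phi> \<longleftrightarrow>
     continuous_on {0..1} \<phi> \<and> \<phi> 0 = 0 \<and> \<phi> 1 = 1 \<and>
     (\<forall>t\<in>{0..1/2}. \<phi> t = b / (a + b) * \<phi> (2 * t)) \<and>
     (\<forall>t\<in>{1/2..1}. \<phi> t = a / (a + b) * \<phi> (2 * t - 1) + b / (a + b))"

text \<open>The values outside \<open>[0,1]\<close> are irrelevant; they are set to \<open>0\<close> only to make the
  description unique as a function on the whole real line.\<close>

definition phi :: "real \<Rightarrow> real \<Rightarrow> real \<Rightarrow> real" where
  "phi a b = (THE \<phi>. is_phi a b \<phi> \<and> (\<forall>t. t \<notin> {0..1} \<longrightarrow> \<phi> t = 0))"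

lemma is_phi_unique:
  assumes "0 < a" "0 < b" "is_phi a b \<phi>" "is_phi a b \<psi>" "t \<in> {0..1}"
  shows "\<phi> t = \<psi> t"
proof -
  define d where "d = (\<lambda>t. \<bar>\<phi> t - \<psi> t\<bar>)"
  define r where "r = max (a / (a + b)) (b / (a + b))"
  have r: "a / (a + b) \<le> r" "b / (a + b) \<le> r" "r < 1"
    using assms by (auto simp: r_def)
  have "continuous_on {0..1} d"
    using assms unfolding d_def is_phi_def by (auto intro!: continuous_intros)
  then obtain t0 where t0: "t0 \<in> {0..1}" "\<And>t. t \<in> {0..1} \<Longrightarrow> d t \<le> d t0"
    using continuous_attains_sup[of "{0..1::real}" d] by auto
  have nn: "0 \<le> d t" for t by (simp add: d_def)
  have "d t0 \<le> r * d t0"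
  proof (cases "t0 \<le> 1/2")
    case True
    hence "\<phi> t0 - \<psi> t0 = b / (a + b) * (\<phi> (2 * t0) - \<psi> (2 * t0))"
      using assms t0(1) unfolding is_phi_def by (auto simp: right_diff_distrib)
    hence "d t0 = b / (a + b) * d (2 * t0)"
      using assms by (simp add: d_def abs_mult)
    also have "\<dots> \<le> r * d t0"
      using True t0(1) assms r nn by (intro mult_mono t0(2)) (auto intro: order_trans[OF _ r(2)])
    finally show ?thesis .
  next
    case False
    hence "\<phi> t0 - \<psi> t0 = a / (a + b) * (\<phi> (2 * t0 - 1) - \<psi> (2 * t0 - 1))"
      using assms t0(1) unfolding is_phi_def by (auto simp: right_diff_distrib)
    hence "d t0 = a / (a + b) * d (2 * t0 - 1)"
      using assms by (simp add: d_def abs_mult)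
    also have "\<dots> \<le> r * d t0"
      using False t0(1) assms r nn by (intro mult_mono t0(2)) (auto intro: order_trans[OF _ r(1)])
    finally show ?thesis .
  qed
  hence "(1 - r) * d t0 \<le> 0" by (simp add: algebra_simps)
  hence "d t0 \<le> 0" using r by (simp add: mult_le_0_iff)
  hence "d t \<le> 0" using t0(2)[OF assms(5)] by linarith
  thus ?thesis by (simp add: d_def)
qed

lemma is_phi_exists:
  assumes "0 < a" "0 < b"
  shows "\<exists>\<phi>. is_phi a b \<phi>"
proof -
  define T where "T = (\<lambda>p (t::real). if t \<le> 1/2 then b / (a + b) * p (2 * t)
                          else a / (a + b) * p (2 * t - 1) + b / (a + b))"
  define p where "p = (\<lambda>n. (T ^^ n) (\<lambda>t. t))"
  define r where "r = max (a / (a + b)) (b / (a + b))"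
  have r: "a / (a + b) \<le> r" "b / (a + b) \<le> r" "r < 1" "0 \<le> r"
    using assms by (auto simp: r_def le_max_iff_disj)
  have ab: "a / (a + b) + b / (a + b) = 1"
    using assms by (simp flip: add_divide_distrib)
  have p_Suc: "p (Suc n) = T (p n)" for n by (simp add: p_def)
  have inv: "continuous_on {0..1} (p n) \<and> p n 0 = 0 \<and> p n 1 = 1" for n
  proof (induction n)
    case 0
    show ?case by (simp add: p_def)
  next
    case (Suc n)
    have c: "continuous_on ({0..1/2} \<union> {1/2..1})
        (\<lambda>t. if t \<le> 1/2 then b / (a + b) * p n (2 * t)
             else a / (a + b) * p n (2 * t - 1) + b / (a + b))"
    proof (intro continuous_on_If)
      show "continuous_on {0..1/2} (\<lambda>t. b / (a + b) * p n (2 * t))"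
        by (intro continuous_intros continuous_on_compose2[OF conjunct1[OF Suc]]) auto
      show "continuous_on {1/2..1} (\<lambda>t. a / (a + b) * p n (2 * t - 1) + b / (a + b))"
        by (intro continuous_intros continuous_on_compose2[OF conjunct1[OF Suc]]) auto
      show "b / (a + b) * p n (2 * t) = a / (a + b) * p n (2 * t - 1) + b / (a + b)"
        if "t \<in> {0..1/2}" "\<not> t \<le> 1/2" for t using that by auto
      show "b / (a + b) * p n (2 * t) = a / (a + b) * p n (2 * t - 1) + b / (a + b)"
        if "t \<in> {1/2..1}" "t \<le> 1/2" for t
      proof -
        have "2 * t = 1" using that by auto
        thus ?thesis using Suc by simp
      qed
    qed auto
    have "{0..1/2} \<union> {1/2..1} = {0..1::real}" by auto
    with c Suc ab show ?case unfolding p_Suc T_def by simp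
  qed
  have bd: "\<bar>p (Suc n) t - p n t\<bar> \<le> r ^ n" if "t \<in> {0..1}" for n t
    using that
  proof (induction n arbitrary: t)
    case 0
    show ?case
    proof (cases "t \<le> 1/2")
      case True
      have "b / (a + b) * (2 * t) \<le> 1 * 1" "0 \<le> b / (a + b) * (2 * t)"
        using True 0 assms by (intro mult_mono mult_nonneg_nonneg; simp)+
      thus ?thesis using True 0 by (simp add: p_def T_def abs_le_iff)
    next
      case False
      have "a / (a + b) * (2 * t - 1) \<le> a / (a + b) * 1" "0 \<le> a / (a + b) * (2 * t - 1)"
        using False 0 assms by (intro mult_left_mono mult_nonneg_nonneg; simp)+
      moreover have "0 \<le> b / (a + b)" using assms by simp
      ultimately have "a / (a + b) * (2 * t - 1) + b / (a + b) \<le> 1"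
        "0 \<le> a / (a + b) * (2 * t - 1) + b / (a + b)" using ab by linarith+
      thus ?thesis using False 0 unfolding p_def T_def abs_le_iff by simp
    qed
  next
    case (Suc n)
    show ?case
    proof (cases "t \<le> 1/2")
      case True
      have "p (Suc (Suc n)) t - p (Suc n) t = b / (a + b) * (p (Suc n) (2 * t) - p n (2 * t))"
        using True by (simp add: p_Suc[of "Suc n"] p_Suc[of n, THEN fun_cong, of t] T_def right_diff_distrib)
      hence "\<bar>p (Suc (Suc n)) t - p (Suc n) t\<bar> = b / (a + b) * \<bar>p (Suc n) (2 * t) - p n (2 * t)\<bar>"
        using assms by (simp add: abs_mult)
      also have "\<dots> \<le> r * r ^ n"
        using True Suc.prems r by (intro mult_mono Suc.IH) auto
      finally show ?thesis by simp
    next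
      case False
      have "p (Suc (Suc n)) t - p (Suc n) t
          = a / (a + b) * (p (Suc n) (2 * t - 1) - p n (2 * t - 1))"
        using False by (simp add: p_Suc[of "Suc n"] p_Suc[of n, THEN fun_cong, of t] T_def right_diff_distrib)
      hence "\<bar>p (Suc (Suc n)) t - p (Suc n) t\<bar>
          = a / (a + b) * \<bar>p (Suc n) (2 * t - 1) - p n (2 * t - 1)\<bar>"
        using assms by (simp add: abs_mult)
      also have "\<dots> \<le> r * r ^ n"
        using False Suc.prems r by (intro mult_mono Suc.IH) auto
      finally show ?thesis by simp
    qed
  qed
  have "uniform_limit {0..1} (\<lambda>n t. \<Sum>i<n. p (Suc i) t - p i t)
          (\<lambda>t. \<Sum>i. p (Suc i) t - p i t) sequentially"
    using bd r by (intro Weierstrass_m_test[where M = "\<lambda>n. r ^ n"]) (auto intro: summable_geometric)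
  hence "uniform_limit {0..1} (\<lambda>n t. p 0 t + (\<Sum>i<n. p (Suc i) t - p i t))
          (\<lambda>t. p 0 t + (\<Sum>i. p (Suc i) t - p i t)) sequentially"
    by (intro uniform_limit_intros)
  then obtain l where "uniform_limit {0..1} (\<lambda>n t. p 0 t + (\<Sum>i<n. p (Suc i) t - p i t)) l sequentially"
    by blast
  hence l: "uniform_limit {0..1} p l sequentially"
    by (simp add: sum_lessThan_telescope[where f = "\<lambda>i. p i _"])
  have pw: "(\<lambda>n. p n t) \<longlonglongrightarrow> l t" if "t \<in> {0..1}" for t
    using tendsto_uniform_limitI[OF l that] .
  have cont: "continuous_on {0..1} l"
    using inv by (intro uniform_limit_theorem[OF _ l]) auto
  have l01: "l 0 = 0" "l 1 = 1"
    using pw[of 0] pw[of 1] inv by (auto simp: LIMSEQ_const_iff)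
  have eq1: "l t = b / (a + b) * l (2 * t)" if t: "t \<in> {0..1/2}" for t
  proof (rule LIMSEQ_unique)
    show "(\<lambda>n. p (Suc n) t) \<longlonglongrightarrow> l t" using t by (intro LIMSEQ_Suc pw) auto
    have "(\<lambda>n. b / (a + b) * p n (2 * t)) \<longlonglongrightarrow> b / (a + b) * l (2 * t)"
      using t by (intro tendsto_intros pw) auto
    thus "(\<lambda>n. p (Suc n) t) \<longlonglongrightarrow> b / (a + b) * l (2 * t)"
      using t by (simp add: p_Suc T_def)
  qed
  have eq2: "l t = a / (a + b) * l (2 * t - 1) + b / (a + b)" if t: "t \<in> {1/2..1}" for t
  proof (cases "t = 1/2")
    case True
    hence "2 * t = 1" by simp
    thus ?thesis using eq1[of t] t l01 by simp
  next
    case False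
    show ?thesis
    proof (rule LIMSEQ_unique)
      show "(\<lambda>n. p (Suc n) t) \<longlonglongrightarrow> l t" using t by (intro LIMSEQ_Suc pw) auto
      have "(\<lambda>n. a / (a + b) * p n (2 * t - 1) + b / (a + b)) \<longlonglongrightarrow> a / (a + b) * l (2 * t - 1) + b / (a + b)"
        using t by (intro tendsto_intros pw) auto
      thus "(\<lambda>n. p (Suc n) t) \<longlonglongrightarrow> a / (a + b) * l (2 * t - 1) + b / (a + b)"
        using t False by (simp add: p_Suc T_def)
    qed
  qed
  show ?thesis using cont l01 eq1 eq2 unfolding is_phi_def by blast
qed

lemma is_phi_phi:
  assumes "0 < a" "0 < b"
  shows "is_phi a b (phi a b)"
proof -
  obtain \<psi> where \<psi>: "is_phi a b \<psi>" using is_phi_exists[OF assms] by blast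
  define \<phi> where "\<phi> = (\<lambda>t. if t \<in> {0..1} then \<psi> t else 0)"
  have eq: "\<phi> t = \<psi> t" if "t \<in> {0..1}" for t using that by (simp add: \<phi>_def)
  have "continuous_on {0..1} \<phi>"
    using \<psi> eq continuous_on_cong[OF refl, of "{0..1}" \<phi> \<psi>] by (simp add: is_phi_def)
  moreover have "\<phi> t = b / (a + b) * \<phi> (2 * t)" if "t \<in> {0..1/2}" for t
    using \<psi> that unfolding is_phi_def by (subst (1 2) eq) auto
  moreover have "\<phi> t = a / (a + b) * \<phi> (2 * t - 1) + b / (a + b)" if "t \<in> {1/2..1}" for t
    using \<psi> that unfolding is_phi_def by (subst (1 2) eq) auto
  moreover have "\<phi> 0 = 0" "\<phi> 1 = 1"
    using \<psi> by (simp_all add: eq is_phi_def)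
  moreover have "\<forall>t. t \<notin> {0..1} \<longrightarrow> \<phi> t = 0"
    by (simp add: \<phi>_def)
  ultimately have \<phi>: "is_phi a b \<phi> \<and> (\<forall>t. t \<notin> {0..1} \<longrightarrow> \<phi> t = 0)"
    unfolding is_phi_def by blast
  have "\<eta> = \<phi>" if "is_phi a b \<eta> \<and> (\<forall>t. t \<notin> {0..1} \<longrightarrow> \<eta> t = 0)" for \<eta>
  proof
    show "\<eta> t = \<phi> t" for t
      using is_phi_unique[OF assms, of \<eta> \<phi> t] that \<phi> by (cases "t \<in> {0..1}") auto
  qed
  with \<phi> have "is_phi a b (phi a b) \<and> (\<forall>t. t \<notin> {0..1} \<longrightarrow> phi a b t = 0)"
    unfolding phi_def by (rule theI)
  thus ?thesis ..
qed

text \<open>Meant for arguments \<open>x \<ge> 1\<close>: with \<open>x = n + t\<close>, where \<open>n\<close> is the integer part of \<open>x\<close>.\<close>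

definition interp :: "(real \<Rightarrow> real) \<Rightarrow> (nat \<Rightarrow> real) \<Rightarrow> real \<Rightarrow> real" where
  "interp \<phi> h x = (1 - \<phi> (frac x)) * h (nat \<lfloor>x\<rfloor>) + \<phi> (frac x) * h (nat \<lfloor>x\<rfloor> + 1)"

definition interp0 :: "(real \<Rightarrow> real) \<Rightarrow> (nat \<Rightarrow> real) \<Rightarrow> real \<Rightarrow> real" where
  "interp0 \<phi> h x = (if x < 1 then 0 else interp \<phi> h x)"

definition antiperiodic1 :: "(real \<Rightarrow> real) \<Rightarrow> bool" where
  "antiperiodic1 P \<longleftrightarrow> (\<forall>t. P (t + 1) = - P t)"

definition P0 :: "real \<Rightarrow> real \<Rightarrow> (real \<Rightarrow> real) \<Rightarrow> real \<Rightarrow> real \<Rightarrow> real" where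
  "P0 \<alpha> \<beta> \<phi> \<rho> t =
     (-1) powi \<lfloor>t\<rfloor> * (1 + (\<alpha> + \<beta> - 1) * \<phi> (2 powr frac t - 1)) * 2 powr (- \<rho> * frac t)"

definition Qterm :: "real \<Rightarrow> (real \<Rightarrow> real) \<Rightarrow> nat \<Rightarrow> real \<Rightarrow> real" where
  "Qterm \<rho> G m x = (- (2 powr - \<rho>)) ^ m * G (2 ^ m * x)"

definition Qfun :: "real \<Rightarrow> (real \<Rightarrow> real) \<Rightarrow> real \<Rightarrow> real" where
  "Qfun \<rho> G x = (\<Sum>m. Qterm \<rho> G (Suc m) x)"

text \<open>Possibly conditionally convergent series over all integers: both one-sided series have to
  converge.\<close>

definition bisummable :: "(int \<Rightarrow> real) \<Rightarrow> bool" where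
  "bisummable a \<longleftrightarrow> summable (\<lambda>n. a (int n)) \<and> summable (\<lambda>n. a (- int (Suc n)))"

definition bisum :: "(int \<Rightarrow> real) \<Rightarrow> real" where
  "bisum a = (\<Sum>n. a (int n)) + (\<Sum>n. a (- int (Suc n)))"

definition Pterm :: "real \<Rightarrow> (real \<Rightarrow> real) \<Rightarrow> real \<Rightarrow> int \<Rightarrow> real" where
  "Pterm \<rho> G t m =
     (-1) powi m * 2 powr (- \<rho> * (of_int m + t)) * G (2 powr (of_int m + t))"

definition chi' :: "int \<Rightarrow> complex" where
  "chi' k = complex_of_real (of_int (2 * k + 1) * pi / ln 2) * \<i>"

text \<open>\<open>Phat P k\<close> is the Fourier coefficient at the half-integer frequency \<open>k + 1/2\<close>.\<close>

definition Phat :: "(real \<Rightarrow> real) \<Rightarrow> int \<Rightarrow> complex" where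
  "Phat P k = integral {0..1}
     (\<lambda>t. complex_of_real (P t) * exp (- (of_int (2 * k + 1) * of_real pi * \<i> * of_real t)))"

definition has_improper_integral :: "(real \<Rightarrow> complex) \<Rightarrow> complex \<Rightarrow> real \<Rightarrow> bool" where
  "has_improper_integral h I c \<longleftrightarrow>
     (\<forall>X\<ge>c. h integrable_on {c..X}) \<and> ((\<lambda>X. integral {c..X} h) \<longlongrightarrow> I) at_top"

definition kernel_g :: "real \<Rightarrow> (real \<Rightarrow> real) \<Rightarrow> int \<Rightarrow> real \<Rightarrow> complex" where
  "kernel_g \<rho> G k u = of_real (G u) / of_real u powr (of_real \<rho> + chi' k + 1)"

definition kernel_1 ::
  "real \<Rightarrow> real \<Rightarrow> (real \<Rightarrow> real) \<Rightarrow> real \<Rightarrow> int \<Rightarrow> real \<Rightarrow> complex" where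
  "kernel_1 \<alpha> \<beta> \<phi> \<rho> k u =
     of_real (1 + (\<alpha> + \<beta> - 1) * \<phi> u) / of_real (1 + u) powr (of_real \<rho> + chi' k + 1)"

definition Amax :: "(nat \<Rightarrow> real) \<Rightarrow> nat \<Rightarrow> real" where
  "Amax g m = Max ((\<lambda>n. \<bar>g n\<bar>) ` {2 ^ m..2 ^ (m + 1)})"

definition Bmax :: "(nat \<Rightarrow> real) \<Rightarrow> nat \<Rightarrow> real" where
  "Bmax g m = Max ((\<lambda>n. \<bar>g (n + 1) - g n\<bar>) ` {2 ^ m..<2 ^ (m + 1)})"

definition Dterm :: "(nat \<Rightarrow> real) \<Rightarrow> complex \<Rightarrow> nat \<Rightarrow> complex" where
  "Dterm g s n =
     of_real (g n) * ((of_nat n - 1) powr - s - 2 * of_nat n powr - s + (of_nat n + 1) powr - s)"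

definition Dseries :: "(nat \<Rightarrow> real) \<Rightarrow> complex \<Rightarrow> complex" where
  "Dseries g s = (\<Sum>n. Dterm g s (n + 2))"

end

theory Submission
  imports Defs
begin

text \<open>Put \<open>c = \<alpha> + \<beta> = - 2\<^sup>\<rho>\<close>. The self-similarity of \<open>\<phi>\<close> is exactly what turns the recurrence into
  the functional equation \<open>F (2 x) = c F x + G (2 x)\<close> for real \<open>x \<ge> 1\<close>. Iterating it, the partial sums
  of \<open>Q\<close> at \<open>y \<in> [1,2]\<close> are \<open>c\<^sup>-\<^sup>N F (2\<^sup>N y) - F y\<close>, so their uniform convergence is the same as
  antiperiodic asymptotics of \<open>F\<close>, and \<open>F + Q\<close> satisfies the homogeneous equation, which gives \<open>P\<close>.
  The substitution \<open>u = 2\<^sup>t\<close> unrolls the Fourier coefficients of \<open>P\<close> into Mellin integrals of \<open>G\<close>.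
  The function \<open>\<phi>\<close> is monotone and Hoelder continuous, so under the condition on \<open>B\<^sub>m\<close> the function
  \<open>P\<close> is Hoelder continuous of bounded variation, and its Fourier series converges absolutely by
  Zygmund's theorem. For \<open>\<alpha> = \<beta>\<close> the function \<open>G\<close> is piecewise linear, and two integrations by
  parts turn its Mellin integral into the Dirichlet series \<open>D\<close>.\<close>

section \<open>The interpolating function\<close>

text \<open>The obstacle in (c) is that the Hoelder exponent of \<open>\<phi>\<close>, the binary
  logarithm of 1 / \<open>contraction\<close>, becomes arbitrarily small for unbalanced weights,
  whereas Hoelder continuity alone yields an absolutely convergent Fourier series only above the
  exponent 1/2. Monotonicity of \<open>\<phi>\<close> supplies bounded variation: in the square of
  an increment one factor is then summed by the variation and only the other is bounded by the
  modulus, so that any positive exponent is enough. In (a) no absolute integrability is at hand. Up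
  to a constant, the integral up to \<open>2 ^ n\<close> is an integral over {0..1} of a partial sum
  of the series for \<open>P\<close> times a character; these sums converge uniformly, and the piece
  up to the next power of 2 is small because \<open>G x / x powr \<rho>\<close> tends to 0. For odd
  multiples of pi as frequencies, the product with an antiperiodic function has period 1, so unit
  windows can be translated. Continuity enters between (i) and (ii), to move between integers and
  reals; for (iii) the comparison is made at the points \<open>2 ^ N * y\<close>, where
  antiperiodicity alone relates the values of the limit function, and continuity returns with
  \<open>P\<close>.\<close>

lemma is_phi_range:
  assumes ab: "0 < a" "0 < b" and phi: "is_phi a b \<phi>" and t: "t \<in> {0..1}"
  shows "0 \<le> \<phi> t" "\<phi> t \<le> 1"
proof -
  define p q where "p = a / (a + b)" and "q = b / (a + b)"
  have pq: "0 < p" "0 < q" "p = 1 - q"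
    using ab by (auto simp: p_def q_def field_simps)
  have cont: "continuous_on {0..1} \<phi>" and \<phi>01: "\<phi> 0 = 0" "\<phi> 1 = 1"
    and L: "\<And>t. t \<in> {0..1/2} \<Longrightarrow> \<phi> t = q * \<phi> (2 * t)"
    and R: "\<And>t. t \<in> {1/2..1} \<Longrightarrow> \<phi> t = p * \<phi> (2 * t - 1) + q"
    using phi unfolding is_phi_def p_def q_def by blast+
  \<comment> \<open>Maximum principle: at a maximiser \<open>u\<close>, one use of the
    self-similarity together with \<open>\<phi> (2 * u) \<le> \<phi> u\<close> or
    \<open>\<phi> (2 * u - 1) \<le> \<phi> u\<close> leaves an inequality for
    \<open>\<phi> u\<close> alone. The minimiser \<open>l\<close> is treated alike.\<close>
  obtain u where u: "u \<in> {0..1}" "\<And>t. t \<in> {0..1} \<Longrightarrow> \<phi> t \<le> \<phi> u"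
    using continuous_attains_sup[OF compact_Icc _ cont] by auto
  obtain l where l: "l \<in> {0..1}" "\<And>t. t \<in> {0..1} \<Longrightarrow> \<phi> l \<le> \<phi> t"
    using continuous_attains_inf[OF compact_Icc _ cont] by auto
  have "\<phi> u \<le> 1"
  proof (cases "u \<le> 1/2")
    case True
    have "\<phi> u \<le> q * \<phi> u"
      using True u pq by (subst L) (auto intro!: mult_left_mono u(2))
    hence "p * \<phi> u \<le> 0" by (simp add: pq(3) algebra_simps)
    hence "\<phi> u \<le> 0" using pq by (simp add: mult_le_0_iff)
    thus ?thesis by simp
  next
    case False
    have "\<phi> u \<le> p * \<phi> u + q"
      using False u pq by (subst R) (auto intro!: mult_left_mono u(2))
    hence "q * \<phi> u \<le> q * 1" by (simp add: pq(3) algebra_simps)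
    thus ?thesis using pq by (subst (asm) mult_le_cancel_left_pos) auto
  qed
  moreover have "0 \<le> \<phi> l"
  proof (cases "l \<le> 1/2")
    case True
    have "q * \<phi> l \<le> \<phi> l"
      using True l pq by (subst (2) L) (auto intro!: mult_left_mono l(2))
    hence "p * \<phi> l \<ge> 0" by (simp add: pq(3) algebra_simps)
    thus ?thesis using pq by (simp add: zero_le_mult_iff)
  next
    case False
    have "p * \<phi> l + q \<le> \<phi> l"
      using False l pq by (subst (2) R) (auto intro!: mult_left_mono l(2))
    hence "q * 1 \<le> q * \<phi> l" by (simp add: pq(3) algebra_simps)
    hence "1 \<le> \<phi> l" using pq by (subst (asm) mult_le_cancel_left_pos) auto
    thus ?thesis by simp
  qed
  ultimately show "0 \<le> \<phi> t" "\<phi> t \<le> 1" using u(2)[OF t] l(2)[OF t] by auto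
qed

text \<open>Both remaining regularity properties iterate the self-similarity of \<open>\<phi>\<close>: every halving of
  the scale contracts differences by the factor \<open>max a b / (a + b) < 1\<close>.\<close>

lemma is_phi_mono:
  assumes ab: "0 < a" "0 < b" and phi: "is_phi a b \<phi>"
    and xy: "0 \<le> x" "x \<le> y" "y \<le> 1"
  shows "\<phi> x \<le> \<phi> y"
proof -
  define p q r where "p = a / (a + b)" and "q = b / (a + b)" and "r = max a b / (a + b)"
  have pq: "0 < p" "0 < q" "p = 1 - q" "r < 1" "0 < r"
    using ab by (auto simp: p_def q_def r_def field_simps max_def)
  have pqr: "p \<le> r" "q \<le> r"
    using ab unfolding p_def q_def r_def by (auto intro!: divide_right_mono)
  have L: "\<And>t. t \<in> {0..1/2} \<Longrightarrow> \<phi> t = q * \<phi> (2 * t)"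
    and R: "\<And>t. t \<in> {1/2..1} \<Longrightarrow> \<phi> t = p * \<phi> (2 * t - 1) + q"
    using phi unfolding is_phi_def p_def q_def by blast+
  note range = is_phi_range[OF ab phi]
  \<comment> \<open>A possible failure of monotonicity is pushed to ever finer scales; when the
    points lie on different sides of 1/2, their values are separated by \<open>q\<close> and there
    is no failure.\<close>
  have *: "\<phi> x - \<phi> y \<le> r ^ n" if "0 \<le> x" "x \<le> y" "y \<le> 1" for x y n
    using that
  proof (induction n arbitrary: x y)
    case 0
    thus ?case using range(2)[of x] range(1)[of y] by simp
  next
    case (Suc n)
    consider "y \<le> 1/2" | "1/2 \<le> x" | "x < 1/2" "1/2 < y" by linarith
    thus ?case
    proof cases
      case 1
      have "\<phi> x - \<phi> y = q * (\<phi> (2*x) - \<phi> (2*y))"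
        using 1 Suc.prems by (subst (1 2) L) (auto simp: algebra_simps)
      also have "\<dots> \<le> q * r ^ n" using 1 Suc.prems pq by (intro mult_left_mono Suc.IH) auto
      also have "\<dots> \<le> r * r ^ n" using pq pqr by (intro mult_right_mono) auto
      finally show ?thesis by simp
    next
      case 2
      have "\<phi> x - \<phi> y = p * (\<phi> (2*x-1) - \<phi> (2*y-1))"
        using 2 Suc.prems by (subst (1 2) R) (auto simp: algebra_simps)
      also have "\<dots> \<le> p * r ^ n" using 2 Suc.prems pq by (intro mult_left_mono Suc.IH) auto
      also have "\<dots> \<le> r * r ^ n" using pq pqr by (intro mult_right_mono) auto
      finally show ?thesis by simp
    next
      case 3
      have "\<phi> x \<le> q * 1"
        using 3 Suc.prems pq range(2) by (subst L) (auto intro!: mult_left_mono)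
      moreover have "\<phi> y \<ge> p * 0 + q"
        using 3 Suc.prems pq range(1)
        by (subst R) (auto simp del: mult_zero_right intro!: add_mono mult_left_mono)
      ultimately have "\<phi> x - \<phi> y \<le> 0" by simp
      also have "0 \<le> r ^ Suc n" using pq by simp
      finally show ?thesis .
    qed
  qed
  have "(\<lambda>n. r ^ n) \<longlonglongrightarrow> 0" using pq by (intro LIMSEQ_power_zero) auto
  hence "\<phi> x - \<phi> y \<le> 0"
    by (rule LIMSEQ_le_const) (use *[OF xy] in auto)
  thus ?thesis by simp
qed

lemma is_phi_modulus:
  assumes ab: "0 < a" "0 < b" and phi: "is_phi a b \<phi>"
    and xy: "x \<in> {0..1}" "y \<in> {0..1}" "\<bar>x - y\<bar> \<le> 1 / 2 ^ n"
  shows "\<bar>\<phi> x - \<phi> y\<bar> \<le> 2 * (max a b / (a + b)) ^ n"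
proof -
  define p q r where "p = a / (a + b)" and "q = b / (a + b)" and "r = max a b / (a + b)"
  have pq: "0 < p" "0 < q" "p = 1 - q" "r < 1" "0 < r"
    using ab by (auto simp: p_def q_def r_def field_simps max_def)
  have pqr: "p \<le> r" "q \<le> r"
    using ab unfolding p_def q_def r_def by (auto intro!: divide_right_mono)
  have \<phi>01: "\<phi> 0 = 0" "\<phi> 1 = 1"
    and L: "\<And>t. t \<in> {0..1/2} \<Longrightarrow> \<phi> t = q * \<phi> (2 * t)"
    and R: "\<And>t. t \<in> {1/2..1} \<Longrightarrow> \<phi> t = p * \<phi> (2 * t - 1) + q"
    using phi unfolding is_phi_def p_def q_def by blast+
  note range = is_phi_range[OF ab phi]
  have half: "(1::real) / 2 ^ Suc n \<le> 1/2" for n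
    by (simp add: field_simps)
  \<comment> \<open>At the two ends of the interval the modulus holds with constant 1. A pair
    straddling 1/2 is split there into two such ends, which is why the constant 2 does not grow with
    the level.\<close>
  have lo: "\<phi> x \<le> r ^ n" if "0 \<le> x" "x \<le> 1 / 2 ^ n" for x n
    using that
  proof (induction n arbitrary: x)
    case (Suc n)
    have "x \<le> 1/2" using Suc.prems half[of n] by linarith
    hence "\<phi> x = q * \<phi> (2 * x)" using Suc.prems by (intro L) auto
    also have "\<dots> \<le> r * r ^ n"
      using pq pqr Suc.prems \<open>x \<le> 1/2\<close> range(1)
      by (intro mult_mono Suc.IH) (auto simp: field_simps)
    finally show ?case by simp
  qed (use range in auto)
  have hi: "1 - \<phi> x \<le> r ^ n" if "x \<le> 1" "1 - x \<le> 1 / 2 ^ n" for x n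
    using that
  proof (induction n arbitrary: x)
    case (Suc n)
    have "x \<ge> 1/2" using Suc.prems half[of n] by linarith
    hence "1 - \<phi> x = p * (1 - \<phi> (2 * x - 1))"
      using Suc.prems pq by (subst R) (auto simp: algebra_simps)
    also have "\<dots> \<le> r * r ^ n"
      using pq pqr Suc.prems \<open>x \<ge> 1/2\<close> range(2)
      by (intro mult_mono Suc.IH) (auto simp: field_simps)
    finally show ?case by simp
  qed (use range in auto)
  have *: "\<phi> y - \<phi> x \<le> 2 * r ^ n" if "0 \<le> x" "x \<le> y" "y \<le> 1" "y - x \<le> 1 / 2 ^ n" for x y n
    using that
  proof (induction n arbitrary: x y)
    case 0
    thus ?case using range(2)[of y] range(1)[of x] by simp
  next
    case (Suc n)
    consider "y \<le> 1/2" | "1/2 \<le> x" | "x < 1/2" "1/2 < y" by linarith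
    thus ?case
    proof cases
      case 1
      have "\<phi> y - \<phi> x = q * (\<phi> (2*y) - \<phi> (2*x))"
        using 1 Suc.prems by (subst (1 2) L) (auto simp: algebra_simps)
      also have "\<dots> \<le> q * (2 * r ^ n)"
        using 1 Suc.prems pq by (intro mult_left_mono Suc.IH) (auto simp: field_simps)
      also have "\<dots> \<le> r * (2 * r ^ n)" using pq pqr by (intro mult_right_mono) auto
      finally show ?thesis by simp
    next
      case 2
      have "\<phi> y - \<phi> x = p * (\<phi> (2*y-1) - \<phi> (2*x-1))"
        using 2 Suc.prems by (subst (1 2) R) (auto simp: algebra_simps)
      also have "\<dots> \<le> p * (2 * r ^ n)"
        using 2 Suc.prems pq by (intro mult_left_mono Suc.IH) (auto simp: field_simps)
      also have "\<dots> \<le> r * (2 * r ^ n)" using pq pqr by (intro mult_right_mono) auto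
      finally show ?thesis by simp
    next
      case 3
      have "\<phi> y - \<phi> x = p * \<phi> (2*y-1) + q * (1 - \<phi> (2*x))"
        using 3 Suc.prems by (subst L[of x], simp, subst R[of y]) (auto simp: algebra_simps)
      also have "\<dots> \<le> r * r ^ n + r * r ^ n"
      proof -
        define e :: real where "e = 1 / 2 ^ n"
        have "2 * y - 2 * x \<le> e" using Suc.prems by (simp add: e_def field_simps)
        hence "2 * y - 1 \<le> e" "1 - 2 * x \<le> e" using 3 by linarith+
        note this[unfolded e_def]
        with 3 Suc.prems pq pqr range show ?thesis
          by (intro add_mono mult_mono lo hi) auto
      qed
      finally show ?thesis by simp
    qed
  qed
  show ?thesis
  proof (cases "x \<le> y")
    case True
    thus ?thesis using *[of x y n] is_phi_mono[OF ab phi, of x y] xy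
      unfolding r_def[symmetric] by auto
  next
    case False
    thus ?thesis using *[of y x n] is_phi_mono[OF ab phi, of y x] xy
      unfolding r_def[symmetric] by auto
  qed
qed

lemma is_phi_equal_weights:
  assumes "0 < a" "is_phi a a \<phi>" "t \<in> {0..1}"
  shows "\<phi> t = t"
  using assms by (intro is_phi_unique[OF assms(1,1,2), of "\<lambda>t. t"]) (auto simp: is_phi_def field_simps)

section \<open>Antiperiodic functions, dyadic scaling and interpolation\<close>

lemma smallo_one_iff: "h \<in> o[F](\<lambda>_. 1 :: real) \<longleftrightarrow> (h \<longlongrightarrow> 0) F"
  for h :: "'a \<Rightarrow> real"
  using smalloI_tendsto[of h "\<lambda>_. 1" F] smalloD_tendsto[of h F "\<lambda>_. 1"] by auto

lemma antiperiodic1_add_int: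
  assumes "antiperiodic1 R"
  shows "R (t + of_int k) = (-1) powi k * R t"
proof (induction k rule: int_induct[of _ 0])
  case (step1 i)
  have "R (t + of_int (i + 1)) = - R (t + of_int i)"
    using assms by (simp add: antiperiodic1_def flip: add.assoc)
  thus ?case using step1 by (simp add: power_int_add)
next
  case (step2 i)
  have "R (t + of_int i) = - R (t + of_int (i - 1))"
    using assms[unfolded antiperiodic1_def, rule_format, of "t + of_int (i - 1)"]
    by (simp add: algebra_simps)
  thus ?case using step2 by (simp add: power_int_diff)
qed auto

lemma antiperiodic1_add_nat:
  assumes "antiperiodic1 R"
  shows "R (t + real n) = (-1) ^ n * R t"
  using antiperiodic1_add_int[OF assms, of t "int n"] by simp

lemma abs_minus_one_power_int [simp]: "\<bar>(-1) powi k\<bar> = (1 :: 'a :: linordered_field)"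
  by (simp add: power_int_abs)

text \<open>The match at the seam, \<open>R 1 = - R 0\<close>, is antiperiodicity itself: the
  translated piece on {-1..0} glues to the piece on {0..1}, and every point is moved by an integer
  into the interior of {-1..1}.\<close>

lemma antiperiodic1_continuous:
  assumes R: "antiperiodic1 R" and cont: "continuous_on {0..1} R"
  shows "continuous_on UNIV R"
proof -
  have "continuous_on {-1..0} (\<lambda>t. - R (t + 1))"
    by (intro continuous_intros continuous_on_compose2[OF cont]) auto
  hence "continuous_on {-1..0} R"
    using R by (simp add: antiperiodic1_def)
  hence "continuous_on ({-1..0} \<union> {0..1}) R"
    using cont by (intro continuous_on_closed_Un) auto
  moreover have "{-1..0} \<union> {0..1} = {-1..1::real}" by auto
  ultimately have c: "continuous_on {-1..1} R" by simp
  have "isCont R t" for t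
  proof -
    define k where "k = \<lfloor>t\<rfloor>"
    have "t - k \<in> {-1<..<1}" unfolding k_def greaterThanLessThan_iff by linarith
    hence "isCont R (t - k)"
      by (intro continuous_on_interior[OF c]) auto
    hence "isCont (\<lambda>u. (-1) powi k * R (u - k)) t"
      by (intro continuous_mult continuous_const isCont_o2[where f = "\<lambda>u. u - real_of_int k" and g = R]) auto
    moreover have "(\<lambda>u. (-1) powi k * R (u - real_of_int k)) = R"
    proof
      show "(-1) powi k * R (u - real_of_int k) = R u" for u
        using antiperiodic1_add_int[OF R, of "u - real_of_int k" k] by simp
    qed
    ultimately show ?thesis by simp
  qed
  thus ?thesis by (simp add: continuous_at_imp_continuous_on)
qed

lemma antiperiodic1_bounded:
  assumes R: "antiperiodic1 R" and cont: "continuous_on UNIV R"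
  shows "\<exists>M>0. \<forall>t. \<bar>R t\<bar> \<le> M"
proof -
  have "bounded (R ` {0..1})"
    by (intro compact_imp_bounded compact_continuous_image continuous_on_subset[OF cont]) auto
  then obtain M where M: "M > 0" "\<And>t. t \<in> {0..1} \<Longrightarrow> \<bar>R t\<bar> \<le> M"
    unfolding bounded_pos by auto
  have "\<bar>R t\<bar> \<le> M" for t
  proof -
    have "\<bar>R t\<bar> = \<bar>R (frac t)\<bar>"
      using antiperiodic1_add_int[OF R, of "frac t" "\<lfloor>t\<rfloor>"] by (simp add: frac_def abs_mult)
    also have "\<dots> \<le> M" using frac_lt_1[of t] by (intro M) auto
    finally show ?thesis .
  qed
  thus ?thesis using M by blast
qed

lemma antiperiodic1_uniformly_continuous:
  assumes R: "antiperiodic1 R" and cont: "continuous_on UNIV R"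
  shows "uniformly_continuous_on UNIV R"
  unfolding uniformly_continuous_on_def
proof (intro allI impI)
  fix e :: real assume "e > 0"
  \<comment> \<open>A common integer shift brings two points at distance below 1 into {0..2}, and it
    changes the difference of the values at most by a sign.\<close>
  have "uniformly_continuous_on {0..2} R"
    by (intro compact_uniformly_continuous continuous_on_subset[OF cont]) auto
  then obtain d where d: "d > 0"
    "\<And>x x'. x \<in> {0..2} \<Longrightarrow> x' \<in> {0..2} \<Longrightarrow> dist x' x < d \<Longrightarrow> dist (R x') (R x) < e"
    using \<open>e > 0\<close> unfolding uniformly_continuous_on_def by metis
  have *: "dist (R x') (R x) < e" if "x \<le> x'" "dist x' x < min d 1" for x x'
  proof -
    define k where "k = \<lfloor>x\<rfloor>"
    have "x - k \<in> {0..2}" "x' - k \<in> {0..2}"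
      using that unfolding k_def dist_real_def atLeastAtMost_iff by linarith+
    hence "dist (R (x' - k)) (R (x - k)) < e"
      using that by (intro d) (auto simp: dist_real_def)
    moreover have "R x' - R x = (-1) powi k * (R (x' - k) - R (x - k))"
      using antiperiodic1_add_int[OF R, of "x' - real_of_int k" k]
        antiperiodic1_add_int[OF R, of "x - real_of_int k" k] by (simp add: right_diff_distrib)
    hence "\<bar>R x' - R x\<bar> = \<bar>R (x' - k) - R (x - k)\<bar>"
      by (simp add: abs_mult)
    ultimately show ?thesis by (simp add: dist_real_def)
  qed
  show "\<exists>d>0. \<forall>x\<in>UNIV. \<forall>x'\<in>UNIV. dist x' x < d \<longrightarrow> dist (R x') (R x) < e"
  proof (intro exI[of _ "min d 1"] conjI ballI impI)
    fix x x' :: real assume "dist x' x < min d 1"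
    thus "dist (R x') (R x) < e"
      using *[of x x'] *[of x' x] by (cases "x \<le> x'") (auto simp: dist_commute)
  qed (use d in auto)
qed

text \<open>Along \<open>x = 2 powr (t + n)\<close> the modulus of \<open>R\<close> is constant.
  Applied to a difference, this makes the limit function unique.\<close>

lemma antiperiodic1_tendsto_0:
  assumes R: "antiperiodic1 R" and lim: "((\<lambda>x. R (log 2 x)) \<longlongrightarrow> 0) at_top"
  shows "R t = 0"
proof -
  have "filterlim (\<lambda>n. 2 powr t * 2 ^ n :: real) at_top sequentially"
    by (intro filterlim_tendsto_pos_mult_at_top[OF tendsto_const] filterlim_at_infinity_imp_filterlim_at_top
          filterlim_realpow_sequentially_gt1) auto
  hence "(\<lambda>n. R (log 2 (2 powr t * 2 ^ n))) \<longlonglongrightarrow> 0"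
    by (rule filterlim_compose[OF lim])
  hence "(\<lambda>n. \<bar>R (log 2 (2 powr t * 2 ^ n))\<bar>) \<longlonglongrightarrow> 0"
    by (simp only: tendsto_rabs_zero_iff)
  moreover have "\<bar>R (log 2 (2 powr t * 2 ^ n))\<bar> = \<bar>R t\<bar>" for n
    using antiperiodic1_add_nat[OF R, of t n] by (simp add: log_mult log_nat_power abs_mult)
  ultimately show ?thesis by (simp add: LIMSEQ_const_iff)
qed

lemma dyadic_decomposition:
  fixes x :: real
  assumes "1 \<le> x"
  obtains N y where "y \<in> {1..<2}" "x = 2 ^ N * y"
proof -
  define N where "N = nat \<lfloor>log 2 x\<rfloor>"
  have "0 \<le> log 2 x" using assms by simp
  hence N: "real N \<le> log 2 x" "log 2 x < real N + 1" unfolding N_def by linarith+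
  have "2 powr real N \<le> x" using N(1) assms by (subst (asm) le_log_iff) auto
  moreover have "x < 2 powr (real N + 1)" using N(2) assms by (subst (asm) log_less_iff) auto
  ultimately show ?thesis
    by (intro that[of "x / 2 ^ N" N]) (auto simp: powr_add powr_realpow field_simps)
qed

lemma dyadic_induct [consumes 1, case_names base double]:
  fixes x :: real
  assumes "1 \<le> x" "\<And>y. y \<in> {1..2} \<Longrightarrow> Pr y" "\<And>y. 1 \<le> y \<Longrightarrow> Pr y \<Longrightarrow> Pr (2 * y)"
  shows "Pr x"
proof -
  obtain N y where y: "y \<in> {1..<2}" "x = 2 ^ N * y"
    using dyadic_decomposition[OF assms(1)] .
  have "Pr (2 ^ N * y)"
  proof (induction N)
    case (Suc N)
    have "1 * 1 \<le> 2 ^ N * y" using y by (intro mult_mono) auto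
    thus ?case using assms(3)[of "2 ^ N * y"] Suc by (simp add: mult.assoc)
  qed (use y assms(2) in auto)
  thus ?thesis using y by simp
qed

text \<open>The shift moves the single term \<open>a 0\<close> from one one-sided series to the
  other. This is the source of the antiperiodicity of \<open>P\<close>.\<close>

lemma bisummable_shift:
  assumes "bisummable a"
  shows "bisummable (\<lambda>m. a (m + 1))" "bisum (\<lambda>m. a (m + 1)) = bisum a"
proof -
  have p: "summable (\<lambda>n. a (int n))" and n: "summable (\<lambda>n. a (- int (Suc n)))"
    using assms by (auto simp: bisummable_def)
  have p1: "(\<lambda>n. a (int (Suc n))) sums (suminf (\<lambda>n. a (int n)) - a 0)"
    using p by (subst sums_Suc_iff) (auto simp: summable_sums)
  have n1: "(\<lambda>n. a (- int n)) sums (suminf (\<lambda>n. a (- int (Suc n))) + a 0)"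
    using summable_sums[OF n] by (subst (asm) sums_Suc_iff) auto
  have e: "(\<lambda>n. a (int n + 1)) = (\<lambda>n. a (int (Suc n)))"
      "(\<lambda>n. a (- int (Suc n) + 1)) = (\<lambda>n. a (- int n))"
    by (auto simp: add.commute)
  show "bisummable (\<lambda>m. a (m + 1))" "bisum (\<lambda>m. a (m + 1)) = bisum a"
    using p1 n1 unfolding bisummable_def bisum_def e by (auto simp: sums_iff)
qed

lemma bisummable_unshift:
  assumes "bisummable (\<lambda>m. a (m + 1))"
  shows "bisummable a"
proof -
  have e: "(\<lambda>n. a (int n + 1)) = (\<lambda>n. a (int (Suc n)))"
      "(\<lambda>n. a (- int (Suc n) + 1)) = (\<lambda>n. a (- int n))"
    by (auto simp: add.commute)
  have "summable (\<lambda>n. a (int (Suc n)))" "summable (\<lambda>n. a (- int n))"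
    using assms unfolding bisummable_def e by auto
  thus ?thesis
    unfolding bisummable_def
    using summable_Suc_iff[of "\<lambda>n. a (int n)"] summable_Suc_iff[of "\<lambda>n. a (- int n)"] by simp
qed

lemma bisummable_uminus:
  assumes "bisummable a"
  shows "bisummable (\<lambda>m. - a m)" "bisum (\<lambda>m. - a m) = - bisum a"
  using assms unfolding bisummable_def bisum_def
  by (auto intro: summable_minus simp: suminf_minus)

text \<open>At \<open>t = 1\<close> the integer part in \<open>interp\<close> already jumps to
  \<open>n + 1\<close>; the values of \<open>\<phi>\<close> at 0 and 1 make both readings agree, so
  the formula holds on the closed cell. Continuity and the doubling equation are glued from closed
  cells.\<close>

lemma interp_add:
  assumes "\<phi> 0 = 0" "\<phi> 1 = 1" "t \<in> {0..1}"
  shows "interp \<phi> h (real n + t) = (1 - \<phi> t) * h n + \<phi> t * h (n + 1)"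
proof (cases "t = 1")
  case True
  have "\<lfloor>real n + 1\<rfloor> = int n + 1" by simp
  hence "nat \<lfloor>real n + 1\<rfloor> = n + 1" by linarith
  thus ?thesis using True assms by (simp add: interp_def frac_def)
next
  case False
  hence "\<lfloor>real n + t\<rfloor> = int n" using assms by (intro floor_unique) auto
  thus ?thesis by (simp add: interp_def frac_def)
qed

lemma interp_of_nat: "\<phi> 0 = 0 \<Longrightarrow> interp \<phi> h (real n) = h n"
  by (simp add: interp_def frac_def)

lemma continuous_on_interp:
  assumes "\<phi> 0 = 0" "\<phi> 1 = 1" "continuous_on {0..1} \<phi>"
  shows "continuous_on {0..} (interp \<phi> h)"
proof -
  have piece: "continuous_on {real n..real (Suc n)} (interp \<phi> h)" for n
  proof -
    have "continuous_on {real n..real (Suc n)}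
        (\<lambda>x. (1 - \<phi> (x - real n)) * h n + \<phi> (x - real n) * h (n + 1))"
      by (intro continuous_intros continuous_on_compose2[OF assms(3)]) auto
    moreover have "interp \<phi> h x = (1 - \<phi> (x - real n)) * h n + \<phi> (x - real n) * h (n + 1)"
      if "x \<in> {real n..real (Suc n)}" for x
      using interp_add[OF assms(1,2), of "x - real n" h n] that by simp
    ultimately show ?thesis by (subst continuous_on_cong[OF refl])
  qed
  have fin: "continuous_on {0..real N} (interp \<phi> h)" for N
  proof (induction N)
    case (Suc N)
    have "continuous_on ({0..real N} \<union> {real N..real (Suc N)}) (interp \<phi> h)"
      by (intro continuous_on_closed_Un Suc piece) auto
    moreover have "{0..real N} \<union> {real N..real (Suc N)} = {0..real (Suc N)}" by auto
    ultimately show ?case by simp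
  qed auto
  show ?thesis
    unfolding continuous_on_eq_continuous_within
  proof
    fix x :: real assume x: "x \<in> {0..}"
    obtain N where N: "x < real N" using reals_Archimedean2 by blast
    have "at x within {0..} = at x within {0..real N}"
      using N by (intro at_within_nhd[of x "{..<real N}"]) auto
    moreover have "continuous (at x within {0..real N}) (interp \<phi> h)"
      using fin[of N] x N by (auto simp: continuous_on_eq_continuous_within)
    ultimately show "continuous (at x within {0..}) (interp \<phi> h)" by simp
  qed
qed

lemma one_minus_powr_le: "1 - 2 powr (- x) \<le> x" if "0 \<le> x" for x :: real
proof -
  have "1 + - (x * ln 2) \<le> exp (- (x * ln 2))" by (rule exp_ge_add_one_self)
  moreover have "x * ln 2 \<le> x * 1" using that ln_2_less_1 by (intro mult_left_mono) auto
  ultimately show ?thesis by (simp add: powr_def)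
qed

section \<open>Fourier series at half-integer frequencies\<close>

definition half_char :: "int \<Rightarrow> real \<Rightarrow> complex" where
  "half_char k t = exp (of_int (2 * k + 1) * of_real pi * \<i> * of_real t)"

text \<open>Stated for complex functions, because the arguments below multiply by exponentials and
  work with the sum of the Fourier series itself.\<close>

definition half_coeff :: "(real \<Rightarrow> complex) \<Rightarrow> int \<Rightarrow> complex" where
  "half_coeff q k = integral {0..1} (\<lambda>t. q t * half_char k (- t))"

lemma Phat_eq_half_coeff: "Phat R k = half_coeff (\<lambda>t. of_real (R t)) k"
  by (simp add: Phat_def half_coeff_def half_char_def)

lemma continuous_on_half_char [continuous_intros]:
  "continuous_on A h \<Longrightarrow> continuous_on A (\<lambda>t. half_char k (h t))"
  unfolding half_char_def by (intro continuous_intros)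

lemma half_char_add: "half_char k (s + t) = half_char k s * half_char k t"
  by (simp add: half_char_def algebra_simps exp_add)

lemma half_char_eq_cis: "half_char k t = cis (of_int (2 * k + 1) * pi * t)"
  by (simp add: half_char_def cis_conv_exp mult_ac)

lemma norm_half_char [simp]: "norm (half_char k t) = 1"
  by (simp add: half_char_eq_cis)

lemma cnj_half_char: "cnj (half_char k t) = half_char k (- t)"
  by (simp add: half_char_eq_cis cis_cnj)

lemma half_char_0 [simp]: "half_char k 0 = 1"
  by (simp add: half_char_eq_cis)

lemma half_char_1 [simp]: "half_char k 1 = -1"
proof -
  have "half_char k 1 = cis (of_int (2 * k) * pi) * cis pi"
    unfolding half_char_eq_cis cis_mult by (simp add: algebra_simps)
  also have "cis (of_int (2 * k) * pi) = 1"
    using cis_multiple_2pi[of "of_int k"] by (simp add: mult_ac)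
  finally show ?thesis by simp
qed

lemma half_char_add_1: "half_char k (t + 1) = - half_char k t"
  by (simp add: half_char_add)

lemma half_char_minus_1: "half_char k (- 1) = -1"
  using half_char_add[of k "1" "-1"] by (simp add: equation_minus_iff)

lemma half_char_mult_shift: "half_char k t * cis (2 * pi * t) = half_char (k + 1) t"
  by (simp add: half_char_eq_cis cis_mult algebra_simps)

lemma half_char_mult_shift': "half_char k t * cis (- (2 * pi * t)) = half_char (k - 1) t"
  by (simp add: half_char_eq_cis cis_mult algebra_simps)

text \<open>The difference of two odd frequencies is even, so the product of the characters has
  period 1 and, for \<open>k \<noteq> l\<close>, its antiderivative takes the same value at both
  ends.\<close>

lemma half_char_orthonormal:
  "((\<lambda>t. half_char k t * half_char l (- t)) has_integral (if k = l then 1 else 0)) {0..1}"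
proof (cases "k = l")
  case True
  have "(\<lambda>t. half_char k t * half_char l (- t)) = (\<lambda>_. 1)"
    using True by (auto simp flip: half_char_add)
  thus ?thesis using True has_integral_const_real[of "1::complex" 0 1] by simp
next
  case False
  define w :: complex where "w = of_int (2 * (k - l)) * of_real pi * \<i>"
  have w: "w \<noteq> 0" using False by (simp add: w_def)
  have eq: "half_char k t * half_char l (- t) = exp (w * of_real t)" for t
    by (simp add: half_char_def w_def algebra_simps flip: exp_add)
  have "exp w = cis (2 * pi * of_int (k - l))" by (simp add: w_def cis_conv_exp mult_ac)
  hence ew: "exp w = 1" by (simp add: complex_eq_iff cos_int_2pin sin_int_2pin)
  have "((\<lambda>t. exp (w * of_real t)) has_integral (exp (w * of_real 1) / w - exp (w * of_real 0) / w)) {0..1}"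
  proof (rule fundamental_theorem_of_calculus)
    fix t :: real assume "t \<in> {0..1}"
    have "((\<lambda>z. exp (w * z) / w) has_field_derivative exp (w * of_real t)) (at (of_real t))"
      using w by (auto intro!: derivative_eq_intros)
    from has_vector_derivative_real_field[OF this]
    show "((\<lambda>t. exp (w * of_real t) / w) has_vector_derivative exp (w * of_real t)) (at t within {0..1})"
      by (rule has_vector_derivative_at_within)
  qed auto
  thus ?thesis using False by (simp add: ew eq)
qed

lemma half_coeff_has_integral:
  assumes "continuous_on {0..1} q"
  shows "((\<lambda>t. q t * half_char k (- t)) has_integral half_coeff q k) {0..1}"
  unfolding half_coeff_def using assms
  by (intro integrable_integral integrable_continuous_real continuous_intros)

text \<open>Expand the integral of \<open>(norm (q t - s t))\<^sup>2\<close> for the partial sum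
  \<open>s\<close>: the two mixed integrals and the integral of \<open>s\<close> against its
  conjugate all equal \<open>S\<close>, so what remains is \<open>Iq - S\<close>.\<close>

lemma bessel_inequality:
  assumes q: "continuous_on {0..1} q" and K: "finite K"
  shows "(\<Sum>k\<in>K. (norm (half_coeff q k))\<^sup>2) \<le> integral {0..1} (\<lambda>t. (norm (q t))\<^sup>2)"
proof -
  define a where "a = half_coeff q"
  define s where "s = (\<lambda>t. \<Sum>k\<in>K. a k * half_char k t)"
  define S where "S = (\<Sum>k\<in>K. (norm (a k))\<^sup>2)"
  have sq: "z * cnj z = of_real ((norm z)\<^sup>2)" for z :: complex
    by (rule complex_norm_square[symmetric])
  have cs: "continuous_on {0..1} s" unfolding s_def by (intro continuous_intros)
  have cnj_s: "cnj (s t) = (\<Sum>k\<in>K. cnj (a k) * half_char k (- t))" for t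
    by (simp add: s_def cnj_half_char)
  have qs: "((\<lambda>t. q t * cnj (s t)) has_integral of_real S) {0..1}"
  proof -
    have "((\<lambda>t. \<Sum>k\<in>K. cnj (a k) * (q t * half_char k (- t))) has_integral (\<Sum>k\<in>K. cnj (a k) * a k)) {0..1}"
      unfolding a_def
      by (intro has_integral_sum K has_integral_mult_right half_coeff_has_integral q)
    also have "(\<Sum>k\<in>K. cnj (a k) * a k) = of_real S"
      by (simp add: S_def mult.commute[of "cnj _"] sq)
    also have "(\<lambda>t. \<Sum>k\<in>K. cnj (a k) * (q t * half_char k (- t))) = (\<lambda>t. q t * cnj (s t))"
      by (simp add: cnj_s sum_distrib_left mult_ac)
    finally show ?thesis .
  qed
  have sq': "((\<lambda>t. s t * cnj (q t)) has_integral of_real S) {0..1}"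
    using has_integral_cnj[THEN iffD2, OF qs] by (simp add: o_def mult.commute)
  have ss: "((\<lambda>t. s t * cnj (s t)) has_integral of_real S) {0..1}"
  proof -
    have "((\<lambda>t. \<Sum>k\<in>K. \<Sum>l\<in>K. (a k * cnj (a l)) * (half_char k t * half_char l (- t))) has_integral
        (\<Sum>k\<in>K. \<Sum>l\<in>K. (a k * cnj (a l)) * (if k = l then 1 else 0))) {0..1}"
      by (intro has_integral_sum K has_integral_mult_right half_char_orthonormal)
    also have "(\<Sum>k\<in>K. \<Sum>l\<in>K. (a k * cnj (a l)) * (if k = l then 1 else 0)) = of_real S"
      using K by (simp add: S_def sq if_distrib cong: if_cong)
    also have "(\<lambda>t. \<Sum>k\<in>K. \<Sum>l\<in>K. (a k * cnj (a l)) * (half_char k t * half_char l (- t)))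
        = (\<lambda>t. s t * cnj (s t))"
      unfolding cnj_s unfolding s_def sum_product by (simp add: mult_ac)
    finally show ?thesis .
  qed
  define Iq where "Iq = integral {0..1} (\<lambda>t. (norm (q t))\<^sup>2)"
  have Iq: "((\<lambda>t. (norm (q t))\<^sup>2) has_integral Iq) {0..1}"
    unfolding Iq_def by (intro integrable_integral integrable_continuous_real continuous_intros q)
  have "((\<lambda>t. q t * cnj (q t)) has_integral of_real Iq) {0..1}"
    using has_integral_of_real[OF Iq] by (simp add: sq)
  from has_integral_add[OF has_integral_diff[OF has_integral_diff[OF this qs] sq'] ss]
  have "((\<lambda>t. of_real ((norm (q t - s t))\<^sup>2) :: complex) has_integral of_real (Iq - S)) {0..1}"
    unfolding sq[symmetric] by (simp add: algebra_simps)
  from has_integral_Re[OF this]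
  have "((\<lambda>t. (norm (q t - s t))\<^sup>2) has_integral (Iq - S)) {0..1}" by simp
  hence "0 \<le> Iq - S" by (rule has_integral_nonneg) auto
  thus ?thesis by (simp add: Iq_def S_def a_def)
qed

lemma integral_periodic_window:
  fixes h :: "real \<Rightarrow> complex"
  assumes cont: "continuous_on UNIV h" and per: "\<And>t. h (t + 1) = h t"
  shows "integral {a..a + 1} h = integral {0..1} h"
proof -
  have int: "h integrable_on {x..y}" for x y
    by (intro integrable_continuous_real continuous_on_subset[OF cont]) auto
  have shift: "integral {x + 1..y + 1} h = integral {x..y} h" for x y
    using integral_shift[of x 1 y h] continuous_on_subset[OF cont] per by (simp add: o_def)
  have unit: "integral {x..x + 1} h = integral {0..1} h" if "0 \<le> x" "x \<le> 1" for x
  proof -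
    have "integral {0..x} h + integral {x..x + 1} h = integral {0..x + 1} h"
      using that by (intro Henstock_Kurzweil_Integration.integral_combine int) auto
    moreover have "integral {0..1} h + integral {1..x + 1} h = integral {0..x + 1} h"
      using that by (intro Henstock_Kurzweil_Integration.integral_combine int) auto
    moreover have "integral {1..x + 1} h = integral {0..x} h" using shift[of 0 x] by simp
    ultimately have "integral {0..x} h + integral {x..x + 1} h = integral {0..x} h + integral {0..1} h"
      by (simp add: add.commute)
    thus ?thesis by simp
  qed
  have "integral {frac a + of_int k..frac a + of_int k + 1} h = integral {0..1} h" for k
  proof (induction k rule: int_induct[of _ 0])
    case base
    show ?case using frac_lt_1[of a] unit[of "frac a"] by simp
  next
    case (step1 i)
    thus ?case using shift[of "frac a + of_int i" "frac a + of_int i + 1"] by (simp add: add_ac)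
  next
    case (step2 i)
    thus ?case using shift[of "frac a + of_int (i - 1)" "frac a + of_int i"]
      by (simp add: algebra_simps)
  qed
  from this[of "\<lfloor>a\<rfloor>"] show ?thesis by (simp add: frac_def)
qed

text \<open>Both \<open>q\<close> and the character change sign under translation by 1, so their
  product is periodic and the unit window may be translated freely.\<close>

lemma half_coeff_shift:
  assumes cont: "continuous_on UNIV q" and anti: "\<And>t. q (t + 1) = - q t"
  shows "half_coeff (\<lambda>t. q (t + h)) k = half_char k h * half_coeff q k"
proof -
  define u where "u = (\<lambda>t. q t * half_char k (- t))"
  have cu: "continuous_on UNIV u"
    unfolding u_def by (intro continuous_intros cont)
  have pu: "u (t + 1) = u t" for t
    using anti[of t] half_char_add[of k "- t" "-1"] by (simp add: u_def half_char_minus_1)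
  have "half_coeff (\<lambda>t. q (t + h)) k = integral {0..1} (\<lambda>t. half_char k h * (u \<circ> (\<lambda>t. t + h)) t)"
    unfolding half_coeff_def
  proof (intro integral_cong)
    fix t :: real
    have "half_char k (- t) = half_char k h * half_char k (- (t + h))"
      by (simp flip: half_char_add)
    thus "q (t + h) * half_char k (- t) = half_char k h * (u \<circ> (\<lambda>t. t + h)) t"
      by (simp add: u_def mult_ac)
  qed
  also have "\<dots> = half_char k h * integral {0..1} (u \<circ> (\<lambda>t. t + h))"
    by (rule integral_mult_right)
  also have "integral {0..1} (u \<circ> (\<lambda>t. t + h)) = integral {0 + h..1 + h} u"
    by (intro integral_shift continuous_on_subset[OF cu]) auto
  also have "\<dots> = integral {0..1} u"
    using integral_periodic_window[OF cu pu, of h] by (simp add: add.commute)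
  finally show ?thesis by (simp add: half_coeff_def u_def)
qed

lemma half_coeff_diff:
  assumes "continuous_on {0..1} p" "continuous_on {0..1} q"
  shows "half_coeff (\<lambda>t. p t - q t) k = half_coeff p k - half_coeff q k"
  using has_integral_diff[OF half_coeff_has_integral[OF assms(1)] half_coeff_has_integral[OF assms(2)], of k k]
  by (simp add: half_coeff_def[of "\<lambda>t. p t - q t"] left_diff_distrib integral_unique)

text \<open>Folds a long interval onto its first piece. Used with \<open>d = 1 / 2 ^ j\<close> to
  turn an integral of squares into sums along a chain, and with \<open>d = 1\<close> to turn a
  Mellin integral into partial sums of \<open>Pterm\<close>.\<close>

lemma integral_sum_pieces:
  fixes h :: "real \<Rightarrow> 'a :: euclidean_space"
  assumes cont: "continuous_on UNIV h" and d: "0 \<le> d"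
  shows "integral {0..real n * d} h = integral {0..d} (\<lambda>t. \<Sum>i<n. h (t + real i * d))"
proof (induction n)
  case (Suc n)
  have int: "(\<lambda>t. h (t + c)) integrable_on {x..y}" for x y c
    by (intro integrable_continuous_real continuous_on_compose2[OF cont] continuous_intros) auto
  have "integral {0..real (Suc n) * d} h
      = integral {0..real n * d} h + integral {0 + real n * d..d + real n * d} h"
    using d int[of 0] Henstock_Kurzweil_Integration.integral_combine[of 0 "real n * d" "real (Suc n) * d" h]
    by (simp add: algebra_simps)
  also have "integral {0 + real n * d..d + real n * d} h = integral {0..d} (\<lambda>t. h (t + real n * d))"
    using integral_shift[of 0 "real n * d" d h] continuous_on_subset[OF cont] by (simp add: o_def)
  also have "integral {0..real n * d} h + \<dots> = integral {0..d} (\<lambda>t. \<Sum>i<Suc n. h (t + real i * d))"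
    unfolding Suc using int by (subst integral_add[symmetric]) (auto intro!: integrable_sum)
  finally show ?case .
qed auto

text \<open>Zygmund's argument: on the block \<open>2\<^sup>j \<le> \<bar>2k+1\<bar> < 2\<^sup>j\<^sup>+\<^sup>1\<close> the shift by
  \<open>h = 2\<^sup>-\<^sup>j\<^sup>-\<^sup>1\<close> multiplies the coefficients by a factor \<open>\<bar>e\<^sup>i\<^sup>\<theta> - 1\<bar> \<ge> \<surd>2\<close>, while the
  square of the increment integrates to at most \<open>h\<close> times the modulus of continuity times the
  variation. Bessel and Cauchy--Schwarz then bound each block by a geometric term.\<close>

lemma half_char_minus_one_lower:
  assumes "2 ^ j \<le> \<bar>2 * k + 1\<bar>" "\<bar>2 * k + 1\<bar> < 2 ^ (j + 1)"
  shows "2 \<le> (norm (half_char k (1 / 2 ^ (j + 1)) - 1))\<^sup>2"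
proof -
  define \<theta> where "\<theta> = of_int (2 * k + 1) * pi * (1 / 2 ^ (j + 1))"
  have "\<bar>\<theta>\<bar> = of_int \<bar>2 * k + 1\<bar> / 2 ^ (j + 1) * pi"
    by (simp add: \<theta>_def abs_mult)
  moreover have "real_of_int (2 ^ j) \<le> of_int \<bar>2 * k + 1\<bar>"
    using assms(1) by (rule of_int_le_iff[THEN iffD2])
  moreover have "of_int \<bar>2 * k + 1\<bar> \<le> real_of_int (2 ^ (j + 1))"
    using assms(2) by (intro of_int_le_iff[THEN iffD2]) simp
  ultimately have "\<bar>\<theta>\<bar> = of_int \<bar>2 * k + 1\<bar> / 2 ^ (j + 1) * pi"
    "1 / 2 \<le> real_of_int \<bar>2 * k + 1\<bar> / 2 ^ (j + 1)" "real_of_int \<bar>2 * k + 1\<bar> / 2 ^ (j + 1) \<le> 1"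
    by (auto simp: field_simps)
  \<comment> \<open>On the block the shift turns the character by an angle between pi/2 and pi in
    modulus, where the cosine is not positive.\<close>
  hence \<theta>: "pi / 2 \<le> \<bar>\<theta>\<bar>" "\<bar>\<theta>\<bar> \<le> pi"
    using mult_right_mono[of "1 / 2" "real_of_int \<bar>2 * k + 1\<bar> / 2 ^ (j + 1)" pi]
      mult_right_mono[of "real_of_int \<bar>2 * k + 1\<bar> / 2 ^ (j + 1)" 1 pi] by auto
  have "cos \<theta> = cos \<bar>\<theta>\<bar>" by (simp add: abs_if)
  also have "\<dots> = - cos (pi - \<bar>\<theta>\<bar>)" by simp
  also have "\<dots> \<le> 0" using \<theta> by (simp del: cos_pi_minus add: cos_ge_zero)
  finally have "cos \<theta> \<le> 0" .
  have "(norm (cis \<theta> - 1))\<^sup>2 = (cos \<theta> - 1)\<^sup>2 + (sin \<theta>)\<^sup>2"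
    by (simp add: cmod_power2)
  also have "\<dots> = 2 - 2 * cos \<theta>"
    using sin_cos_squared_add[of \<theta>] by (simp add: power2_eq_square algebra_simps)
  finally show ?thesis using \<open>cos \<theta> \<le> 0\<close> by (simp add: half_char_eq_cis \<theta>_def)
qed

lemma antiperiodic1_increment_integral:
  assumes R: "antiperiodic1 R" "continuous_on UNIV R"
    and mod: "\<And>s t. \<bar>s - t\<bar> \<le> 1 / 2 ^ j \<Longrightarrow> \<bar>R s - R t\<bar> \<le> \<omega>"
    and var: "\<And>n x. (\<And>i. i \<le> n \<Longrightarrow> x i \<in> {0..1}) \<Longrightarrow> (\<And>i. i < n \<Longrightarrow> x i \<le> x (Suc i)) \<Longrightarrow>
      (\<Sum>i<n. \<bar>R (x (Suc i)) - R (x i)\<bar>) \<le> V"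
  shows "integral {0..1} (\<lambda>t. (R (t + 1 / 2 ^ j) - R t)\<^sup>2) \<le> 1 / 2 ^ j * (\<omega> * (V + \<omega>))"
proof -
  define h :: real where "h = 1 / 2 ^ j"
  define N :: nat where "N = 2 ^ j"
  have h: "h > 0" "real N * h = 1" "h \<le> 1" by (auto simp: h_def N_def)
  have N: "N = Suc (N - 1)" by (simp add: N_def)
  define d where "d = (\<lambda>t. (R (t + h) - R t)\<^sup>2)"
  have cd: "continuous_on UNIV d"
    unfolding d_def by (intro continuous_intros continuous_on_compose2[OF R(2)]) (auto intro: continuous_intros R)
  have \<omega>: "0 \<le> \<omega>" using mod[of 0 0] by simp
  have bound: "(\<Sum>i<N. d (t + real i * h)) \<le> \<omega> * (V + \<omega>)" if t: "t \<in> {0..h}" for t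
  proof -
    define x where "x = (\<lambda>i. t + real i * h)"
    have xS: "x (Suc i) = x i + h" for i by (simp add: x_def algebra_simps)
    have step: "\<bar>R (x (Suc i)) - R (x i)\<bar> \<le> \<omega>" for i
      using h by (intro mod) (simp add: xS h_def)
    have "(\<Sum>i<N. d (x i)) = (\<Sum>i<N. \<bar>R (x (Suc i)) - R (x i)\<bar> * \<bar>R (x (Suc i)) - R (x i)\<bar>)"
      by (simp add: d_def xS power2_eq_square)
    also have "\<dots> \<le> (\<Sum>i<N. \<omega> * \<bar>R (x (Suc i)) - R (x i)\<bar>)"
      by (intro sum_mono mult_right_mono step) auto
    \<comment> \<open>The first \<open>N - 1\<close> increments have both ends in {0..1}, and the
      variation bound covers them; the last one may cross 1 and is charged to
      \<open>\<omega>\<close>.\<close>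
    also have "\<dots> = \<omega> * ((\<Sum>i<N - 1. \<bar>R (x (Suc i)) - R (x i)\<bar>) + \<bar>R (x (Suc (N - 1))) - R (x (N - 1))\<bar>)"
      by (subst (1) N) (simp add: sum_distrib_left distrib_left)
    also have "\<dots> \<le> \<omega> * (V + \<omega>)"
    proof (intro mult_left_mono add_mono step var \<omega>)
      fix i assume "i \<le> N - 1"
      hence "real i + 1 \<le> real N" using N by linarith
      hence "(real i + 1) * h \<le> 1" using h mult_right_mono[of "real i + 1" "real N" h] by simp
      moreover have "0 \<le> real i * h" using h by simp
      ultimately show "x i \<in> {0..1}" using t by (auto simp: x_def algebra_simps)
    qed (use h xS in auto)
    finally show ?thesis by (simp add: x_def)
  qed
  have "integral {0..1} d = integral {0..h} (\<lambda>t. \<Sum>i<N. d (t + real i * h))"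
    using integral_sum_pieces[OF cd, of h N] h by simp
  also have "\<dots> \<le> integral {0..h} (\<lambda>t. \<omega> * (V + \<omega>))"
    using bound
    by (intro integral_le integrable_continuous_real continuous_intros continuous_on_compose2[OF cd]) auto
  also have "\<dots> = h * (\<omega> * (V + \<omega>))" using h by simp
  finally show ?thesis by (simp add: d_def h_def)
qed

lemma Phat_block_square_sum:
  assumes R: "antiperiodic1 R" "continuous_on UNIV R" and K: "finite K"
    "\<And>k. k \<in> K \<Longrightarrow> 2 ^ j \<le> \<bar>2 * k + 1\<bar> \<and> \<bar>2 * k + 1\<bar> < 2 ^ (j + 1)"
  shows "2 * (\<Sum>k\<in>K. (norm (Phat R k))\<^sup>2) \<le> integral {0..1} (\<lambda>t. (R (t + 1 / 2 ^ (j + 1)) - R t)\<^sup>2)"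
proof -
  define h :: real where "h = 1 / 2 ^ (j + 1)"
  define q where "q = (\<lambda>t. complex_of_real (R t))"
  have cq: "continuous_on UNIV q" unfolding q_def by (intro continuous_intros R)
  have aq: "q (t + 1) = - q t" for t using R(1) by (simp add: q_def antiperiodic1_def)
  have cq': "continuous_on A (\<lambda>t. q (t + h))" for A
    by (intro continuous_on_compose2[OF cq] continuous_intros) auto
  have coeff: "half_coeff (\<lambda>t. q (t + h) - q t) k = (half_char k h - 1) * Phat R k" for k
    using half_coeff_diff[OF cq' continuous_on_subset[OF cq], of k] half_coeff_shift[OF cq aq, of h k]
    by (simp add: Phat_eq_half_coeff q_def algebra_simps)
  have "2 * (\<Sum>k\<in>K. (norm (Phat R k))\<^sup>2) \<le> (\<Sum>k\<in>K. (norm (half_char k h - 1))\<^sup>2 * (norm (Phat R k))\<^sup>2)"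
    unfolding sum_distrib_left using K(2) half_char_minus_one_lower
    by (intro sum_mono mult_right_mono) (auto simp: h_def)
  also have "\<dots> = (\<Sum>k\<in>K. (norm (half_coeff (\<lambda>t. q (t + h) - q t) k))\<^sup>2)"
    by (simp add: coeff norm_mult power_mult_distrib)
  also have "\<dots> \<le> integral {0..1} (\<lambda>t. (norm (q (t + h) - q t))\<^sup>2)"
    by (intro bessel_inequality K continuous_intros cq' continuous_on_subset[OF cq]) auto
  also have "(\<lambda>t. (norm (q (t + h) - q t))\<^sup>2) = (\<lambda>t. (R (t + h) - R t)\<^sup>2)"
    unfolding q_def of_real_diff[symmetric] norm_of_real by simp
  finally show ?thesis by (simp add: h_def)
qed

text \<open>After an integer shift the pair lies in {0..1} or straddles 1. In the second case the
  path goes through 1 and continues from 0, using \<open>R 1 = - R 0\<close>; the two pieces cost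
  the factor 2.\<close>

lemma antiperiodic1_modulus_extend:
  assumes R: "antiperiodic1 R"
    and mod: "\<And>s t. s \<in> {0..1} \<Longrightarrow> t \<in> {0..1} \<Longrightarrow> \<bar>s - t\<bar> \<le> d \<Longrightarrow> \<bar>R s - R t\<bar> \<le> \<omega>"
    and d: "d \<le> 1" and st: "\<bar>s - t\<bar> \<le> d"
  shows "\<bar>R s - R t\<bar> \<le> 2 * \<omega>"
proof -
  have \<omega>: "0 \<le> \<omega>" using mod[of 0 0] st by simp
  have *: "\<bar>R t - R s\<bar> \<le> 2 * \<omega>" if "s \<le> t" "t - s \<le> d" for s t
  proof -
    define k where "k = \<lfloor>s\<rfloor>"
    define s' t' where "s' = s - of_int k" and "t' = t - of_int k"
    have s': "0 \<le> s'" "s' \<le> 1" "s' \<le> t'" "t' - s' \<le> d"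
      using that unfolding s'_def t'_def k_def by linarith+
    have "R t - R s = (-1) powi k * (R t' - R s')"
      using antiperiodic1_add_int[OF R, of t' k] antiperiodic1_add_int[OF R, of s' k]
      by (simp add: s'_def t'_def right_diff_distrib)
    hence eq: "\<bar>R t - R s\<bar> = \<bar>R t' - R s'\<bar>" by (simp add: abs_mult)
    show ?thesis
    proof (cases "t' \<le> 1")
      case True
      have "\<bar>R t' - R s'\<bar> \<le> \<omega>" using s' True by (intro mod) auto
      thus ?thesis using eq \<omega> by simp
    next
      case False
      have "R t' = - R (t' - 1)" "R 1 = - R 0"
        using R[unfolded antiperiodic1_def, rule_format, of "t' - 1"]
          R[unfolded antiperiodic1_def, rule_format, of 0] by simp_all
      moreover have "\<bar>R (t' - 1) - R 0\<bar> \<le> \<omega>" using False s' d by (intro mod) auto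
      moreover have "\<bar>R 1 - R s'\<bar> \<le> \<omega>" using False s' by (intro mod) auto
      ultimately show ?thesis using eq by linarith
    qed
  qed
  show ?thesis using *[of s t] *[of t s] st by (cases "s \<le> t") (auto simp: abs_minus_commute)
qed

lemma Phat_abs_summable:
  assumes R: "antiperiodic1 R" "continuous_on UNIV R" and r: "0 < r" "r < 1"
    and mod: "\<And>j s t. s \<in> {0..1} \<Longrightarrow> t \<in> {0..1} \<Longrightarrow> \<bar>s - t\<bar> \<le> 1 / 2 ^ j \<Longrightarrow> \<bar>R s - R t\<bar> \<le> C * r ^ j"
    and var: "\<And>n x. (\<And>i. i \<le> n \<Longrightarrow> x i \<in> {0..1}) \<Longrightarrow> (\<And>i. i < n \<Longrightarrow> x i \<le> x (Suc i)) \<Longrightarrow>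
      (\<Sum>i<n. \<bar>R (x (Suc i)) - R (x i)\<bar>) \<le> V"
  shows "(\<lambda>k. norm (Phat R k)) summable_on UNIV"
proof -
  have C: "0 \<le> C" using mod[of 0 0 0] by simp
  have V: "0 \<le> V" using var[of 0 "\<lambda>_. 0"] by simp
  have mod': "\<bar>R s - R t\<bar> \<le> 2 * (C * r ^ j)" if "\<bar>s - t\<bar> \<le> 1 / 2 ^ j" for s t j
    using mod that by (intro antiperiodic1_modulus_extend[OF R(1), of "1 / 2 ^ j"]) auto
  define K where "K = (\<lambda>j. {k::int. 2 ^ j \<le> \<bar>2 * k + 1\<bar> \<and> \<bar>2 * k + 1\<bar> < 2 ^ (j + 1)})"
  \<comment> \<open>\<open>B\<^sup>2 * r ^ j\<close> has to dominate the block size, at most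
    \<open>2 * 2 ^ j\<close>, times the sum of squares over the block, at most
    \<open>C * (V + 2 * C) * r ^ j / (2 * 2 ^ j)\<close>; the powers of 2 cancel, and the factor 4
    leaves room.\<close>
  define B where "B = sqrt (4 * C * (V + 2 * C))"
  have K_sub: "K j \<subseteq> {- (2 ^ j)..<2 ^ j}" for j
    by (auto simp: K_def)
  hence K_fin: "finite (K j)" for j by (rule finite_subset) auto
  have K_card: "card (K j) \<le> 2 * 2 ^ j" for j
  proof -
    have "card (K j) \<le> card {- (2 ^ j)..<(2::int) ^ j}" using K_sub by (intro card_mono) auto
    also have "\<dots> = nat (2 * 2 ^ j)" by simp
    also have "\<dots> = 2 * 2 ^ j" by (simp add: nat_mult_distrib nat_power_eq)
    finally show ?thesis .
  qed
  have block: "(\<Sum>k\<in>K j. norm (Phat R k)) \<le> B * sqrt r ^ j" for j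
  proof -
    define \<omega> where "\<omega> = 2 * (C * r ^ (j + 1))"
    have r1: "r ^ (j + 1) \<le> r ^ j" "r ^ j \<le> 1" "0 \<le> r ^ j" using r by (auto intro: power_le_one power_decreasing)
    have \<omega>: "0 \<le> \<omega>" "\<omega> \<le> 2 * (C * r ^ j)" "\<omega> \<le> 2 * C"
    proof -
      have "C * r ^ (j + 1) \<le> C * r ^ j" using C r1 by (intro mult_left_mono) auto
      moreover have "C * r ^ j \<le> C * 1" using C r1 by (intro mult_left_mono) auto
      ultimately show "0 \<le> \<omega>" "\<omega> \<le> 2 * (C * r ^ j)" "\<omega> \<le> 2 * C"
        using C r by (auto simp: \<omega>_def)
    qed
    have "2 * (\<Sum>k\<in>K j. (norm (Phat R k))\<^sup>2) \<le> integral {0..1} (\<lambda>t. (R (t + 1 / 2 ^ (j + 1)) - R t)\<^sup>2)"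
      by (intro Phat_block_square_sum R K_fin) (auto simp: K_def)
    also have "\<dots> \<le> 1 / 2 ^ (j + 1) * (\<omega> * (V + \<omega>))"
      unfolding \<omega>_def by (intro antiperiodic1_increment_integral R var mod'[where j = "j + 1"])
    also have "\<dots> \<le> 1 / 2 ^ (j + 1) * ((2 * (C * r ^ j)) * (V + 2 * C))"
      using \<omega> V by (intro mult_left_mono mult_mono add_mono) auto
    finally have sq: "(\<Sum>k\<in>K j. (norm (Phat R k))\<^sup>2) * (2 * 2 ^ j) \<le> C * (V + 2 * C) * r ^ j"
      by (simp add: field_simps)
    have "(\<Sum>k\<in>K j. norm (Phat R k))\<^sup>2 \<le> (\<Sum>k\<in>K j. (norm (Phat R k))\<^sup>2) * card (K j)"
      by (rule sum_squared_le_sum_of_squares)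
    also have "\<dots> \<le> (\<Sum>k\<in>K j. (norm (Phat R k))\<^sup>2) * real (2 * 2 ^ j)"
      using K_card[of j] by (intro mult_left_mono sum_nonneg) (auto simp del: of_nat_mult of_nat_power)
    also have "\<dots> \<le> 4 * C * (V + 2 * C) * r ^ j"
    proof -
      define Y where "Y = C * (V + 2 * C) * r ^ j"
      have "0 \<le> Y" using C V r by (simp add: Y_def)
      have "(\<Sum>k\<in>K j. (norm (Phat R k))\<^sup>2) * real (2 * 2 ^ j) \<le> Y" using sq by (simp add: Y_def)
      also have "Y \<le> 4 * Y" using \<open>0 \<le> Y\<close> by simp
      finally show ?thesis by (simp add: Y_def mult.assoc)
    qed
    also have "\<dots> = (B * sqrt r ^ j)\<^sup>2"
    proof -
      have "(sqrt r ^ j)\<^sup>2 = (sqrt r)\<^sup>2 ^ j" by (simp add: power_mult[symmetric] mult.commute)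
      thus ?thesis using C V r by (simp add: B_def power_mult_distrib)
    qed
    finally show ?thesis by (rule power2_le_imp_le) (use C V r in \<open>auto simp: B_def\<close>)
  qed
  have sqr: "0 < sqrt r" "sqrt r < 1" using r by auto
  show ?thesis
  proof (rule nonneg_bdd_above_summable_on)
    show "bdd_above (sum (\<lambda>k. norm (Phat R k)) ` {X. X \<subseteq> UNIV \<and> finite X})"
    proof (rule bdd_aboveI2)
      fix X :: "int set" assume "X \<in> {X. X \<subseteq> UNIV \<and> finite X}"
      hence X: "finite X" by simp
      \<comment> \<open>\<open>2 * k + 1\<close> is odd, hence nonzero, so every frequency falls
        into some block.\<close>
      have cover: "\<exists>j. k \<in> K j" for k :: int
      proof -
        have "1 \<le> \<bar>2 * k + 1\<bar>" by presburger
        hence "1 \<le> real_of_int \<bar>2 * k + 1\<bar>" by (simp only: of_int_1_le_iff)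
        then obtain j y where y: "y \<in> {1..<2}" "real_of_int \<bar>2 * k + 1\<bar> = 2 ^ j * y"
          using dyadic_decomposition by blast
        have "real_of_int (2 ^ j) \<le> real_of_int \<bar>2 * k + 1\<bar>" "real_of_int \<bar>2 * k + 1\<bar> < real_of_int (2 ^ (j + 1))"
          unfolding y(2) using y(1) by auto
        hence "2 ^ j \<le> \<bar>2 * k + 1\<bar>" "\<bar>2 * k + 1\<bar> < 2 ^ (j + 1)"
          by (simp_all only: of_int_le_iff of_int_less_iff)
        thus ?thesis by (auto simp: K_def)
      qed
      then obtain j where j: "\<And>k. k \<in> K (j k)" by metis
      define J where "J = Suc (Max (insert 0 (j ` X)))"
      have "X \<subseteq> (\<Union>i<J. K i)"
      proof
        fix k assume "k \<in> X"
        hence "j k \<le> Max (insert 0 (j ` X))" using X by (intro Max_ge) auto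
        thus "k \<in> (\<Union>i<J. K i)" using j[of k] by (auto simp: J_def less_Suc_eq_le)
      qed
      hence "(\<Sum>k\<in>X. norm (Phat R k)) \<le> (\<Sum>k\<in>(\<Union>i<J. K i). norm (Phat R k))"
        using K_fin by (intro sum_mono2) auto
      also have "\<dots> = (\<Sum>i<J. \<Sum>k\<in>K i. norm (Phat R k))"
      proof (intro sum.UNION_disjoint ballI impI)
        show "K i \<inter> K l = {}" if "i \<noteq> l" for i l
        proof (rule ccontr)
          assume "K i \<inter> K l \<noteq> {}"
          then obtain k :: int where "2 ^ i \<le> \<bar>2 * k + 1\<bar>" "\<bar>2 * k + 1\<bar> < 2 ^ (i + 1)"
            "2 ^ l \<le> \<bar>2 * k + 1\<bar>" "\<bar>2 * k + 1\<bar> < 2 ^ (l + 1)" by (auto simp: K_def)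
          hence "(2::int) ^ i < 2 ^ (l + 1)" "(2::int) ^ l < 2 ^ (i + 1)" by linarith+
          hence "i < l + 1" "l < i + 1" by (auto simp only: power_strict_increasing_iff)
          thus False using that by simp
        qed
      qed (use K_fin in auto)
      also have "\<dots> \<le> (\<Sum>i<J. B * sqrt r ^ i)" by (intro sum_mono block)
      also have "\<dots> = B * (\<Sum>i<J. sqrt r ^ i)" by (simp add: sum_distrib_left)
      also have "\<dots> \<le> B * (1 / (1 - sqrt r))"
      proof (rule mult_left_mono)
        have "(\<Sum>i<J. sqrt r ^ i) \<le> (\<Sum>i. sqrt r ^ i)"
          using sqr by (intro sum_le_suminf summable_geometric) auto
        thus "(\<Sum>i<J. sqrt r ^ i) \<le> 1 / (1 - sqrt r)" using sqr by (simp add: suminf_geometric)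
        show "0 \<le> B" using C V by (simp add: B_def)
      qed
      finally show "(\<Sum>k\<in>X. norm (Phat R k)) \<le> B * (1 / (1 - sqrt r))" .
    qed
  qed auto
qed

text \<open>A continuous antiperiodic function without Fourier coefficients is orthogonal to the odd
  powers of \<open>cos (\<pi> (t - t\<^sub>0))\<close>, which concentrate at \<open>t\<^sub>0\<close> on a window of length \<open>1\<close>.\<close>

lemma half_coeff_linear3:
  assumes "continuous_on {0..1} q"
  shows "half_coeff (\<lambda>t. q t * (a + b * cis (2 * pi * t) + c * cis (- (2 * pi * t)))) k
    = a * half_coeff q k + b * half_coeff q (k - 1) + c * half_coeff q (k + 1)"
proof -
  have k1: "half_char k (- t) * cis (2 * pi * t) = half_char (k - 1) (- t)" for t
    using half_char_mult_shift'[of k "- t"] by simp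
  have k2: "half_char k (- t) * cis (- (2 * pi * t)) = half_char (k + 1) (- t)" for t
    using half_char_mult_shift[of k "- t"] by simp
  have "((\<lambda>t. a * (q t * half_char k (- t)) + b * (q t * half_char (k - 1) (- t))
        + c * (q t * half_char (k + 1) (- t))) has_integral
      (a * half_coeff q k + b * half_coeff q (k - 1) + c * half_coeff q (k + 1))) {0..1}"
    by (intro has_integral_add has_integral_mult_right half_coeff_has_integral assms)
  also have "(\<lambda>t. a * (q t * half_char k (- t)) + b * (q t * half_char (k - 1) (- t))
        + c * (q t * half_char (k + 1) (- t)))
      = (\<lambda>t. (q t * (a + b * cis (2 * pi * t) + c * cis (- (2 * pi * t)))) * half_char k (- t))"
    unfolding k1[symmetric] k2[symmetric] by (simp add: algebra_simps)
  finally show ?thesis unfolding half_coeff_def by (rule integral_unique)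
qed

text \<open>The square of the cosine is 1/2 plus two exponentials of period 1; multiplication by it
  mixes only the coefficients \<open>k - 1\<close>, \<open>k\<close> and \<open>k + 1\<close>, so
  their vanishing survives the induction.\<close>

lemma half_coeff_cos_power_zero:
  assumes q: "continuous_on {0..1} q" "\<And>k. half_coeff q k = 0"
  shows "half_coeff (\<lambda>t. q t * of_real (cos (pi * (t - t0)) ^ (2 * n))) k = 0"
proof (induction n arbitrary: k)
  case (Suc n)
  define u where "u = (\<lambda>t. q t * of_real (cos (pi * (t - t0)) ^ (2 * n)))"
  have c: "complex_of_real (cos (pi * (t - t0)) ^ 2)
      = 1/2 + cis (- (2 * pi * t0)) / 4 * cis (2 * pi * t) + cis (2 * pi * t0) / 4 * cis (- (2 * pi * t))" for t
  proof -
    define x where "x = 2 * (pi * (t - t0))"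
    have "cos (pi * (t - t0)) ^ 2 = 1/2 + cos x / 2"
      using cos_double_cos[of "pi * (t - t0)"] by (simp add: x_def field_simps)
    hence "complex_of_real (cos (pi * (t - t0)) ^ 2) = 1/2 + cis x / 4 + cis (- x) / 4"
      by (simp only:) (simp add: complex_eq_iff)
    moreover have "cis x = cis (- (2 * pi * t0)) * cis (2 * pi * t)"
      "cis (- x) = cis (2 * pi * t0) * cis (- (2 * pi * t))"
      by (simp_all add: cis_mult x_def algebra_simps)
    ultimately show ?thesis by simp
  qed
  have "(\<lambda>t. q t * of_real (cos (pi * (t - t0)) ^ (2 * Suc n)))
      = (\<lambda>t. u t * of_real (cos (pi * (t - t0)) ^ 2))"
    by (simp add: u_def power_add[symmetric] mult.assoc flip: of_real_mult) (simp add: power2_eq_square mult_ac)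
  also have "\<dots> = (\<lambda>t. u t * (1/2 + cis (- (2 * pi * t0)) / 4 * cis (2 * pi * t)
      + cis (2 * pi * t0) / 4 * cis (- (2 * pi * t))))"
    unfolding c ..
  finally have eq: "(\<lambda>t. q t * of_real (cos (pi * (t - t0)) ^ (2 * Suc n)))
      = (\<lambda>t. u t * (1/2 + cis (- (2 * pi * t0)) / 4 * cis (2 * pi * t)
          + cis (2 * pi * t0) / 4 * cis (- (2 * pi * t))))" .
  have cu: "continuous_on {0..1} u" unfolding u_def by (intro continuous_intros q)
  have u0: "half_coeff u k = 0" for k unfolding u_def by (rule Suc.IH)
  show ?case unfolding eq half_coeff_linear3[OF cu] u0 by simp
qed (use q in auto)

text \<open>The remaining single cosine is itself a combination of the two characters with
  \<open>k = -1\<close> and \<open>k = 0\<close>, so the integral is a combination of two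
  coefficients of \<open>u\<close>.\<close>

lemma half_coeff_cos_odd_power_zero:
  assumes q: "continuous_on {0..1} q" "\<And>k. half_coeff q k = 0"
  shows "integral {0..1} (\<lambda>t. q t * of_real (cos (pi * (t - t0)) ^ (2 * n + 1))) = 0"
proof -
  define u where "u = (\<lambda>t. q t * of_real (cos (pi * (t - t0)) ^ (2 * n)))"
  have cu: "continuous_on {0..1} u" unfolding u_def by (intro continuous_intros q)
  have u0: "half_coeff u k = 0" for k
    unfolding u_def by (rule half_coeff_cos_power_zero[OF q])
  have e: "cis (- (pi * t0)) / 2 * half_char (-1) (- t) + cis (pi * t0) / 2 * half_char 0 (- t)
      = of_real (cos (pi * (t - t0)))" for t
  proof -
    define x where "x = pi * (t - t0)"
    have "cis x = cis (- (pi * t0)) * half_char (-1) (- t) * (1::complex)"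
      "cis (- x) = cis (pi * t0) * half_char 0 (- t)"
      by (simp_all add: cis_mult half_char_eq_cis x_def algebra_simps)
    moreover have "complex_of_real (cos x) = cis x / 2 + cis (- x) / 2"
      by (simp add: complex_eq_iff)
    ultimately show ?thesis by (simp add: x_def)
  qed
  have "((\<lambda>t. cis (- (pi * t0)) / 2 * (u t * half_char (-1) (- t)) + cis (pi * t0) / 2 * (u t * half_char 0 (- t)))
      has_integral (cis (- (pi * t0)) / 2 * half_coeff u (-1) + cis (pi * t0) / 2 * half_coeff u 0)) {0..1}"
    by (intro has_integral_add has_integral_mult_right half_coeff_has_integral cu)
  also have "(\<lambda>t. cis (- (pi * t0)) / 2 * (u t * half_char (-1) (- t)) + cis (pi * t0) / 2 * (u t * half_char 0 (- t)))
      = (\<lambda>t. u t * of_real (cos (pi * (t - t0))))"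
    unfolding e[symmetric] by (simp add: algebra_simps)
  also have "\<dots> = (\<lambda>t. q t * of_real (cos (pi * (t - t0)) ^ (2 * n + 1)))"
    by (simp add: u_def mult_ac)
  finally show ?thesis by (simp add: u0 integral_unique)
qed

lemma antiperiodic_zero_coeffs_imp_zero:
  assumes cont: "continuous_on UNIV q" and anti: "\<And>t. q (t + 1) = - q t"
    and zero: "\<And>k. half_coeff q k = 0"
  shows "q t0 = 0"
proof (rule ccontr)
  assume q0: "q t0 \<noteq> 0"
  \<comment> \<open>On this window the cosine is nonnegative; since \<open>q\<close> and the odd
    power both change sign under translation by 1, the integral over \<open>W\<close> is the one
    over {0..1}.\<close>
  define W where "W = {t0 - 1/2..t0 + 1/2}"
  define e where "e = norm (q t0) / 2"
  have e: "e > 0" using q0 by (simp add: e_def)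
  define c where "c = (\<lambda>n t. cos (pi * (t - t0)) ^ (2 * n + 1))"
  have cc: "continuous_on A (c n)" for A n unfolding c_def by (intro continuous_intros)
  have c_nonneg: "0 \<le> c n t" if "t \<in> W" for n t
  proof -
    have "\<bar>t - t0\<bar> \<le> 1/2" using that unfolding W_def atLeastAtMost_iff by linarith
    hence "\<bar>pi * (t - t0)\<bar> \<le> pi * (1/2)" by (simp add: abs_mult)
    hence "- (pi / 2) \<le> pi * (t - t0)" "pi * (t - t0) \<le> pi / 2" by linarith+
    hence "0 \<le> cos (pi * (t - t0))" by (rule cos_ge_zero)
    thus ?thesis unfolding c_def by (rule zero_le_power)
  qed
  have zero_int: "integral W (\<lambda>t. q t * of_real (c n t)) = 0" for n
  proof -
    define u where "u = (\<lambda>t. q t * of_real (c n t))"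
    have "cos (pi * (t + 1 - t0)) = - cos (pi * (t - t0))" for t
      using cos_periodic_pi[of "pi * (t - t0)"] by (simp add: algebra_simps)
    hence "u (t + 1) = u t" for t by (simp add: u_def c_def anti)
    moreover have "continuous_on UNIV u" unfolding u_def by (intro continuous_intros cont cc)
    ultimately have "integral {t0 - 1/2..t0 - 1/2 + 1} u = integral {0..1} u"
      by (intro integral_periodic_window) auto
    also have "\<dots> = 0" unfolding u_def c_def
      by (intro half_coeff_cos_odd_power_zero zero continuous_on_subset[OF cont]) auto
    finally show ?thesis by (simp add: W_def u_def add.commute)
  qed
  have "isCont q t0" using cont by (simp add: continuous_on_eq_continuous_at)
  then obtain d0 where d0: "d0 > 0" "\<And>t. dist t t0 < d0 \<Longrightarrow> dist (q t) (q t0) < e"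
    using e unfolding continuous_at_eps_delta dist_norm by metis
  define d where "d = min (d0 / 2) (1/4)"
  have d: "0 < d" "d \<le> 1/4" "d < d0" using d0(1) by (auto simp: d_def)
  have "compact (q ` W)"
    unfolding W_def by (intro compact_continuous_image continuous_on_subset[OF cont]) auto
  then obtain M where M: "M > 0" "\<And>t. t \<in> W \<Longrightarrow> norm (q t) \<le> M"
    using compact_imp_bounded bounded_pos by (metis image_eqI)
  \<comment> \<open>On \<open>W\<close> the cosine is at most \<open>A\<close> at distance more than
    \<open>d\<close> from \<open>t0\<close>, and at least \<open>B\<close> within distance
    \<open>d / 2\<close>; \<open>A < B\<close> makes the far part negligible against the
    peak.\<close>
  define A B where "A = cos (pi * d)" and "B = cos (pi * (d / 2))"
  have pid: "pi * d \<le> pi * (1/4)" using d by (intro mult_left_mono) auto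
  have AB: "0 < A" "A < B"
  proof -
    show "0 < A" unfolding A_def using d pid by (intro cos_gt_zero) auto
    show "A < B" unfolding A_def B_def using d pid by (intro cos_monotone_0_pi) auto
  qed
  have key: "norm (q t0 - q t) * c n t \<le> e * c n t + 2 * M * A ^ (2 * n + 1)" if "t \<in> W" for n t
  proof (cases "\<bar>t - t0\<bar> \<le> d")
    case True
    hence "norm (q t0 - q t) \<le> e" using d0(2)[of t] d by (auto simp: dist_norm norm_minus_commute)
    hence "norm (q t0 - q t) * c n t \<le> e * c n t" using c_nonneg[OF that] by (intro mult_right_mono)
    moreover have "0 \<le> 2 * M * A ^ (2 * n + 1)" using M AB by simp
    ultimately show ?thesis by linarith
  next
    case False
    have "\<bar>t - t0\<bar> \<le> 1/2" using that unfolding W_def atLeastAtMost_iff by linarith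
    have "cos (pi * (t - t0)) = cos (pi * \<bar>t - t0\<bar>)" using cos_abs_real[of "pi * (t - t0)"] by (simp add: abs_mult)
    also have "\<dots> \<le> A" unfolding A_def
    proof (rule cos_monotone_0_pi_le)
      show "pi * d \<le> pi * \<bar>t - t0\<bar>" using False by (intro mult_left_mono) auto
      show "pi * \<bar>t - t0\<bar> \<le> pi" using \<open>\<bar>t - t0\<bar> \<le> 1/2\<close> by simp
    qed (use d in auto)
    finally have "cos (pi * (t - t0)) \<le> A" .
    moreover have "0 \<le> cos (pi * (t - t0))" 
      using c_nonneg[OF that, of 0] by (simp add: c_def)
    ultimately have "c n t \<le> A ^ (2 * n + 1)" unfolding c_def by (intro power_mono)
    moreover have "norm (q t0 - q t) \<le> 2 * M"
      using norm_triangle_ineq4[of "q t0" "q t"] M(2)[of t0] M(2)[OF that] by (simp add: W_def)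
    ultimately have "norm (q t0 - q t) * c n t \<le> 2 * M * A ^ (2 * n + 1)"
      using c_nonneg[OF that] M by (intro mult_mono) auto
    moreover have "0 \<le> e * c n t" using e c_nonneg[OF that] by simp
    ultimately show ?thesis by linarith
  qed
  have bound: "e * (d * B ^ (2 * n + 1)) \<le> 2 * M * A ^ (2 * n + 1)" for n
  proof -
    have I: "c n integrable_on {x..y}" for x y
      by (intro integrable_continuous_real cc)
    have Iq: "(\<lambda>t. q t * of_real (c n t)) integrable_on W" unfolding W_def
      by (intro integrable_continuous_real continuous_intros continuous_on_subset[OF cont] cc) auto
    have "0 \<le> integral W (c n)"
      using I c_nonneg unfolding W_def by (intro Henstock_Kurzweil_Integration.integral_nonneg) auto
    \<comment> \<open>\<open>norm (q t0)\<close> is \<open>2 * e\<close>, while near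
      \<open>t0\<close> the deviation from \<open>q t0\<close> is at most \<open>e\<close>: half of
      the peak survives and has to be paid for by the far part.\<close>
    hence "2 * e * integral W (c n) = norm (q t0 * of_real (integral W (c n)))"
      by (simp add: e_def norm_mult)
    also have "q t0 * of_real (integral W (c n)) = integral W (\<lambda>t. (q t0 - q t) * of_real (c n t))"
    proof -
      have "((\<lambda>t. q t0 * of_real (c n t)) has_integral q t0 * of_real (integral W (c n))) W"
        using I by (intro has_integral_mult_right has_integral_of_real integrable_integral) (auto simp: W_def)
      from has_integral_diff[OF this integrable_integral[OF Iq]]
      show ?thesis by (simp add: zero_int left_diff_distrib integral_unique)
    qed
    also have "norm \<dots> \<le> integral W (\<lambda>t. e * c n t + 2 * M * A ^ (2 * n + 1))"
    proof (rule integral_norm_bound_integral)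
      show "(\<lambda>t. (q t0 - q t) * of_real (c n t)) integrable_on W" unfolding W_def
        by (intro integrable_continuous_real continuous_intros continuous_on_subset[OF cont] cc) auto
      show "(\<lambda>t. e * c n t + 2 * M * A ^ (2 * n + 1)) integrable_on W" unfolding W_def
        by (intro integrable_continuous_real continuous_intros cc)
      show "norm ((q t0 - q t) * of_real (c n t)) \<le> e * c n t + 2 * M * A ^ (2 * n + 1)" if "t \<in> W" for t
        using key[OF that] c_nonneg[OF that] by (simp add: norm_mult)
    qed
    also have "\<dots> = e * integral W (c n) + 2 * M * A ^ (2 * n + 1)"
      unfolding W_def by (subst integral_add) (auto intro!: integrable_continuous_real continuous_intros cc)
    finally have 1: "e * integral W (c n) \<le> 2 * M * A ^ (2 * n + 1)" by simp
    have "d * B ^ (2 * n + 1) = integral {t0 - d / 2..t0 + d / 2} (\<lambda>_. B ^ (2 * n + 1))"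
      using d by simp
    also have "\<dots> \<le> integral {t0 - d / 2..t0 + d / 2} (c n)"
    proof (intro integral_le I)
      fix t assume "t \<in> {t0 - d / 2..t0 + d / 2}"
      hence t: "\<bar>t - t0\<bar> \<le> d / 2" unfolding atLeastAtMost_iff by linarith
      have "B \<le> cos (pi * \<bar>t - t0\<bar>)" unfolding B_def
      proof (rule cos_monotone_0_pi_le)
        show "pi * \<bar>t - t0\<bar> \<le> pi * (d / 2)" using t by (intro mult_left_mono) auto
        show "pi * (d / 2) \<le> pi" using d by simp
      qed auto
      also have "cos (pi * \<bar>t - t0\<bar>) = cos (pi * (t - t0))"
        using cos_abs_real[of "pi * (t - t0)"] by (simp add: abs_mult)
      finally show "B ^ (2 * n + 1) \<le> c n t" unfolding c_def using AB by (intro power_mono) auto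
    qed auto
    also have "\<dots> \<le> integral W (c n)"
      using d c_nonneg I unfolding W_def by (intro integral_subset_le) (auto simp: W_def)
    finally have "e * (d * B ^ (2 * n + 1)) \<le> e * integral W (c n)" using e by (intro mult_left_mono) auto
    with 1 show ?thesis by linarith
  qed
  have "(\<lambda>n. 2 * M * A * ((A\<^sup>2 / B\<^sup>2) ^ n)) \<longlonglongrightarrow> 2 * M * A * 0"
  proof (intro tendsto_intros LIMSEQ_power_zero)
    have "A\<^sup>2 < B\<^sup>2" using AB by (intro power_strict_mono) auto
    thus "norm (A\<^sup>2 / B\<^sup>2) < 1" using AB by (simp add: abs_divide)
  qed
  hence lim: "(\<lambda>n. 2 * M * A * ((A\<^sup>2 / B\<^sup>2) ^ n)) \<longlonglongrightarrow> 0" by simp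
  have "e * d * B \<le> 2 * M * A * ((A\<^sup>2 / B\<^sup>2) ^ n)" for n
  proof -
    define a b where "a = (A\<^sup>2) ^ n" and "b = (B\<^sup>2) ^ n"
    have eqs: "A ^ (2 * n + 1) = A * a" "B ^ (2 * n + 1) = B * b" "(A\<^sup>2 / B\<^sup>2) ^ n = a / b" "b > 0"
      using AB power_mult[of A 2 n] power_mult[of B 2 n] by (simp_all add: a_def b_def power_divide)
    have "e * (d * (B * b)) \<le> 2 * M * (A * a)" using bound[of n] by (simp only: eqs)
    thus ?thesis unfolding eqs(3) using eqs(4) by (simp add: field_simps)
  qed
  hence "e * d * B \<le> 0" by (intro LIMSEQ_le_const[OF lim]) auto
  moreover have "e * d * B > 0" using e d AB by simp
  ultimately show False by simp
qed

text \<open>Absolute summability makes the series \<open>S\<close> converge uniformly, so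
  \<open>S\<close> is continuous, antiperiodic and has the coefficients of \<open>q\<close>; the
  difference then vanishes by uniqueness.\<close>

lemma half_series_inversion:
  assumes cont: "continuous_on UNIV q" and anti: "\<And>t. q (t + 1) = - q t"
    and summ: "(\<lambda>k. norm (half_coeff q k)) summable_on UNIV"
  shows "((\<lambda>k. half_coeff q k * half_char k t) has_sum q t) UNIV"
proof -
  define S where "S = (\<lambda>t. \<Sum>\<^sub>\<infinity>k. half_coeff q k * half_char k t)"
  define T where "T = (\<lambda>X t. \<Sum>k\<in>X. half_coeff q k * half_char k t)"
  have lim: "uniform_limit A T S (finite_subsets_at_top UNIV)" for A
    unfolding S_def T_def using summ
    by (intro Weierstrass_m_test_general[where M = "\<lambda>k. norm (half_coeff q k)"]) (auto simp: norm_mult)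
  have cT: "continuous_on A (T X)" for A X
    unfolding T_def by (intro continuous_intros)
  have cS: "continuous_on A S" for A
    by (rule uniform_limit_theorem[OF _ lim]) (auto simp: cT intro!: always_eventually)
  have sums: "((\<lambda>k. half_coeff q k * half_char k t) has_sum S t) UNIV" for t
    unfolding has_sum_def using tendsto_uniform_limitI[OF lim[of UNIV], of t] by (simp add: T_def)
  have aS: "S (t + 1) = - S t" for t
    unfolding S_def by (simp add: half_char_add_1 infsum_uminus)
  have "half_coeff S l = half_coeff q l" for l
  proof -
    have "uniform_limit {0..1} (\<lambda>X t. T X t * half_char l (- t)) (\<lambda>t. S t * half_char l (- t))
        (finite_subsets_at_top UNIV)"
      by (intro uniform_lim_mult lim uniform_limit_const)
         (auto intro!: compact_imp_bounded compact_continuous_image continuous_intros cS)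
    then obtain I J where I: "\<And>X. ((\<lambda>t. T X t * half_char l (- t)) has_integral I X) {0..1}"
        and J: "((\<lambda>t. S t * half_char l (- t)) has_integral J) {0..1}"
        and IJ: "(I \<longlongrightarrow> J) (finite_subsets_at_top UNIV)"
      by (rule uniform_limit_integral) (auto intro!: continuous_intros cT)
    \<comment> \<open>By orthonormality, every finite partial sum whose index set contains
      \<open>l\<close> already has the right coefficient.\<close>
    have "I X = half_coeff q l" if "finite X" "l \<in> X" for X
    proof -
      have "((\<lambda>t. \<Sum>k\<in>X. half_coeff q k * (half_char k t * half_char l (- t))) has_integral
          (\<Sum>k\<in>X. half_coeff q k * (if k = l then 1 else 0))) {0..1}"
        by (intro has_integral_sum that has_integral_mult_right half_char_orthonormal)
      also have "(\<Sum>k\<in>X. half_coeff q k * (if k = l then 1 else 0)) = half_coeff q l"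
        using that by (simp add: if_distrib cong: if_cong)
      also have "(\<lambda>t. \<Sum>k\<in>X. half_coeff q k * (half_char k t * half_char l (- t)))
          = (\<lambda>t. T X t * half_char l (- t))"
        by (simp add: T_def sum_distrib_right mult.assoc)
      finally show ?thesis using I[of X] by (blast intro: has_integral_unique)
    qed
    hence "\<forall>\<^sub>F X in finite_subsets_at_top UNIV. I X = half_coeff q l"
      unfolding eventually_finite_subsets_at_top by (intro exI[of _ "{l}"]) auto
    hence "(I \<longlongrightarrow> half_coeff q l) (finite_subsets_at_top UNIV)"
      by (rule tendsto_eventually)
    hence "J = half_coeff q l" using tendsto_unique[OF _ IJ] by auto
    thus ?thesis using J by (simp add: half_coeff_def integral_unique)
  qed
  hence "half_coeff (\<lambda>t. S t - q t) l = 0" for l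
    by (subst half_coeff_diff) (auto intro: cS continuous_on_subset[OF cont])
  moreover have "continuous_on UNIV (\<lambda>t. S t - q t)"
    by (intro continuous_on_diff cS cont)
  moreover have "S (t + 1) - q (t + 1) = - (S t - q t)" for t
    by (simp add: aS anti)
  ultimately have "S t - q t = 0" for t
    by (rule antiperiodic_zero_coeffs_imp_zero[rotated 2])
  thus ?thesis using sums[of t] by simp
qed

section \<open>Bounded variation\<close>

text \<open>An upper bound for the variation, tested on finite chains that may start and end
  anywhere in {a..b}. Such bounds add up over the terms of a series and pass to pointwise
  limits.\<close>

definition variation_le :: "(real \<Rightarrow> real) \<Rightarrow> real \<Rightarrow> real \<Rightarrow> real \<Rightarrow> bool" where
  "variation_le h a b V \<longleftrightarrow> (\<forall>n x. (\<forall>i\<le>n. x i \<in> {a..b}) \<longrightarrow> (\<forall>i<n. x i \<le> x (Suc i)) \<longrightarrow>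
     (\<Sum>i<n. \<bar>h (x (Suc i)) - h (x i)\<bar>) \<le> V)"

lemma variation_leD:
  assumes "variation_le h a b V" "\<And>i. i \<le> n \<Longrightarrow> x i \<in> {a..b}" "\<And>i. i < n \<Longrightarrow> x i \<le> x (Suc i)"
  shows "(\<Sum>i<n. \<bar>h (x (Suc i)) - h (x i)\<bar>) \<le> V"
  using assms unfolding variation_le_def by blast

lemma variation_leI:
  assumes "\<And>n x. (\<And>i. i \<le> n \<Longrightarrow> x i \<in> {a..b}) \<Longrightarrow> (\<And>i. i < n \<Longrightarrow> x i \<le> x (Suc i)) \<Longrightarrow>
    (\<Sum>i<n. \<bar>h (x (Suc i)) - h (x i)\<bar>) \<le> V"
  shows "variation_le h a b V"
  using assms unfolding variation_le_def by blast

lemma variation_le_weaken: "variation_le h a b V \<Longrightarrow> V \<le> W \<Longrightarrow> variation_le h a b W"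
  unfolding variation_le_def by (meson order.trans)

lemma variation_le_cong:
  assumes "\<And>x. x \<in> {a..b} \<Longrightarrow> h x = h' x"
  shows "variation_le h a b V \<longleftrightarrow> variation_le h' a b V"
proof -
  have "variation_le h' a b V" if "variation_le h a b V" "\<And>x. x \<in> {a..b} \<Longrightarrow> h x = h' x" for h h' :: "real \<Rightarrow> real"
  proof (rule variation_leI)
    fix n and x :: "nat \<Rightarrow> real"
    assume x: "\<And>i. i \<le> n \<Longrightarrow> x i \<in> {a..b}" "\<And>i. i < n \<Longrightarrow> x i \<le> x (Suc i)"
    have "(\<Sum>i<n. \<bar>h' (x (Suc i)) - h' (x i)\<bar>) = (\<Sum>i<n. \<bar>h (x (Suc i)) - h (x i)\<bar>)"
      using x(1) that(2) by (intro sum.cong) auto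
    also have "\<dots> \<le> V" by (intro variation_leD[OF that(1)] x)
    finally show "(\<Sum>i<n. \<bar>h' (x (Suc i)) - h' (x i)\<bar>) \<le> V" .
  qed
  from this[of h h'] this[of h' h] show ?thesis using assms by auto
qed

lemma variation_le_mono:
  assumes "\<And>x y. a \<le> x \<Longrightarrow> x \<le> y \<Longrightarrow> y \<le> b \<Longrightarrow> h x \<le> h y" and "a \<le> b"
  shows "variation_le h a b (h b - h a)"
proof (rule variation_leI)
  fix n and x :: "nat \<Rightarrow> real"
  assume x: "\<And>i. i \<le> n \<Longrightarrow> x i \<in> {a..b}" "\<And>i. i < n \<Longrightarrow> x i \<le> x (Suc i)"
  have "(\<Sum>i<n. \<bar>h (x (Suc i)) - h (x i)\<bar>) = (\<Sum>i<n. h (x (Suc i)) - h (x i))"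
  proof (intro sum.cong refl)
    fix i assume "i \<in> {..<n}"
    hence "h (x i) \<le> h (x (Suc i))" using x(1)[of i] x(1)[of "Suc i"] x(2)[of i] by (intro assms) auto
    thus "\<bar>h (x (Suc i)) - h (x i)\<bar> = h (x (Suc i)) - h (x i)" by simp
  qed
  also have "\<dots> = h (x n) - h (x 0)" by (rule sum_lessThan_telescope)
  also have "\<dots> \<le> h b - h a"
    using x(1)[of n] x(1)[of 0] assms by (intro diff_mono assms(1)) auto
  finally show "(\<Sum>i<n. \<bar>h (x (Suc i)) - h (x i)\<bar>) \<le> h b - h a" .
qed

lemma variation_le_add:
  assumes "variation_le h a b V" "variation_le h' a b V'"
  shows "variation_le (\<lambda>x. h x + h' x) a b (V + V')"
proof (rule variation_leI)
  fix n and x :: "nat \<Rightarrow> real"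
  assume x: "\<And>i. i \<le> n \<Longrightarrow> x i \<in> {a..b}" "\<And>i. i < n \<Longrightarrow> x i \<le> x (Suc i)"
  have "(\<Sum>i<n. \<bar>h (x (Suc i)) + h' (x (Suc i)) - (h (x i) + h' (x i))\<bar>)
      \<le> (\<Sum>i<n. \<bar>h (x (Suc i)) - h (x i)\<bar> + \<bar>h' (x (Suc i)) - h' (x i)\<bar>)"
    by (intro sum_mono) linarith
  also have "\<dots> \<le> V + V'"
    unfolding sum.distrib by (intro add_mono variation_leD[OF assms(1)] variation_leD[OF assms(2)] x)
  finally show "(\<Sum>i<n. \<bar>h (x (Suc i)) + h' (x (Suc i)) - (h (x i) + h' (x i))\<bar>) \<le> V + V'" .
qed

lemma variation_le_const_add: "variation_le h a b V \<Longrightarrow> variation_le (\<lambda>x. c + h x) a b V"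
  by (simp add: variation_le_def)

lemma variation_le_cmult:
  assumes "variation_le h a b V"
  shows "variation_le (\<lambda>x. c * h x) a b (\<bar>c\<bar> * V)"
proof (rule variation_leI)
  fix n and x :: "nat \<Rightarrow> real"
  assume x: "\<And>i. i \<le> n \<Longrightarrow> x i \<in> {a..b}" "\<And>i. i < n \<Longrightarrow> x i \<le> x (Suc i)"
  have "(\<Sum>i<n. \<bar>c * h (x (Suc i)) - c * h (x i)\<bar>) = \<bar>c\<bar> * (\<Sum>i<n. \<bar>h (x (Suc i)) - h (x i)\<bar>)"
    by (simp add: sum_distrib_left abs_mult flip: right_diff_distrib)
  also have "\<dots> \<le> \<bar>c\<bar> * V" by (intro mult_left_mono variation_leD[OF assms] x) auto
  finally show "(\<Sum>i<n. \<bar>c * h (x (Suc i)) - c * h (x i)\<bar>) \<le> \<bar>c\<bar> * V" .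
qed

lemma variation_le_sum:
  assumes "\<And>m. variation_le (h m) a b (V m)"
  shows "variation_le (\<lambda>x. \<Sum>m<N :: nat. h m x) a b (\<Sum>m<N. V m)"
proof (induction N)
  case (Suc N)
  from variation_le_add[OF Suc assms[of N]] show ?case by simp
qed (simp add: variation_le_def)

text \<open>A fixed chain involves only finitely many values, so pointwise convergence
  suffices.\<close>

lemma variation_le_limit:
  assumes "\<And>N. variation_le (h N) a b V" "\<And>x. x \<in> {a..b} \<Longrightarrow> (\<lambda>N. h N x) \<longlonglongrightarrow> l x"
  shows "variation_le l a b V"
proof (rule variation_leI)
  fix n and x :: "nat \<Rightarrow> real"
  assume x: "\<And>i. i \<le> n \<Longrightarrow> x i \<in> {a..b}" "\<And>i. i < n \<Longrightarrow> x i \<le> x (Suc i)"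
  have "(\<lambda>N. \<Sum>i<n. \<bar>h N (x (Suc i)) - h N (x i)\<bar>) \<longlonglongrightarrow> (\<Sum>i<n. \<bar>l (x (Suc i)) - l (x i)\<bar>)"
    using x(1) by (intro tendsto_intros assms(2)) (auto simp del: atLeastAtMost_iff)
  thus "(\<Sum>i<n. \<bar>l (x (Suc i)) - l (x i)\<bar>) \<le> V"
    by (rule LIMSEQ_le_const2) (intro exI allI impI variation_leD[OF assms(1)] x)
qed

lemma variation_le_compose_mono:
  assumes "variation_le h a b V" "\<And>x. x \<in> {c..d} \<Longrightarrow> u x \<in> {a..b}"
    "\<And>x y. c \<le> x \<Longrightarrow> x \<le> y \<Longrightarrow> y \<le> d \<Longrightarrow> u x \<le> u y"
  shows "variation_le (\<lambda>x. h (u x)) c d V"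
proof (rule variation_leI)
  fix n and x :: "nat \<Rightarrow> real"
  assume x: "\<And>i. i \<le> n \<Longrightarrow> x i \<in> {c..d}" "\<And>i. i < n \<Longrightarrow> x i \<le> x (Suc i)"
  show "(\<Sum>i<n. \<bar>h (u (x (Suc i))) - h (u (x i))\<bar>) \<le> V"
  proof (rule variation_leD[OF assms(1)])
    show "u (x i) \<le> u (x (Suc i))" if "i < n" for i
      using x(1)[of i] x(1)[of "Suc i"] x(2)[of i] that by (intro assms(3)) auto
  qed (use x assms(2) in blast)
qed

lemma variation_le_mult:
  assumes h: "variation_le h a b V" "\<And>x. x \<in> {a..b} \<Longrightarrow> \<bar>h x\<bar> \<le> M"
    and h': "variation_le h' a b V'" "\<And>x. x \<in> {a..b} \<Longrightarrow> \<bar>h' x\<bar> \<le> M'" and M: "0 \<le> M" "0 \<le> M'"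
  shows "variation_le (\<lambda>x. h x * h' x) a b (M * V' + M' * V)"
proof (rule variation_leI)
  fix n and x :: "nat \<Rightarrow> real"
  assume x: "\<And>i. i \<le> n \<Longrightarrow> x i \<in> {a..b}" "\<And>i. i < n \<Longrightarrow> x i \<le> x (Suc i)"
  have "(\<Sum>i<n. \<bar>h (x (Suc i)) * h' (x (Suc i)) - h (x i) * h' (x i)\<bar>)
      \<le> (\<Sum>i<n. M * \<bar>h' (x (Suc i)) - h' (x i)\<bar> + M' * \<bar>h (x (Suc i)) - h (x i)\<bar>)"
  proof (rule sum_mono)
    fix i assume "i \<in> {..<n}"
    hence i: "x i \<in> {a..b}" "x (Suc i) \<in> {a..b}" using x(1)[of i] x(1)[of "Suc i"] by auto
    have "h (x (Suc i)) * h' (x (Suc i)) - h (x i) * h' (x i)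
        = h (x (Suc i)) * (h' (x (Suc i)) - h' (x i)) + h' (x i) * (h (x (Suc i)) - h (x i))"
      by (simp add: algebra_simps)
    also have "\<bar>\<dots>\<bar> \<le> \<bar>h (x (Suc i))\<bar> * \<bar>h' (x (Suc i)) - h' (x i)\<bar> + \<bar>h' (x i)\<bar> * \<bar>h (x (Suc i)) - h (x i)\<bar>"
      by (metis abs_mult abs_triangle_ineq)
    also have "\<dots> \<le> M * \<bar>h' (x (Suc i)) - h' (x i)\<bar> + M' * \<bar>h (x (Suc i)) - h (x i)\<bar>"
      using i h(2) h'(2) by (intro add_mono mult_right_mono) auto
    finally show "\<bar>h (x (Suc i)) * h' (x (Suc i)) - h (x i) * h' (x i)\<bar>
      \<le> M * \<bar>h' (x (Suc i)) - h' (x i)\<bar> + M' * \<bar>h (x (Suc i)) - h (x i)\<bar>" .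
  qed
  also have "\<dots> \<le> M * V' + M' * V"
    unfolding sum.distrib sum_distrib_left[symmetric] using M
    by (intro add_mono mult_left_mono variation_leD[OF h(1)] variation_leD[OF h'(1)] x)
  finally show "(\<Sum>i<n. \<bar>h (x (Suc i)) * h' (x (Suc i)) - h (x i) * h' (x i)\<bar>) \<le> M * V' + M' * V" .
qed

section \<open>Mellin transforms\<close>

text \<open>\<open>chi' k * ln 2\<close> is \<open>2 * k + 1\<close> times pi times the imaginary
  unit, so in the variable \<open>t = log 2 u\<close> the imaginary part of the exponent becomes the
  character. The factor \<open>2 powr t\<close> will cancel against the Jacobian.\<close>

lemma powr_chi':
  "complex_of_real (2 powr t) powr (of_real \<rho> + chi' k + 1) = of_real (2 powr (\<rho> * t) * 2 powr t) * half_char k t"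
proof -
  have "complex_of_real (2 powr t) powr (of_real \<rho> + chi' k + 1)
      = exp ((of_real \<rho> + chi' k + 1) * of_real (t * ln 2))"
    using Ln_of_real[of "2 powr t"] powr_def[of "complex_of_real (2 powr t)" "of_real \<rho> + chi' k + 1"]
    by (simp add: ln_powr)
  also have "(of_real \<rho> + chi' k + 1) * of_real (t * ln 2)
      = of_real (\<rho> * t * ln 2) + of_real (t * ln 2) + of_int (2 * k + 1) * of_real pi * \<i> * of_real t"
    by (simp add: chi'_def field_simps)
  finally show ?thesis
    by (simp only: exp_add half_char_def exp_of_real) (simp add: powr_def mult_ac)
qed

lemma mellin_kernel_continuous:
  assumes "continuous_on {a..b} w" "a > 0"
  shows "continuous_on {a..b} (\<lambda>u. of_real (w u) / of_real u powr (of_real \<rho> + chi' k + 1))"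
  using assms by (intro continuous_intros) (auto simp: complex_nonpos_Reals_iff)

lemma mellin_substitution:
  assumes w: "continuous_on {1..X} w" and X: "1 \<le> X"
  shows "integral {1..X} (\<lambda>u. of_real (w u) / of_real u powr (of_real \<rho> + chi' k + 1))
    = of_real (ln 2) * integral {0..log 2 X} (\<lambda>t. of_real (2 powr (- \<rho> * t) * w (2 powr t)) * half_char k (- t))"
proof -
  define K where "K = (\<lambda>u. of_real (w u) / complex_of_real u powr (of_real \<rho> + chi' k + 1))"
  have im: "2 powr t \<in> {1..X}" if "t \<in> {0..log 2 X}" for t :: real
  proof -
    have "2 powr t \<le> 2 powr log 2 X" using that by (intro powr_mono) auto
    thus ?thesis using that X by (auto simp: ge_one_powr_ge_zero)
  qed
  have "((\<lambda>t. (2 powr t * ln 2) *\<^sub>R K (2 powr t)) has_integral (integral {2 powr 0..2 powr log 2 X} K)) {0..log 2 X}"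
    unfolding K_def
  proof (rule has_integral_substitution[OF _ _ _ mellin_kernel_continuous[OF w]])
    show "(\<lambda>t. 2 powr t) ` {0..log 2 X} \<subseteq> {1..X}" using im by blast
    show "((\<lambda>t. 2 powr t) has_field_derivative 2 powr t * ln 2) (at t within {0..log 2 X})" for t :: real
      unfolding powr_def by (auto intro!: derivative_eq_intros)
  qed (use X in auto)
  moreover have "(2 powr t * ln 2) *\<^sub>R K (2 powr t)
      = of_real (ln 2) * (of_real (2 powr (- \<rho> * t) * w (2 powr t)) * half_char k (- t))" for t
  proof -
    have "half_char k t \<noteq> 0" using norm_half_char[of k t] by force
    have "half_char k (- t) * half_char k t = 1" by (simp flip: half_char_add)
    hence "half_char k (- t) = 1 / half_char k t" using \<open>half_char k t \<noteq> 0\<close> by (simp add: field_simps)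
    thus ?thesis using \<open>half_char k t \<noteq> 0\<close>
      unfolding K_def powr_chi' scaleR_conv_of_real
      by (simp add: powr_minus field_simps)
  qed
  ultimately have "((\<lambda>t. of_real (ln 2) * (of_real (2 powr (- \<rho> * t) * w (2 powr t)) * half_char k (- t)))
      has_integral integral {1..X} K) {0..log 2 X}"
    using X by simp
  from integral_unique[OF this] show ?thesis unfolding K_def integral_mult_right by (rule sym)
qed

text \<open>Iterated antiderivatives of \<open>u powr (- s - 2)\<close>. With
  \<open>s = \<rho> - 1 + chi' k\<close> this is the reciprocal of the power in
  \<open>kernel_g\<close>, see \<open>kernel_exponent\<close>.\<close>

lemma powr_second_antiderivative:
  fixes s :: complex
  assumes s: "s \<noteq> 0" "s + 1 \<noteq> 0" and u: "u > 0"
  shows "((\<lambda>u. of_real u powr - s / (s * (s + 1))) has_vector_derivative - (of_real u powr (- s - 1)) / (s + 1)) (at u within A)"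
    and "((\<lambda>u. - (of_real u powr (- s - 1)) / (s + 1)) has_vector_derivative of_real u powr (- s - 2)) (at u within A)"
proof -
  have u': "complex_of_real u \<notin> \<real>\<^sub>\<le>\<^sub>0" using u by (simp add: complex_nonpos_Reals_iff)
  have "((\<lambda>z. z powr - s / (s * (s + 1))) has_field_derivative (- s * of_real u powr (- s - 1)) / (s * (s + 1))) (at (of_real u))"
    using s u' by (intro derivative_eq_intros refl | simp)+
  also have "(- s * of_real u powr (- s - 1)) / (s * (s + 1)) = - (of_real u powr (- s - 1)) / (s + 1)"
    using s by simp
  finally have "((\<lambda>z. z powr - s / (s * (s + 1))) has_field_derivative - (of_real u powr (- s - 1)) / (s + 1)) (at (of_real u))" .
  from has_vector_derivative_real_field[OF this]
  show "((\<lambda>u. of_real u powr - s / (s * (s + 1))) has_vector_derivative - (of_real u powr (- s - 1)) / (s + 1)) (at u within A)"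
    by (rule has_vector_derivative_at_within)
  have e: "- s - 1 - 1 = - s - (2::complex)" by simp
  have "((\<lambda>z. - (z powr (- s - 1)) / (s + 1)) has_field_derivative (- ((- s - 1) * of_real u powr (- s - 1 - 1)) / (s + 1))) (at (of_real u))"
    using s u' by (intro derivative_eq_intros refl | simp)+
  also have "- ((- s - 1) * of_real u powr (- s - 1 - 1)) / (s + 1) = of_real u powr (- s - 2)"
    unfolding e using s by (simp add: field_simps)
  finally have "((\<lambda>z. - (z powr (- s - 1)) / (s + 1)) has_field_derivative of_real u powr (- s - 2)) (at (of_real u))" .
  from has_vector_derivative_real_field[OF this]
  show "((\<lambda>u. - (of_real u powr (- s - 1)) / (s + 1)) has_vector_derivative of_real u powr (- s - 2)) (at u within A)"
    by (rule has_vector_derivative_at_within)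
qed

text \<open>Two integrations by parts: the second derivative of an affine function vanishes.\<close>

lemma integral_affine_powr:
  fixes s :: complex and p q a b :: real
  assumes s: "s \<noteq> 0" "s + 1 \<noteq> 0" and ab: "0 < a" "a \<le> b"
  shows "((\<lambda>u. of_real (p + q * u) * of_real u powr (- s - 2)) has_integral
    (of_real (p + q * b) * (- (of_real b powr (- s - 1)) / (s + 1)) - of_real q * (of_real b powr - s / (s * (s + 1)))
     - (of_real (p + q * a) * (- (of_real a powr (- s - 1)) / (s + 1)) - of_real q * (of_real a powr - s / (s * (s + 1)))))) {a..b}"
proof (rule fundamental_theorem_of_calculus[OF ab(2)])
  fix u assume u: "u \<in> {a..b}"
  hence "u > 0" using ab by auto
  note d = powr_second_antiderivative[OF s this, of "{a..b}"]
  have l: "((\<lambda>u. complex_of_real (p + q * u)) has_vector_derivative of_real q) (at u within {a..b})"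
    by (intro has_vector_derivative_of_real) (auto intro!: derivative_eq_intros)
  have "((\<lambda>u. of_real (p + q * u) * (- (of_real u powr (- s - 1)) / (s + 1)) - of_real q * (of_real u powr - s / (s * (s + 1))))
      has_vector_derivative (of_real (p + q * u) * of_real u powr (- s - 2) + of_real q * (- (of_real u powr (- s - 1)) / (s + 1))
        - of_real q * (- (of_real u powr (- s - 1)) / (s + 1)))) (at u within {a..b})"
    by (intro has_vector_derivative_diff has_vector_derivative_mult has_vector_derivative_mult_right d l)
  thus "((\<lambda>u. of_real (p + q * u) * (- (of_real u powr (- s - 1)) / (s + 1)) - of_real q * (of_real u powr - s / (s * (s + 1))))
      has_vector_derivative of_real (p + q * u) * of_real u powr (- s - 2)) (at u within {a..b})"
    by simp
qed

section \<open>The recurrence and its antiperiodic limit\<close>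

locale antiperiodic_recurrence =
  fixes \<alpha> \<beta> \<rho> :: real
    and f g :: "nat \<Rightarrow> real"
    and \<phi> F G P :: "real \<Rightarrow> real"
  assumes neg: "\<alpha> < 0" "\<beta> < 0"
    and rho: "\<rho> = log 2 (\<bar>\<alpha>\<bar> + \<bar>\<beta>\<bar>)"
    and phi: "\<phi> = phi \<bar>\<alpha>\<bar> \<bar>\<beta>\<bar>"
    and rec: "\<And>n. n \<ge> 2 \<Longrightarrow>
      f n = \<alpha> * f (nat \<lfloor>real n / 2\<rfloor>) + \<beta> * f (nat \<lceil>real n / 2\<rceil>) + g n"
    and g1: "g 1 = 0"
    and F: "F = interp \<phi> f"
    and G: "G = interp0 \<phi> g"
    and P: "P = (\<lambda>t. bisum (Pterm \<rho> G t) + f 1 * P0 \<alpha> \<beta> \<phi> \<rho> t)"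
begin

text \<open>Condition (iv). The sum starts at 1; the term with index 0 would be \<open>G\<close>
  itself, which enters \<open>P\<close> but not \<open>Qfun\<close>.\<close>

definition uniform_series :: bool where
  "uniform_series \<longleftrightarrow> uniformly_convergent_on {1..2} (\<lambda>N x. \<Sum>m=1..N. Qterm \<rho> G m x)"

lemma sum_eq: "\<alpha> + \<beta> = - (2 powr \<rho>)"
  using neg by (simp add: rho)

lemma is_phi: "is_phi \<bar>\<alpha>\<bar> \<bar>\<beta>\<bar> \<phi>"
  unfolding phi by (rule is_phi_phi) (use neg in auto)

lemma phi_continuous: "continuous_on {0..1} \<phi>" and phi_0 [simp]: "\<phi> 0 = 0" and phi_1 [simp]: "\<phi> 1 = 1"
  using is_phi by (auto simp: is_phi_def)

text \<open>\<open>\<phi>\<close> is built from the absolute values, but as both weights are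
  negative the signs cancel in the quotients; cleared of denominators, the equations have the
  coefficients of the recurrence itself.\<close>

lemma phi_half:
  "t \<in> {0..1/2} \<Longrightarrow> (\<alpha> + \<beta>) * \<phi> t = \<beta> * \<phi> (2 * t)"
  "t \<in> {1/2..1} \<Longrightarrow> (\<alpha> + \<beta>) * \<phi> t = \<alpha> * \<phi> (2 * t - 1) + \<beta>"
proof -
  have c: "\<alpha> + \<beta> \<noteq> 0" "\<bar>\<alpha>\<bar> + \<bar>\<beta>\<bar> = - (\<alpha> + \<beta>)" "\<bar>\<alpha>\<bar> = - \<alpha>" "\<bar>\<beta>\<bar> = - \<beta>" using neg by auto
  have L: "\<And>t. t \<in> {0..1/2} \<Longrightarrow> \<phi> t = \<beta> / (\<alpha> + \<beta>) * \<phi> (2 * t)"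
    and R: "\<And>t. t \<in> {1/2..1} \<Longrightarrow> \<phi> t = \<alpha> / (\<alpha> + \<beta>) * \<phi> (2 * t - 1) + \<beta> / (\<alpha> + \<beta>)"
    using is_phi unfolding is_phi_def c(2) unfolding c(3) c(4) minus_divide_divide by blast+
  show "(\<alpha> + \<beta>) * \<phi> t = \<beta> * \<phi> (2 * t)" if "t \<in> {0..1/2}"
    unfolding L[OF that] using c by simp
  show "(\<alpha> + \<beta>) * \<phi> t = \<alpha> * \<phi> (2 * t - 1) + \<beta>" if "t \<in> {1/2..1}"
    unfolding R[OF that] using c by (simp add: distrib_left)
qed

lemma phi_range: "t \<in> {0..1} \<Longrightarrow> 0 \<le> \<phi> t \<and> \<phi> t \<le> 1"
  using is_phi_range[OF _ _ is_phi] neg by auto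

lemma F_add: "t \<in> {0..1} \<Longrightarrow> F (real n + t) = (1 - \<phi> t) * f n + \<phi> t * f (n + 1)"
  unfolding F by (rule interp_add) auto

lemma F_of_nat: "F (real n) = f n"
  by (simp add: F interp_of_nat)

lemma G_add: "1 \<le> n \<Longrightarrow> t \<in> {0..1} \<Longrightarrow> G (real n + t) = (1 - \<phi> t) * g n + \<phi> t * g (n + 1)"
  using interp_add[of \<phi> t g n] by (simp add: G interp0_def)

lemma G_of_nat: "1 \<le> n \<Longrightarrow> G (real n) = g n"
  using G_add[of n 0] by simp

text \<open>\<open>g 1 = 0\<close> makes the zero extension meet the interpolation at 1. The closed
  bound matters: it kills \<open>Pterm\<close> at negative indices up to and including
  \<open>t = 1\<close>.\<close>

lemma G_le_1: "x \<le> 1 \<Longrightarrow> G x = 0"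
  using G_of_nat[of 1] g1 by (cases "x = 1") (auto simp: G interp0_def)

lemma F_continuous: "continuous_on {1..} F"
  unfolding F by (intro continuous_on_subset[OF continuous_on_interp] phi_continuous) auto

lemma G_continuous: "continuous_on UNIV G"
proof -
  have "continuous_on {1..} G"
    using continuous_on_subset[OF continuous_on_interp[of \<phi> g], of "{1..}"] phi_continuous
    by (subst continuous_on_cong[of _ "{1..}" _ "interp \<phi> g"]) (auto simp: G interp0_def)
  moreover have "continuous_on {..1} G"
    by (subst continuous_on_cong[of _ "{..1}" _ "\<lambda>_. 0"]) (auto simp: G_le_1)
  ultimately have "continuous_on ({1..} \<union> {..1}) G" by (intro continuous_on_closed_Un) auto
  moreover have "{1..} \<union> {..1} = (UNIV :: real set)" by auto
  ultimately show ?thesis by simp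
qed

section \<open>The doubling equation for the interpolated sequence\<close>

lemma rec_even: "1 \<le> n \<Longrightarrow> f (2 * n) = (\<alpha> + \<beta>) * f n + g (2 * n)"
  using rec[of "2 * n"] by (simp add: distrib_right)

lemma rec_odd: "1 \<le> n \<Longrightarrow> f (2 * n + 1) = \<alpha> * f n + \<beta> * f (n + 1) + g (2 * n + 1)"
proof -
  assume n: "1 \<le> n"
  have "\<lfloor>real (2 * n + 1) / 2\<rfloor> = int n" "\<lceil>real (2 * n + 1) / 2\<rceil> = int n + 1"
    by (intro floor_unique ceiling_unique; simp)+
  hence "nat \<lfloor>real (2 * n + 1) / 2\<rfloor> = n" "nat \<lceil>real (2 * n + 1) / 2\<rceil> = n + 1" by linarith+
  thus ?thesis using rec[of "2 * n + 1"] n by simp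
qed

text \<open>If \<open>x\<close> lies in the left half of a unit cell, \<open>2 * x\<close> lies in
  the cell starting at the even integer \<open>2 * n\<close>, otherwise in the next one. The two
  branches of \<open>phi_half\<close> fit the even and odd recurrences at the ends of these
  cells.\<close>

lemma F_double:
  assumes "1 \<le> x"
  shows "F (2 * x) = (\<alpha> + \<beta>) * F x + G (2 * x)"
proof -
  define n t where "n = nat \<lfloor>x\<rfloor>" and "t = frac x"
  have n: "1 \<le> n" using assms unfolding n_def by linarith
  have x: "x = real n + t" using assms by (simp add: n_def t_def frac_def)
  have t: "0 \<le> t" "t \<le> 1" using frac_lt_1[of x] by (auto simp: t_def)
  have Fx: "F x = f n + \<phi> t * (f (n + 1) - f n)"
    unfolding x using t by (subst F_add) (auto simp: algebra_simps)
  have cFx: "(\<alpha> + \<beta>) * F x = (\<alpha> + \<beta>) * f n + (\<alpha> + \<beta>) * \<phi> t * (f (n + 1) - f n)"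
    unfolding Fx by (simp add: algebra_simps)
  show ?thesis
  proof (cases "t \<le> 1/2")
    case True
    have e: "2 * x = real (2 * n) + 2 * t" by (simp add: x)
    have "F (2 * x) = (1 - \<phi> (2 * t)) * f (2 * n) + \<phi> (2 * t) * f (2 * n + 1)"
      "G (2 * x) = (1 - \<phi> (2 * t)) * g (2 * n) + \<phi> (2 * t) * g (2 * n + 1)"
      unfolding e using True t n by (intro F_add G_add; simp)+
    thus ?thesis unfolding cFx using rec_even[OF n] rec_odd[OF n] phi_half(1)[of t] t True
      by (simp add: algebra_simps)
  next
    case False
    have e: "2 * x = real (2 * n + 1) + (2 * t - 1)" by (simp add: x)
    have "F (2 * x) = (1 - \<phi> (2 * t - 1)) * f (2 * n + 1) + \<phi> (2 * t - 1) * f (2 * n + 1 + 1)"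
      "G (2 * x) = (1 - \<phi> (2 * t - 1)) * g (2 * n + 1) + \<phi> (2 * t - 1) * g (2 * n + 1 + 1)"
      unfolding e using False t n by (intro F_add G_add; simp)+
    moreover have "2 * n + 1 + 1 = 2 * (n + 1)" by simp
    ultimately show ?thesis unfolding cFx
      using rec_even[of "n + 1"] rec_odd[OF n] phi_half(2)[of t] t False n
      by (simp add: algebra_simps)
  qed
qed

text \<open>Only \<open>f 1\<close> and \<open>f 2 = (\<alpha> + \<beta>) * f 1 + g 2\<close> enter;
  apart from \<open>g 2\<close>, the slope \<open>f 2 - f 1\<close> is the origin of the coefficient
  \<open>\<alpha> + \<beta> - 1\<close> in \<open>P0\<close>.\<close>

lemma F_base:
  assumes "x \<in> {1..2}"
  shows "F x = f 1 * (1 + (\<alpha> + \<beta> - 1) * \<phi> (x - 1)) + G x"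
proof -
  have "F x = (1 - \<phi> (x - 1)) * f 1 + \<phi> (x - 1) * f 2"
    "G x = (1 - \<phi> (x - 1)) * g 1 + \<phi> (x - 1) * g 2"
    using F_add[of "x - 1" 1] G_add[of 1 "x - 1"] assms by (simp_all add: numeral_2_eq_2)
  moreover have "f 2 = (\<alpha> + \<beta>) * f 1 + g 2" using rec_even[of 1] by simp
  ultimately show ?thesis using g1 by (simp add: algebra_simps)
qed

section \<open>The series for Q and the two-sided series for P\<close>

lemma Qterm_eq: "Qterm \<rho> G m x = (\<alpha> + \<beta>) powi (- int m) * G (2 ^ m * x)"
proof -
  have "- (2 powr - \<rho>) = inverse (\<alpha> + \<beta>)"
    by (simp add: sum_eq powr_minus)
  thus ?thesis by (simp add: Qterm_def power_int_minus power_inverse)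
qed

lemma Qterm_div: "Qterm \<rho> G m x = G (2 ^ m * x) / (\<alpha> + \<beta>) ^ m"
  by (simp add: Qterm_eq power_int_minus divide_inverse mult.commute)

lemma Qterm_double: "Qterm \<rho> G m (2 * x) = (\<alpha> + \<beta>) * Qterm \<rho> G (Suc m) x"
proof -
  define c where "c = \<alpha> + \<beta>"
  have "c \<noteq> 0" using neg by (simp add: c_def)
  thus ?thesis unfolding Qterm_div c_def[symmetric] by (simp add: mult_ac)
qed

lemma F_iterate:
  assumes "1 \<le> y"
  shows "F (2 ^ N * y) = (\<alpha> + \<beta>) ^ N * (F y + (\<Sum>m=1..N. Qterm \<rho> G m y))"
proof (induction N)
  case (Suc N)
  define c where "c = \<alpha> + \<beta>"
  have c: "c \<noteq> 0" using neg by (simp add: c_def)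
  have "1 * 1 \<le> 2 ^ N * y" using assms by (intro mult_mono) auto
  hence "F (2 ^ Suc N * y) = c * F (2 ^ N * y) + G (2 ^ Suc N * y)"
    using F_double[of "2 ^ N * y"] by (simp add: mult.assoc c_def)
  also have "G (2 ^ Suc N * y) = c ^ Suc N * Qterm \<rho> G (Suc N) y"
    using c by (simp add: Qterm_div c_def)
  also have "c * F (2 ^ N * y) + c ^ Suc N * Qterm \<rho> G (Suc N) y
      = c ^ Suc N * (F y + (\<Sum>m=1..Suc N. Qterm \<rho> G m y))"
    unfolding Suc c_def[symmetric] by (simp add: algebra_simps)
  finally show ?case by (simp add: c_def)
qed auto

lemma Pterm_eq: "Pterm \<rho> G t m = 2 powr (- \<rho> * t) * ((\<alpha> + \<beta>) powi (- m) * G (2 powr (of_int m + t)))"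
proof -
  have "(\<alpha> + \<beta>) powi (- m) = ((-1) * 2 powr \<rho>) powi (- m)"
    by (simp add: sum_eq)
  also have "\<dots> = (-1) powi (- m) * (2 powr \<rho>) powi (- m)"
    by (rule power_int_mult_distrib)
  also have "(-1) powi (- m) = ((-1) powi m :: real)"
    by (simp add: power_int_minus flip: power_int_inverse)
  also have "(2 powr \<rho>) powi (- m) = 2 powr (- \<rho> * of_int m)"
    by (simp add: powr_powr flip: powr_real_of_int')
  finally have "(\<alpha> + \<beta>) powi (- m) = (-1) powi m * 2 powr (- \<rho> * of_int m)" .
  moreover have "2 powr (- \<rho> * (of_int m + t)) = 2 powr (- \<rho> * t) * 2 powr (- \<rho> * of_int m)"
    by (simp add: algebra_simps flip: powr_add)
  ultimately show ?thesis by (simp only: Pterm_def mult_ac)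
qed

lemma Pterm_add_1: "Pterm \<rho> G (t + 1) = (\<lambda>m. - Pterm \<rho> G t (m + 1))"
proof
  fix m :: int
  have "of_int m + (t + 1) = of_int (m + 1) + t" by simp
  thus "Pterm \<rho> G (t + 1) m = - Pterm \<rho> G t (m + 1)"
    unfolding Pterm_def by (simp only:) (simp add: power_int_add)
qed

lemma P0_add_1: "P0 \<alpha> \<beta> \<phi> \<rho> (t + 1) = - P0 \<alpha> \<beta> \<phi> \<rho> t"
proof -
  have "frac (t + 1) = frac t" by (simp add: frac_def)
  thus ?thesis by (simp add: P0_def power_int_add)
qed

text \<open>At \<open>t = 1\<close> the integer part jumps and the definition gives -1; the formula
  gives \<open>2 powr (- \<rho>) * (\<alpha> + \<beta>)\<close>, the same number. This agreement
  makes \<open>P0\<close> continuous across the integers.\<close>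

lemma P0_eq:
  assumes "t \<in> {0..1}"
  shows "P0 \<alpha> \<beta> \<phi> \<rho> t = 2 powr (- \<rho> * t) * (1 + (\<alpha> + \<beta> - 1) * \<phi> (2 powr t - 1))"
proof (cases "t = 1")
  case True
  have "P0 \<alpha> \<beta> \<phi> \<rho> 1 = -1" by (simp add: P0_def)
  thus ?thesis using True by (simp add: sum_eq powr_minus)
next
  case False
  hence "\<lfloor>t\<rfloor> = 0" "frac t = t" using assms by (auto simp: floor_eq_iff frac_eq)
  thus ?thesis by (simp add: P0_def)
qed

text \<open>For \<open>t\<close> in {0..1} a negative index means an argument of at most 1, where
  \<open>G\<close> vanishes: the two-sided series is one-sided there.\<close>

lemma Pterm_base:
  assumes "t \<in> {0..1}"
  shows "Pterm \<rho> G t (int n) = 2 powr (- \<rho> * t) * Qterm \<rho> G n (2 powr t)"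
    and "Pterm \<rho> G t (- int (Suc n)) = 0"
proof -
  show "Pterm \<rho> G t (int n) = 2 powr (- \<rho> * t) * Qterm \<rho> G n (2 powr t)"
    by (simp add: Pterm_eq Qterm_eq powr_add powr_realpow)
  have "2 powr (of_int (- int (Suc n)) + t) \<le> (2::real) powr 0"
    using assms by (intro powr_mono) auto
  thus "Pterm \<rho> G t (- int (Suc n)) = 0"
    by (simp only: Pterm_eq) (simp add: G_le_1)
qed

lemma Q_uniform_limit:
  assumes uniform_series
  shows "uniform_limit {1..2} (\<lambda>N x. \<Sum>m=1..N. Qterm \<rho> G m x) (Qfun \<rho> G) sequentially"
    and "\<And>x. x \<in> {1..2} \<Longrightarrow> summable (\<lambda>m. Qterm \<rho> G (Suc m) x)"
proof -
  obtain L where L: "uniform_limit {1..2} (\<lambda>N x. \<Sum>m=1..N. Qterm \<rho> G m x) L sequentially"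
    using assms by (auto simp: uniform_series_def uniformly_convergent_on_def)
  have "(\<lambda>m. Qterm \<rho> G (Suc m) x) sums L x" if "x \<in> {1..2}" for x
    using tendsto_uniform_limitI[OF L that] by (simp add: sums_def sum.atLeast1_atMost_eq)
  hence eq: "summable (\<lambda>m. Qterm \<rho> G (Suc m) x)" "L x = Qfun \<rho> G x" if "x \<in> {1..2}" for x
    using that by (auto simp: sums_iff Qfun_def)
  show "\<And>x. x \<in> {1..2} \<Longrightarrow> summable (\<lambda>m. Qterm \<rho> G (Suc m) x)" by (rule eq(1))
  show "uniform_limit {1..2} (\<lambda>N x. \<Sum>m=1..N. Qterm \<rho> G m x) (Qfun \<rho> G) sequentially"
    using eq(2) by (intro iffD1[OF uniform_limit_cong'[OF refl] L]) auto
qed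

lemma summable_Qterm_double:
  "summable (\<lambda>m. Qterm \<rho> G (Suc m) (2 * x)) \<longleftrightarrow> summable (\<lambda>m. Qterm \<rho> G (Suc m) x)"
proof -
  have "\<alpha> + \<beta> \<noteq> 0" using neg by simp
  thus ?thesis unfolding Qterm_double
    by (simp add: summable_Suc_iff[of "\<lambda>m. Qterm \<rho> G (Suc m) x"])
qed

text \<open>Doubling the argument shifts the series by one term, so summability at \<open>x\<close>
  and at \<open>2 * x\<close> are equivalent. A small \<open>x\<close> is doubled until it exceeds
  1, that point is reached from {1..2}, and the doublings are undone.\<close>

lemma Q_summable:
  assumes uniform_series "x > 0"
  shows "summable (\<lambda>m. Qterm \<rho> G (Suc m) x)"
proof -
  obtain n where n: "1 / x < 2 ^ n" using real_arch_pow[of 2 "1 / x"] by auto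
  hence "1 \<le> 2 ^ n * x" using assms by (simp add: field_simps)
  hence "summable (\<lambda>m. Qterm \<rho> G (Suc m) (2 ^ n * x))"
  proof (induction rule: dyadic_induct)
    case (base y)
    thus ?case using Q_uniform_limit(2)[OF assms(1)] by blast
  next
    case (double y)
    thus ?case by (simp add: summable_Qterm_double)
  qed
  thus ?thesis
    by (induction n) (simp_all add: summable_Qterm_double mult.assoc)
qed

lemma Q_double:
  assumes uniform_series "x > 0"
  shows "Qfun \<rho> G (2 * x) = (\<alpha> + \<beta>) * Qfun \<rho> G x - G (2 * x)"
proof -
  define c where "c = \<alpha> + \<beta>"
  have c: "c \<noteq> 0" using neg by (simp add: c_def)
  have s: "summable (\<lambda>m. Qterm \<rho> G (Suc m) x)" using assms by (rule Q_summable)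
  have "Qfun \<rho> G (2 * x) = (\<Sum>m. c * Qterm \<rho> G (Suc (Suc m)) x)"
    unfolding Qfun_def Qterm_double c_def ..
  also have "\<dots> = c * (\<Sum>m. Qterm \<rho> G (Suc (Suc m)) x)"
    using s by (intro suminf_mult) (subst summable_Suc_iff)
  also have "(\<Sum>m. Qterm \<rho> G (Suc (Suc m)) x) = Qfun \<rho> G x - Qterm \<rho> G 1 x"
    using suminf_split_head[OF s] by (simp add: Qfun_def)
  also have "c * (Qfun \<rho> G x - Qterm \<rho> G 1 x) = c * Qfun \<rho> G x - G (2 * x)"
    using c by (simp add: Qterm_div right_diff_distrib flip: c_def)
  finally show ?thesis by (simp add: c_def)
qed

lemma Q_iterate:
  assumes uniform_series "y > 0"
  shows "Qfun \<rho> G (2 ^ N * y) = (\<alpha> + \<beta>) ^ N * (Qfun \<rho> G y - (\<Sum>m=1..N. Qterm \<rho> G m y))"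
proof (induction N)
  case (Suc N)
  define c where "c = \<alpha> + \<beta>"
  have c: "c \<noteq> 0" using neg by (simp add: c_def)
  have "Qfun \<rho> G (2 ^ Suc N * y) = c * Qfun \<rho> G (2 ^ N * y) - G (2 ^ Suc N * y)"
    using Q_double[of "2 ^ N * y"] assms by (simp add: mult.assoc c_def)
  also have "G (2 ^ Suc N * y) = c ^ Suc N * Qterm \<rho> G (Suc N) y"
    using c by (simp add: Qterm_div c_def)
  also have "c * Qfun \<rho> G (2 ^ N * y) - c ^ Suc N * Qterm \<rho> G (Suc N) y
      = c ^ Suc N * (Qfun \<rho> G y - (\<Sum>m=1..Suc N. Qterm \<rho> G m y))"
    unfolding Suc c_def[symmetric] by (simp add: algebra_simps)
  finally show ?case by (simp add: c_def)
qed auto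

lemma powr_rho_double: "x > 0 \<Longrightarrow> (2 * x) powr \<rho> = - (\<alpha> + \<beta>) * x powr \<rho>"
  by (simp add: sum_eq powr_mult)

lemma powr_rho_iterate: "y > 0 \<Longrightarrow> (2 ^ N * y) powr \<rho> = (- (\<alpha> + \<beta>)) ^ N * y powr \<rho>"
proof (induction N)
  case (Suc N)
  have "(2 ^ Suc N * y) powr \<rho> = (2 * (2 ^ N * y)) powr \<rho>" by (simp add: mult.assoc)
  also have "\<dots> = - (\<alpha> + \<beta>) * (2 ^ N * y) powr \<rho>" using Suc.prems by (intro powr_rho_double) auto
  finally show ?case using Suc by simp
qed auto

lemma powr_rho_bounds:
  assumes "y \<in> {1..2}"
  shows "min 1 (2 powr \<rho>) \<le> y powr \<rho>" "y powr \<rho> \<le> max 1 (2 powr \<rho>)"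
proof -
  have "y powr \<rho> \<in> {1..2 powr \<rho>}" if "\<rho> \<ge> 0"
    using that assms by (auto intro: powr_mono2 ge_one_powr_ge_zero)
  moreover have "y powr \<rho> \<in> {2 powr \<rho>..1}" if "\<rho> \<le> 0"
    using that assms powr_mono2'[of \<rho> y 2] powr_mono2'[of \<rho> 1 y] by auto
  ultimately show "min 1 (2 powr \<rho>) \<le> y powr \<rho>" "y powr \<rho> \<le> max 1 (2 powr \<rho>)"
    by (cases "\<rho> \<ge> 0"; force)+
qed

text \<open>By \<open>Q_iterate\<close>, the value at \<open>x = 2 ^ N * y\<close> is
  \<open>(\<alpha> + \<beta>) ^ N\<close> times the tail of the series at \<open>y\<close> after
  \<open>N\<close> terms, and the modulus of that power times \<open>y powr \<rho>\<close> is
  \<open>x powr \<rho>\<close>. Uniformly small tails thus give the claim.\<close>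

lemma Q_smallo:
  assumes uniform_series
  shows "Qfun \<rho> G \<in> o(\<lambda>x. x powr \<rho>)"
proof (rule landau_o.smallI)
  fix e :: real assume e: "e > 0"
  \<comment> \<open>A lower bound for \<open>y powr \<rho>\<close> on {1..2}, valid for either sign
    of \<open>\<rho>\<close>.\<close>
  define k where "k = min 1 (2 powr \<rho>)"
  have k: "k > 0" by (simp add: k_def)
  have "\<forall>\<^sub>F N in sequentially. \<forall>y\<in>{1..2}. dist (\<Sum>m=1..N. Qterm \<rho> G m y) (Qfun \<rho> G y) < e * k"
    using Q_uniform_limit(1)[OF assms] e k by (intro uniform_limitD) auto
  then obtain N0 where N0: "\<And>N y. N \<ge> N0 \<Longrightarrow> y \<in> {1..2} \<Longrightarrow>
      \<bar>Qfun \<rho> G y - (\<Sum>m=1..N. Qterm \<rho> G m y)\<bar> < e * k"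
    unfolding eventually_sequentially dist_real_def by (metis abs_minus_commute)
  show "\<forall>\<^sub>F x in at_top. norm (Qfun \<rho> G x) \<le> e * norm (x powr \<rho>)"
    using eventually_ge_at_top[of "2 ^ N0"]
  proof eventually_elim
    case (elim x)
    have "(1::real) \<le> 2 ^ N0" by simp
    hence "1 \<le> x" using elim by linarith
    then obtain N y where y: "y \<in> {1..<2}" "x = 2 ^ N * y"
      using dyadic_decomposition by blast
    have "(2::real) ^ N0 < 2 ^ N * 2"
      using elim y by (elim le_less_trans) auto
    hence "(2::real) ^ N0 < 2 ^ Suc N" by simp
    hence "N \<ge> N0" by (subst (asm) power_strict_increasing_iff) auto
    have "\<bar>Qfun \<rho> G x\<bar> = \<bar>\<alpha> + \<beta>\<bar> ^ N * \<bar>Qfun \<rho> G y - (\<Sum>m=1..N. Qterm \<rho> G m y)\<bar>"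
      unfolding y(2) using y(1) by (subst Q_iterate[OF assms]) (auto simp: abs_mult power_abs)
    also have "\<dots> \<le> \<bar>\<alpha> + \<beta>\<bar> ^ N * (e * y powr \<rho>)"
    proof (intro mult_left_mono)
      have "e * k \<le> e * y powr \<rho>"
        using y e powr_rho_bounds(1)[of y] unfolding k_def by (intro mult_left_mono) auto
      thus "\<bar>Qfun \<rho> G y - (\<Sum>m=1..N. Qterm \<rho> G m y)\<bar> \<le> e * y powr \<rho>"
        using N0[OF \<open>N \<ge> N0\<close>, of y] y by auto
    qed auto
    also have "\<dots> = e * x powr \<rho>"
      unfolding y(2) using y(1) neg by (subst powr_rho_iterate) auto
    finally show ?case by simp
  qed
qed

text \<open>The term with index 0 is \<open>G\<close> up to the scaling factor; by
  \<open>F_base\<close> it combines with the multiple of \<open>P0\<close> to \<open>F\<close>. So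
  on {0..1} the function \<open>P\<close> is a rescaled \<open>F + Qfun\<close>.\<close>

lemma bisummable_Pterm_base:
  assumes uniform_series "t \<in> {0..1}"
  shows "bisummable (Pterm \<rho> G t)"
    and "P t = 2 powr (- \<rho> * t) * (F (2 powr t) + Qfun \<rho> G (2 powr t))"
proof -
  define x :: real where "x = 2 powr t"
  have x: "x \<in> {1..2}" using assms powr_mono[of t 1 2] by (auto simp: x_def ge_one_powr_ge_zero)
  have s: "summable (\<lambda>n. Qterm \<rho> G (Suc n) x)" using x by (intro Q_uniform_limit(2) assms)
  hence "(\<lambda>n. Qterm \<rho> G n x) sums (Qfun \<rho> G x + Qterm \<rho> G 0 x)"
    unfolding Qfun_def by (subst (asm) summable_sums_iff, subst (asm) sums_Suc_iff)
  hence "(\<lambda>n. Pterm \<rho> G t (int n)) sums (2 powr (- \<rho> * t) * (Qfun \<rho> G x + G x))"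
    unfolding Pterm_base(1)[OF assms(2)] x_def[symmetric]
    by (intro sums_mult) (simp add: Qterm_div)
  moreover have "(\<lambda>n. Pterm \<rho> G t (- int (Suc n))) sums 0"
    unfolding Pterm_base(2)[OF assms(2)] by simp
  ultimately have b: "bisummable (Pterm \<rho> G t)"
    and bs: "bisum (Pterm \<rho> G t) = 2 powr (- \<rho> * t) * (Qfun \<rho> G x + G x)"
    unfolding bisummable_def bisum_def by (auto simp: sums_iff)
  show "bisummable (Pterm \<rho> G t)" by (fact b)
  have "P t = 2 powr (- \<rho> * t) * (Qfun \<rho> G x + G x)
      + f 1 * (2 powr (- \<rho> * t) * (1 + (\<alpha> + \<beta> - 1) * \<phi> (x - 1)))"
    by (simp only: P bs P0_eq[OF assms(2)] x_def)
  also have "\<dots> = 2 powr (- \<rho> * t) * (F x + Qfun \<rho> G x)"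
    by (simp only: F_base[OF x]) (simp add: algebra_simps)
  finally show "P t = 2 powr (- \<rho> * t) * (F (2 powr t) + Qfun \<rho> G (2 powr t))"
    by (simp only: x_def)
qed

lemma bisummable_Pterm:
  assumes uniform_series
  shows "bisummable (Pterm \<rho> G t)"
proof -
  have iff: "bisummable (Pterm \<rho> G (t + 1)) \<longleftrightarrow> bisummable (Pterm \<rho> G t)" for t
  proof
    assume "bisummable (Pterm \<rho> G (t + 1))"
    hence "bisummable (\<lambda>m. Pterm \<rho> G t (m + 1))"
      using bisummable_uminus(1)[of "\<lambda>m. - Pterm \<rho> G t (m + 1)"] by (simp add: Pterm_add_1)
    thus "bisummable (Pterm \<rho> G t)" by (rule bisummable_unshift)
  next
    assume "bisummable (Pterm \<rho> G t)"
    from bisummable_uminus(1)[OF bisummable_shift(1)[OF this]]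
    show "bisummable (Pterm \<rho> G (t + 1))" by (simp add: Pterm_add_1)
  qed
  have "bisummable (Pterm \<rho> G (frac t + of_int k))" for k
  proof (induction k rule: int_induct[of _ 0])
    case base
    show ?case using frac_lt_1[of t] by (intro bisummable_Pterm_base[OF assms]) auto
  next
    case (step1 i)
    thus ?case using iff[of "frac t + of_int i"] by (simp add: add.assoc)
  next
    case (step2 i)
    thus ?case using iff[of "frac t + of_int (i - 1)"] by (simp add: algebra_simps)
  qed
  from this[of "\<lfloor>t\<rfloor>"] show ?thesis by (simp add: frac_def)
qed

lemma P_antiperiodic:
  assumes uniform_series
  shows "antiperiodic1 P"
  unfolding antiperiodic1_def P Pterm_add_1 P0_add_1
  using bisummable_shift[OF bisummable_Pterm[OF assms]] bisummable_uminus(2)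
  by (simp add: bisummable_uminus(2))

lemma Q_continuous:
  assumes uniform_series
  shows "continuous_on {1..2} (Qfun \<rho> G)"
  by (rule uniform_limit_theorem[OF _ Q_uniform_limit(1)[OF assms]])
     (auto simp: Qterm_def intro!: always_eventually continuous_intros continuous_on_compose2[OF G_continuous])

lemma P_continuous:
  assumes uniform_series
  shows "continuous_on UNIV P"
proof (rule antiperiodic1_continuous)
  have im: "2 powr t \<in> {1..2}" if "t \<in> {0..1}" for t :: real
    using that powr_mono[of t 1 2] by (auto simp: ge_one_powr_ge_zero)
  have "continuous_on {0..1} (\<lambda>t. 2 powr (- \<rho> * t) * (F (2 powr t) + Qfun \<rho> G (2 powr t)))"
    using im by (intro continuous_intros continuous_on_compose2[OF F_continuous]
        continuous_on_compose2[OF Q_continuous[OF assms]]) force+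
  thus "continuous_on {0..1} P"
    using bisummable_Pterm_base(2)[OF assms] by (subst continuous_on_cong[OF refl]) auto
qed (rule P_antiperiodic[OF assms])

text \<open>On {1..2} this is the formula of \<open>bisummable_Pterm_base\<close>; under doubling
  the \<open>G\<close> terms of \<open>F\<close> and \<open>Qfun\<close> cancel, and the sign change
  of \<open>P\<close> makes up for the negative sign of \<open>\<alpha> + \<beta>\<close>.\<close>

lemma F_representation:
  assumes uniform_series "1 \<le> x"
  shows "F x = x powr \<rho> * P (log 2 x) - Qfun \<rho> G x"
  using assms(2)
proof (induction rule: dyadic_induct)
  case (base y)
  hence "log 2 y \<in> {0..1}" by auto
  from bisummable_Pterm_base(2)[OF assms(1) this]
  have "P (log 2 y) = 2 powr (- \<rho> * log 2 y) * (F y + Qfun \<rho> G y)"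
    using base by simp
  also have "2 powr (- \<rho> * log 2 y) = y powr - \<rho>"
    using base by (simp add: powr_def log_def)
  finally show ?case using base by (simp add: powr_minus field_simps)
next
  case (double y)
  have "P (log 2 (2 * y)) = - P (log 2 y)"
    using antiperiodic1_add_nat[OF P_antiperiodic[OF assms(1)], of "log 2 y" 1] double(1)
    by (simp add: log_mult add.commute)
  moreover have "F (2 * y) = (\<alpha> + \<beta>) * F y + G (2 * y)"
    "Qfun \<rho> G (2 * y) = (\<alpha> + \<beta>) * Qfun \<rho> G y - G (2 * y)"
    "(2 * y) powr \<rho> = - (\<alpha> + \<beta>) * y powr \<rho>"
    using double(1) by (intro F_double Q_double[OF assms(1)] powr_rho_double; simp)+
  ultimately show ?case
    by (simp only: double) (simp add: algebra_simps)
qed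

section \<open>The asymptotic conditions and their limit function\<close>

definition asymptotic_nat :: "(real \<Rightarrow> real) \<Rightarrow> bool" where
  "asymptotic_nat R \<longleftrightarrow> ((\<lambda>n::nat. real n powr - \<rho> * f n - R (log 2 (real n))) \<longlongrightarrow> 0) sequentially"

definition asymptotic_real :: "(real \<Rightarrow> real) \<Rightarrow> bool" where
  "asymptotic_real R \<longleftrightarrow> ((\<lambda>x::real. x powr - \<rho> * F x - R (log 2 x)) \<longlongrightarrow> 0) at_top"

lemma asymptotic_real_P:
  assumes uniform_series
  shows "asymptotic_real P"
proof -
  have "((\<lambda>x. Qfun \<rho> G x / x powr \<rho>) \<longlongrightarrow> 0) at_top"
    using Q_smallo[OF assms] by (rule smalloD_tendsto)
  hence "((\<lambda>x. - (Qfun \<rho> G x / x powr \<rho>)) \<longlongrightarrow> 0) at_top"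
    using tendsto_minus_cancel_left by fastforce
  moreover have "\<forall>\<^sub>F x in at_top. - (Qfun \<rho> G x / x powr \<rho>) = x powr - \<rho> * F x - P (log 2 x)"
    using eventually_ge_at_top[of 1]
    by eventually_elim (simp add: F_representation[OF assms] powr_minus field_simps)
  ultimately show ?thesis unfolding asymptotic_real_def by (rule Lim_transform_eventually)
qed

lemma asymptotic_real_imp_nat: "asymptotic_real R \<Longrightarrow> asymptotic_nat R"
  unfolding asymptotic_real_def asymptotic_nat_def
  by (drule filterlim_compose[OF _ filterlim_real_sequentially]) (simp add: F_of_nat)

text \<open>Since \<open>F\<close> interpolates between neighbouring integers, it suffices that the asymptotics is
  insensitive to moving the argument by at most \<open>1\<close>.\<close>

lemma asymptotic_nat_perturb:
  fixes k :: "real \<Rightarrow> nat"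
  assumes R: "antiperiodic1 R" "continuous_on UNIV R" and lim: "asymptotic_nat R"
    and k: "\<And>x. x \<ge> 1 \<Longrightarrow> \<bar>real (k x) - x\<bar> \<le> 1"
  shows "((\<lambda>x. x powr - \<rho> * f (k x) - R (log 2 x)) \<longlongrightarrow> 0) at_top"
proof -
  have k_top: "filterlim k sequentially at_top"
    unfolding filterlim_at_top
  proof
    fix Z :: nat
    show "\<forall>\<^sub>F x in at_top. Z \<le> k x"
      using eventually_ge_at_top[of "real Z + 1"]
    proof eventually_elim
      case (elim x)
      hence "real Z \<le> real (k x)" using k[of x] by linarith
      thus ?case by simp
    qed
  qed
  have inv0: "((\<lambda>x::real. 1 / x) \<longlongrightarrow> 0) at_top"
    by (intro tendsto_divide_0[OF tendsto_const] filterlim_at_top_imp_at_infinity filterlim_ident)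
  have "((\<lambda>x. real (k x) / x - 1) \<longlongrightarrow> 0) at_top"
  proof (rule Lim_null_comparison[OF _ inv0])
    show "\<forall>\<^sub>F x in at_top. norm (real (k x) / x - 1) \<le> 1 / x"
      using eventually_ge_at_top[of 1]
    proof eventually_elim
      case (elim x)
      have "norm (real (k x) / x - 1) = \<bar>(real (k x) - x) / x\<bar>"
        using elim by (simp add: diff_divide_distrib)
      also have "\<dots> \<le> 1 / x" using elim k[of x] by (simp add: abs_divide divide_right_mono)
      finally show ?case .
    qed
  qed
  hence ratio: "((\<lambda>x. real (k x) / x) \<longlongrightarrow> 1) at_top" by (rule LIM_zero_cancel)
  hence ratio_rho: "((\<lambda>x. (real (k x) / x) powr \<rho>) \<longlongrightarrow> 1) at_top"
    using tendsto_powr[OF ratio tendsto_const, of \<rho>] by simp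
  have "((\<lambda>x. log 2 (real (k x) / x)) \<longlongrightarrow> log 2 1) at_top"
    by (intro tendsto_log ratio tendsto_const) auto
  hence log0: "((\<lambda>x. log 2 (real (k x) / x)) \<longlongrightarrow> 0) at_top" by simp
  have pos: "\<forall>\<^sub>F x in at_top. x > 0 \<and> k x > 0"
    using eventually_gt_at_top[of "2::real"]
  proof eventually_elim
    case (elim x)
    thus ?case using k[of x] by (cases "k x = 0") auto
  qed
  have R_diff: "((\<lambda>x. R (log 2 (real (k x))) - R (log 2 x)) \<longlongrightarrow> 0) at_top"
  proof (rule tendstoI)
    fix e :: real assume "e > 0"
    then obtain d where d: "d > 0" "\<And>s t. dist s t < d \<Longrightarrow> dist (R s) (R t) < e"
      using antiperiodic1_uniformly_continuous[OF R] unfolding uniformly_continuous_on_def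
      by (metis UNIV_I)
    have "\<forall>\<^sub>F x in at_top. dist (log 2 (real (k x) / x)) 0 < d" using log0 d(1) by (rule tendstoD)
    with pos show "\<forall>\<^sub>F x in at_top. dist (R (log 2 (real (k x))) - R (log 2 x)) 0 < e"
    proof eventually_elim
      case (elim x)
      thus ?case using d(2)[of "log 2 (real (k x))" "log 2 x"]
        by (simp add: dist_real_def log_divide)
    qed
  qed
  obtain M where M: "\<And>t. \<bar>R t\<bar> \<le> M" using antiperiodic1_bounded[OF R] by blast
  define u where "u = (\<lambda>n::nat. real n powr - \<rho> * f n - R (log 2 (real n)))"
  have "u \<longlonglongrightarrow> 0" using lim by (simp add: u_def asymptotic_nat_def)
  hence u0: "((\<lambda>x. u (k x)) \<longlongrightarrow> 0) at_top" by (rule filterlim_compose[OF _ k_top])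
  have "((\<lambda>x. ((real (k x) / x) powr \<rho> - 1) * R (log 2 (real (k x)))) \<longlongrightarrow> 0) at_top"
  proof (rule Lim_null_comparison[where g = "\<lambda>x. \<bar>(real (k x) / x) powr \<rho> - 1\<bar> * M"])
    have "((\<lambda>x. \<bar>(real (k x) / x) powr \<rho> - 1\<bar> * M) \<longlongrightarrow> \<bar>1 - 1\<bar> * M) at_top"
      by (intro tendsto_intros ratio_rho)
    thus "((\<lambda>x. \<bar>(real (k x) / x) powr \<rho> - 1\<bar> * M) \<longlongrightarrow> 0) at_top" by simp
    show "\<forall>\<^sub>F x in at_top. norm (((real (k x) / x) powr \<rho> - 1) * R (log 2 (real (k x))))
        \<le> \<bar>(real (k x) / x) powr \<rho> - 1\<bar> * M"
      using M by (intro always_eventually) (auto simp: abs_mult intro!: mult_left_mono)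
  qed
  \<comment> \<open>Three errors: the asymptotics at \<open>k x\<close> rescaled by the ratio, the
    change of the power against the bounded \<open>R\<close>, and the change of the argument of
    \<open>R\<close>, where uniform continuity enters.\<close>
  hence "((\<lambda>x. (real (k x) / x) powr \<rho> * u (k x) + (((real (k x) / x) powr \<rho> - 1) * R (log 2 (real (k x)))
            + (R (log 2 (real (k x))) - R (log 2 x)))) \<longlongrightarrow> 1 * 0 + (0 + 0)) at_top"
    by (intro tendsto_intros ratio_rho u0 R_diff)
  hence "((\<lambda>x. (real (k x) / x) powr \<rho> * u (k x) + (((real (k x) / x) powr \<rho> - 1) * R (log 2 (real (k x)))
            + (R (log 2 (real (k x))) - R (log 2 x)))) \<longlongrightarrow> 0) at_top"
    by simp
  moreover have "\<forall>\<^sub>F x in at_top. (real (k x) / x) powr \<rho> * u (k x) +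
      (((real (k x) / x) powr \<rho> - 1) * R (log 2 (real (k x))) + (R (log 2 (real (k x))) - R (log 2 x)))
      = x powr - \<rho> * f (k x) - R (log 2 x)"
    using pos
  proof eventually_elim
    case (elim x)
    have "(real (k x) / x) powr \<rho> * (real (k x) powr - \<rho>) = x powr - \<rho>"
      using elim by (simp add: powr_divide powr_minus field_simps)
    hence "(real (k x) / x) powr \<rho> * (real (k x) powr - \<rho> * f (k x)) = x powr - \<rho> * f (k x)"
      by (simp flip: mult.assoc)
    thus ?case by (simp add: u_def right_diff_distrib left_diff_distrib)
  qed
  ultimately show ?thesis by (rule Lim_transform_eventually)
qed

text \<open>\<open>F x\<close> is a convex combination of the values at the two integers next to
  \<open>x\<close>, because \<open>\<phi>\<close> lies between 0 and 1; both integers are within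
  distance 1 of \<open>x\<close>.\<close>

lemma asymptotic_nat_imp_real:
  assumes R: "antiperiodic1 R" "continuous_on UNIV R" and lim: "asymptotic_nat R"
  shows "asymptotic_real R"
proof -
  define w where "w = (\<lambda>k x. x powr - \<rho> * f (k x) - R (log 2 x))"
  define k where "k = (\<lambda>x::real. nat \<lfloor>x\<rfloor>)"
  have k: "\<bar>real (k x) - x\<bar> \<le> 1" "\<bar>real (k x + 1) - x\<bar> \<le> 1" if "x \<ge> 1" for x
    using that unfolding k_def by linarith+
  have "(w k \<longlongrightarrow> 0) at_top" "(w (\<lambda>x. k x + 1) \<longlongrightarrow> 0) at_top"
    using k unfolding w_def by (intro asymptotic_nat_perturb[OF R lim]; blast)+
  hence lim: "((\<lambda>x. \<bar>w k x\<bar> + \<bar>w (\<lambda>x. k x + 1) x\<bar>) \<longlongrightarrow> 0) at_top"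
    using tendsto_add[OF tendsto_rabs tendsto_rabs] by fastforce
  show ?thesis unfolding asymptotic_real_def
  proof (rule Lim_null_comparison[OF _ lim], intro eventually_mono[OF eventually_ge_at_top[of 1]])
    fix x :: real assume x: "x \<ge> 1"
    define t where "t = frac x"
    have t: "t \<in> {0..1}" using frac_lt_1[of x] by (auto simp: t_def)
    have eq: "real (k x) + t = x" using x by (simp add: k_def t_def frac_def)
    have "F x = (1 - \<phi> t) * f (k x) + \<phi> t * f (k x + 1)"
      using F_add[OF t, of "k x"] by (simp add: eq)
    hence "x powr - \<rho> * F x - R (log 2 x) = (1 - \<phi> t) * w k x + \<phi> t * w (\<lambda>x. k x + 1) x"
      by (simp only: w_def) (simp add: algebra_simps)
    also have "norm \<dots> \<le> \<bar>1 - \<phi> t\<bar> * \<bar>w k x\<bar> + \<bar>\<phi> t\<bar> * \<bar>w (\<lambda>x. k x + 1) x\<bar>"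
      by (metis abs_mult abs_triangle_ineq real_norm_def)
    also have "\<dots> \<le> 1 * \<bar>w k x\<bar> + 1 * \<bar>w (\<lambda>x. k x + 1) x\<bar>"
      using phi_range[OF t] by (intro add_mono mult_right_mono) auto
    finally show "norm (x powr - \<rho> * F x - R (log 2 x)) \<le> \<bar>w k x\<bar> + \<bar>w (\<lambda>x. k x + 1) x\<bar>" by simp
  qed
qed

text \<open>With \<open>x = 2 ^ N * y\<close>, antiperiodicity turns
  \<open>(\<alpha> + \<beta>) ^ N * y powr \<rho> * R (log 2 y)\<close> into
  \<open>x powr \<rho> * R (log 2 x)\<close>, as the two signs \<open>(-1) ^ N\<close> cancel. The
  error of the partial sum at \<open>y\<close> is then \<open>y powr \<rho>\<close> times the
  asymptotic error at \<open>x\<close>, small uniformly since \<open>x \<ge> 2 ^ N\<close>.\<close>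

lemma asymptotic_real_imp_uniform_series:
  assumes R: "antiperiodic1 R" and lim: "asymptotic_real R"
  shows uniform_series
proof -
  define c where "c = \<alpha> + \<beta>"
  have c: "c \<noteq> 0" "(-1) ^ N * (- c) ^ N = c ^ N" for N
    using neg power_mult_distrib[of "-1" "- c" N] by (auto simp: c_def add.commute)
  define M where "M = max 1 (2 powr \<rho>)"
  have M: "M > 0" by (simp add: M_def)
  have "uniform_limit {1..2} (\<lambda>N y. \<Sum>m=1..N. Qterm \<rho> G m y)
          (\<lambda>y. y powr \<rho> * R (log 2 y) - F y) sequentially"
  proof (rule uniform_limitI)
    fix e :: real assume e: "e > 0"
    have "\<forall>\<^sub>F x in at_top. dist (x powr - \<rho> * F x - R (log 2 x)) 0 < e / M"
      using lim e M unfolding asymptotic_real_def by (intro tendstoD) auto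
    then obtain X where X: "\<And>x. x \<ge> X \<Longrightarrow> \<bar>x powr - \<rho> * F x - R (log 2 x)\<bar> < e / M"
      by (auto simp: eventually_at_top_linorder dist_real_def)
    obtain N0 where N0: "X < 2 ^ N0" using real_arch_pow[of 2 X] by auto
    show "\<forall>\<^sub>F N in sequentially. \<forall>y\<in>{1..2}.
        dist (\<Sum>m=1..N. Qterm \<rho> G m y) (y powr \<rho> * R (log 2 y) - F y) < e"
      using eventually_ge_at_top[of N0]
    proof eventually_elim
      case (elim N)
      show ?case
      proof
        fix y :: real assume y: "y \<in> {1..2}"
        define x where "x = 2 ^ N * y"
        have "(2::real) ^ N0 * 1 \<le> 2 ^ N * y" using elim y by (intro mult_mono power_increasing) auto
        hence x: "x \<ge> X" using N0 by (simp add: x_def)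
        have xpos: "x > 0" using y by (simp add: x_def)
        have "log 2 x = log 2 y + real N" using y by (simp add: x_def log_mult log_nat_power)
        hence Rx: "R (log 2 x) = (-1) ^ N * R (log 2 y)"
          using antiperiodic1_add_nat[OF R, of "log 2 y" N] by simp
        have Fx: "F x = c ^ N * (F y + (\<Sum>m=1..N. Qterm \<rho> G m y))"
          using F_iterate[of y N] y by (simp add: x_def c_def)
        have xr: "x powr \<rho> = (- c) ^ N * y powr \<rho>"
          using powr_rho_iterate[of y N] y by (simp add: x_def c_def)
        have "c ^ N * ((\<Sum>m=1..N. Qterm \<rho> G m y) - (y powr \<rho> * R (log 2 y) - F y))
            = F x - (c ^ N * y powr \<rho>) * R (log 2 y)"
          unfolding Fx by (simp add: algebra_simps)
        also have "(c ^ N * y powr \<rho>) * R (log 2 y) = x powr \<rho> * R (log 2 x)"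
          unfolding Rx xr c(2)[of N, symmetric] by (simp only: mult_ac)
        also have "F x - x powr \<rho> * R (log 2 x) = x powr \<rho> * (x powr - \<rho> * F x - R (log 2 x))"
          using xpos by (simp add: powr_minus field_simps)
        also have "\<bar>\<dots>\<bar> = \<bar>c\<bar> ^ N * y powr \<rho> * \<bar>x powr - \<rho> * F x - R (log 2 x)\<bar>"
          by (simp add: abs_mult xr power_abs)
        finally have "\<bar>c\<bar> ^ N * \<bar>(\<Sum>m=1..N. Qterm \<rho> G m y) - (y powr \<rho> * R (log 2 y) - F y)\<bar>
            = \<bar>c\<bar> ^ N * (y powr \<rho> * \<bar>x powr - \<rho> * F x - R (log 2 x)\<bar>)"
          by (simp add: abs_mult power_abs)
        hence "\<bar>(\<Sum>m=1..N. Qterm \<rho> G m y) - (y powr \<rho> * R (log 2 y) - F y)\<bar>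
            = y powr \<rho> * \<bar>x powr - \<rho> * F x - R (log 2 x)\<bar>"
          using c(1) by simp
        also have "\<dots> \<le> M * \<bar>x powr - \<rho> * F x - R (log 2 x)\<bar>"
          using powr_rho_bounds(2)[OF y] by (intro mult_right_mono) (auto simp: M_def)
        also have "\<dots> < M * (e / M)" using X[OF x] M by (intro mult_strict_left_mono)
        also have "\<dots> = e" using M by simp
        finally show "dist (\<Sum>m=1..N. Qterm \<rho> G m y) (y powr \<rho> * R (log 2 y) - F y) < e"
          by (simp add: dist_real_def)
      qed
    qed
  qed
  thus ?thesis by (auto simp: uniform_series_def uniformly_convergent_on_def)
qed

lemma asymptotic_real_unique:
  assumes uniform_series and R: "antiperiodic1 R" "asymptotic_real R"
  shows "R = P"
proof
  fix t
  have "antiperiodic1 (\<lambda>t. R t - P t)"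
    using R(1) P_antiperiodic[OF assms(1)] by (simp add: antiperiodic1_def)
  moreover have "((\<lambda>x. R (log 2 x) - P (log 2 x)) \<longlongrightarrow> 0) at_top"
    using tendsto_diff[OF asymptotic_real_P[OF assms(1), unfolded asymptotic_real_def]
        R(2)[unfolded asymptotic_real_def]] by simp
  ultimately have "R t - P t = 0" by (rule antiperiodic1_tendsto_0)
  thus "R t = P t" by simp
qed

section \<open>Fourier coefficients\<close>

text \<open>The integrand of \<open>kernel_g\<close> in the variable \<open>t = log 2 u\<close>,
  without the constant factor \<open>ln 2\<close>.\<close>

definition wave :: "int \<Rightarrow> real \<Rightarrow> complex" where
  "wave k t = of_real (2 powr (- \<rho> * t) * G (2 powr t)) * half_char k (- t)"

lemma wave_continuous: "continuous_on A (wave k)"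
  unfolding wave_def by (intro continuous_intros continuous_on_compose2[OF G_continuous]) auto

text \<open>The sign in \<open>Pterm\<close> is produced by the antiperiodic character, so folding
  the integral onto {0..1} yields partial sums of the series defining \<open>P\<close>.\<close>

lemma wave_add_nat: "wave k (t + real n) = of_real (Pterm \<rho> G t (int n)) * half_char k (- t)"
proof -
  have "half_char k (- t - real n) = (-1) ^ n * half_char k (- t)" for n
  proof (induction n)
    case (Suc n)
    have "- t - real (Suc n) = (- t - real n) + (-1)" by simp
    hence "half_char k (- t - real (Suc n)) = half_char k (- t - real n) * half_char k (- 1)"
      by (simp only: half_char_add)
    thus ?case using Suc by (simp add: half_char_minus_1)
  qed auto
  from this[of n] show ?thesis
    by (simp add: wave_def Pterm_def add.commute)
qed

lemma kernel_g_continuous: "0 < a \<Longrightarrow> continuous_on {a..b} (kernel_g \<rho> G k)"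
  unfolding kernel_g_def by (intro mellin_kernel_continuous continuous_on_subset[OF G_continuous]) auto

lemma integral_kernel_g:
  assumes "1 \<le> X"
  shows "integral {1..X} (kernel_g \<rho> G k) = of_real (ln 2) * integral {0..log 2 X} (wave k)"
  unfolding kernel_g_def wave_def using assms
  by (intro mellin_substitution continuous_on_subset[OF G_continuous]) auto

lemma phi_shift_continuous: "continuous_on {1..2} (\<lambda>u. 1 + (\<alpha> + \<beta> - 1) * \<phi> (u - 1))"
  by (intro continuous_intros continuous_on_compose2[OF phi_continuous]) auto

lemma kernel_1_continuous: "continuous_on {0..1} (kernel_1 \<alpha> \<beta> \<phi> \<rho> k)"
proof -
  have "1 + complex_of_real u \<noteq> 0" if "0 \<le> u" for u
    using that by (simp add: complex_eq_iff)
  thus ?thesis unfolding kernel_1_def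
    by (intro continuous_intros phi_continuous) (auto simp: complex_nonpos_Reals_iff)
qed

text \<open>Substitute \<open>1 + u = 2 powr t\<close> in the second integral of the coefficient
  formula and use \<open>P0_eq\<close>.\<close>

lemma integral_P0:
  "integral {0..1} (\<lambda>t. of_real (P0 \<alpha> \<beta> \<phi> \<rho> t) * half_char k (- t))
    = 1 / of_real (ln 2) * integral {0..1} (kernel_1 \<alpha> \<beta> \<phi> \<rho> k)"
proof -
  define w where "w = (\<lambda>u. 1 + (\<alpha> + \<beta> - 1) * \<phi> (u - 1))"
  define K where "K = (\<lambda>u. of_real (w u) / complex_of_real u powr (of_real \<rho> + chi' k + 1))"
  have cw: "continuous_on {1..2} w" unfolding w_def by (rule phi_shift_continuous)
  have "integral {0..1} (kernel_1 \<alpha> \<beta> \<phi> \<rho> k) = integral {0..1} (K \<circ> (\<lambda>u. u + 1))"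
    by (intro integral_cong) (simp add: kernel_1_def K_def w_def add.commute[of 1 "_ :: real"])
  also have "\<dots> = integral {1..2} K"
    using integral_shift[of 0 1 1 K] mellin_kernel_continuous[OF cw, of \<rho> k] by (simp add: K_def)
  also have "\<dots> = of_real (ln 2) * integral {0..1} (\<lambda>t. of_real (2 powr (- \<rho> * t) * w (2 powr t)) * half_char k (- t))"
    using mellin_substitution[OF cw, of \<rho> k] by (simp add: K_def)
  also have "integral {0..1} (\<lambda>t. of_real (2 powr (- \<rho> * t) * w (2 powr t)) * half_char k (- t))
      = integral {0..1} (\<lambda>t. of_real (P0 \<alpha> \<beta> \<phi> \<rho> t) * half_char k (- t))"
    by (intro integral_cong) (simp add: P0_eq w_def)
  finally show ?thesis by simp
qed

text \<open>\<open>Q_double\<close> solved for \<open>G\<close> expresses it by two values of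
  \<open>Qfun\<close>, each of smaller order than the power.\<close>

lemma G_smallo:
  assumes uniform_series
  shows "((\<lambda>x. G x / x powr \<rho>) \<longlongrightarrow> 0) at_top"
proof -
  have Q0: "((\<lambda>x. Qfun \<rho> G x / x powr \<rho>) \<longlongrightarrow> 0) at_top"
    using Q_smallo[OF assms] by (rule smalloD_tendsto)
  have "filterlim (\<lambda>x::real. x / 2) at_top at_top"
    using filterlim_tendsto_pos_mult_at_top[OF tendsto_const[of "1/2::real"] _ filterlim_ident] by simp
  from filterlim_compose[OF Q0 this]
  have "((\<lambda>x. - (Qfun \<rho> G (x / 2) / (x / 2) powr \<rho>) - Qfun \<rho> G x / x powr \<rho>) \<longlongrightarrow> - 0 - 0) at_top"
    by (intro tendsto_intros Q0)
  moreover have "\<forall>\<^sub>F x in at_top. - (Qfun \<rho> G (x / 2) / (x / 2) powr \<rho>) - Qfun \<rho> G x / x powr \<rho> = G x / x powr \<rho>"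
    using eventually_gt_at_top[of 0]
  proof eventually_elim
    case (elim x)
    define c y where "c = \<alpha> + \<beta>" and "y = (x / 2) powr \<rho>"
    have eqs: "Qfun \<rho> G x = c * Qfun \<rho> G (x / 2) - G x"
      using Q_double[OF assms, of "x / 2"] elim by (simp add: c_def)
    have x: "x powr \<rho> = - c * y"
      using powr_rho_double[of "x / 2"] elim by (simp add: c_def y_def)
    have "c \<noteq> 0" "y \<noteq> 0" using neg elim by (auto simp: c_def y_def)
    thus ?case unfolding eqs x y_def[symmetric] by (simp add: field_simps)
  qed
  ultimately show ?thesis using Lim_transform_eventually by fastforce
qed

lemma wave_tendsto_0:
  assumes uniform_series
  shows "((\<lambda>t. norm (wave k t)) \<longlongrightarrow> 0) at_top"
proof -
  have "filterlim (\<lambda>t::real. exp (ln 2 * t)) at_top at_top"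
    by (intro filterlim_compose[OF exp_at_top] filterlim_tendsto_pos_mult_at_top[OF tendsto_const _ filterlim_ident]) auto
  hence "filterlim (\<lambda>t::real. 2 powr t) at_top at_top" by (simp add: powr_def mult.commute)
  from filterlim_compose[OF tendsto_rabs_zero[OF G_smallo[OF assms]] this]
  show ?thesis
  proof (rule Lim_transform_eventually, intro always_eventually allI)
    show "\<bar>G (2 powr t) / (2 powr t) powr \<rho>\<bar> = norm (wave k t)" for t
    proof -
      have "norm (wave k t) = \<bar>2 powr (- \<rho> * t) * G (2 powr t)\<bar>"
        unfolding wave_def norm_mult norm_half_char norm_of_real by simp
      moreover have "(2 powr t) powr \<rho> = 2 powr (\<rho> * t)" by (simp add: powr_powr mult.commute)
      ultimately show ?thesis by (simp add: powr_minus divide_inverse mult.commute)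
    qed
  qed
qed

lemma integral_wave_nat:
  "integral {0..real n} (wave k) = integral {0..1} (\<lambda>t. (\<Sum>i<n. of_real (Pterm \<rho> G t (int i))) * half_char k (- t))"
  using integral_sum_pieces[OF wave_continuous, of 1 n k] by (simp add: wave_add_nat sum_distrib_right)

lemma Pterm_sum_uniform_limit:
  assumes uniform_series
  shows "uniform_limit {0..1} (\<lambda>n t. \<Sum>i<n. Pterm \<rho> G t (int i)) (\<lambda>t. P t - f 1 * P0 \<alpha> \<beta> \<phi> \<rho> t) sequentially"
proof -
  have im: "2 powr t \<in> {1..2}" if "t \<in> {0..1}" for t :: real
    using that powr_mono[of t 1 2] by (auto simp: ge_one_powr_ge_zero)
  have eq: "P t - f 1 * P0 \<alpha> \<beta> \<phi> \<rho> t = 2 powr (- \<rho> * t) * (G (2 powr t) + Qfun \<rho> G (2 powr t))"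
    if "t \<in> {0..1}" for t
    unfolding bisummable_Pterm_base(2)[OF assms that] P0_eq[OF that] F_base[OF im[OF that]]
    by (simp add: algebra_simps)
  have "uniform_limit {0..1} (\<lambda>n t. \<Sum>m=1..n. Qterm \<rho> G m (2 powr t)) (\<lambda>t. Qfun \<rho> G (2 powr t)) sequentially"
    using im by (intro uniform_limit_compose'[OF Q_uniform_limit(1)[OF assms]]) blast
  hence "uniform_limit {0..1} (\<lambda>n t. 2 powr (- \<rho> * t) * (G (2 powr t) + (\<Sum>m=1..n. Qterm \<rho> G m (2 powr t))))
      (\<lambda>t. 2 powr (- \<rho> * t) * (G (2 powr t) + Qfun \<rho> G (2 powr t))) sequentially"
    using im
    by (intro uniform_lim_mult uniform_limit_add uniform_limit_const)
       (auto intro!: compact_imp_bounded compact_continuous_image continuous_intros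
         continuous_on_compose2[OF G_continuous] continuous_on_compose2[OF Q_continuous[OF assms]])
  \<comment> \<open>The term with index 0 is the scaled \<open>G\<close>, so \<open>Suc n\<close>
    terms of \<open>Pterm\<close> correspond to \<open>n\<close> terms of the series for
    \<open>Qfun\<close>.\<close>
  moreover have "2 powr (- \<rho> * t) * (G (2 powr t) + (\<Sum>m=1..n. Qterm \<rho> G m (2 powr t)))
      = (\<Sum>i<Suc n. Pterm \<rho> G t (int i))" if "t \<in> {0..1}" for n t
    by (simp only: Pterm_base(1)[OF that] sum_distrib_left[symmetric] sum.lessThan_Suc_shift)
       (simp add: Qterm_div sum.atLeast1_atMost_eq)
  ultimately have "uniform_limit {0..1} (\<lambda>n t. \<Sum>i<Suc n. Pterm \<rho> G t (int i))
      (\<lambda>t. P t - f 1 * P0 \<alpha> \<beta> \<phi> \<rho> t) sequentially"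
    using eq by (subst uniform_limit_cong') auto
  thus ?thesis by (rule filterlim_sequentially_Suc[THEN iffD1])
qed

text \<open>Up to an integer the integral is one of partial sums that converge uniformly on {0..1}.
  Beyond the last integer a piece of length at most 1 remains, on which \<open>wave\<close> tends to
  0. Absolute integrals never enter, so the limit is obtained only as an improper integral.\<close>

lemma integral_wave_tendsto:
  assumes uniform_series
  shows "((\<lambda>y. integral {0..y} (wave k)) \<longlongrightarrow>
    integral {0..1} (\<lambda>t. of_real (P t - f 1 * P0 \<alpha> \<beta> \<phi> \<rho> t) * half_char k (- t))) at_top"
proof -
  define T where "T = (\<lambda>n t. (\<Sum>i<n. complex_of_real (Pterm \<rho> G t (int i))) * half_char k (- t))"
  define J where "J = integral {0..1} (\<lambda>t. of_real (P t - f 1 * P0 \<alpha> \<beta> \<phi> \<rho> t) * half_char k (- t))"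
  have cT: "continuous_on {0..1} (T n)" for n
    unfolding T_def Pterm_def by (intro continuous_intros continuous_on_compose2[OF G_continuous]) auto
  have "uniform_limit {0..1} T (\<lambda>t. of_real (P t - f 1 * P0 \<alpha> \<beta> \<phi> \<rho> t) * half_char k (- t)) sequentially"
  proof (rule uniform_limitI)
    fix e :: real assume "e > 0"
    from uniform_limitD[OF Pterm_sum_uniform_limit[OF assms] this]
    show "\<forall>\<^sub>F n in sequentially. \<forall>t\<in>{0..1}. dist (T n t) (of_real (P t - f 1 * P0 \<alpha> \<beta> \<phi> \<rho> t) * half_char k (- t)) < e"
    proof eventually_elim
      case (elim n)
      have "dist (T n t) (of_real (P t - f 1 * P0 \<alpha> \<beta> \<phi> \<rho> t) * half_char k (- t))
          = dist (\<Sum>i<n. Pterm \<rho> G t (int i)) (P t - f 1 * P0 \<alpha> \<beta> \<phi> \<rho> t)" for t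
        unfolding T_def dist_norm left_diff_distrib[symmetric] norm_mult norm_half_char
          of_real_sum[symmetric] of_real_diff[symmetric] norm_of_real by simp
      thus ?case using elim by simp
    qed
  qed
  then obtain I J' where I: "\<And>n. (T n has_integral I n) {0..1}"
      and J': "((\<lambda>t. of_real (P t - f 1 * P0 \<alpha> \<beta> \<phi> \<rho> t) * half_char k (- t)) has_integral J') {0..1}"
      and IJ: "I \<longlonglongrightarrow> J'"
    using cT by (rule uniform_limit_integral) auto
  have "(\<lambda>n. integral {0..1} (T n)) \<longlonglongrightarrow> J"
    using IJ unfolding J_def integral_unique[OF I] integral_unique[OF J'] .
  hence nat: "(\<lambda>n. integral {0..real n} (wave k)) \<longlonglongrightarrow> J"
    by (simp add: integral_wave_nat T_def)
  show ?thesis unfolding J_def[symmetric]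
  proof (rule tendstoI)
    fix e :: real assume e: "e > 0"
    have "\<forall>\<^sub>F n in sequentially. dist (integral {0..real n} (wave k)) J < e / 2"
      using nat e by (intro tendstoD) auto
    then obtain N where N: "\<And>n. n \<ge> N \<Longrightarrow> dist (integral {0..real n} (wave k)) J < e / 2"
      by (auto simp: eventually_sequentially)
    have "\<forall>\<^sub>F t in at_top. dist (norm (wave k t)) 0 < e / 2"
      using wave_tendsto_0[OF assms] e by (intro tendstoD) auto
    then obtain Y where Y: "\<And>t. t \<ge> Y \<Longrightarrow> norm (wave k t) < e / 2"
      by (auto simp: eventually_at_top_linorder)
    show "\<forall>\<^sub>F y in at_top. dist (integral {0..y} (wave k)) J < e"
      using eventually_ge_at_top[of "max (real N + 1) (max (Y + 1) 1)"]
    proof eventually_elim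
      case (elim y)
      define n where "n = nat \<lfloor>y\<rfloor>"
      have n: "real n \<le> y" "y \<le> real n + 1" "n \<ge> N" "real n \<ge> Y"
        using elim unfolding n_def by linarith+
      have "integral {0..y} (wave k) = integral {0..real n} (wave k) + integral {real n..y} (wave k)"
        using n by (intro Henstock_Kurzweil_Integration.integral_combine[symmetric] integrable_continuous_real wave_continuous) auto
      moreover have "norm (integral {real n..y} (wave k)) \<le> e / 2 * (y - real n)"
        using n Y by (intro integral_bound wave_continuous) (auto intro: less_imp_le)
      moreover have "e / 2 * (y - real n) \<le> e / 2 * 1"
        using n e by (intro mult_left_mono) auto
      moreover note N[OF n(3)]
      ultimately show ?case
        unfolding dist_norm by (smt (verit) add_diff_eq diff_add_eq norm_triangle_ineq field_sum_of_halves)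
    qed
  qed
qed

lemma Phat_formula:
  assumes uniform_series
  shows "\<exists>I. has_improper_integral (kernel_g \<rho> G k) I 1 \<and>
    Phat P k = 1 / of_real (ln 2) * I
          + of_real (f 1) / of_real (ln 2) * integral {0..1} (kernel_1 \<alpha> \<beta> \<phi> \<rho> k)"
proof -
  define J where "J = integral {0..1} (\<lambda>t. of_real (P t - f 1 * P0 \<alpha> \<beta> \<phi> \<rho> t) * half_char k (- t))"
  have log_top: "filterlim (log 2) at_top at_top" 
    unfolding log_def
    by (intro filterlim_at_top_mult_tendsto_pos[OF tendsto_const[of "1 / ln 2"], of "ln", simplified] ) (auto simp: ln_at_top)
  have "((\<lambda>X. of_real (ln 2) * integral {0..log 2 X} (wave k)) \<longlongrightarrow> of_real (ln 2) * J) at_top"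
    unfolding J_def
    by (intro tendsto_intros filterlim_compose[OF integral_wave_tendsto[OF assms] log_top])
  moreover have "\<forall>\<^sub>F X in at_top. of_real (ln 2) * integral {0..log 2 X} (wave k) = integral {1..X} (kernel_g \<rho> G k)"
    using eventually_ge_at_top[of 1] by eventually_elim (simp add: integral_kernel_g)
  ultimately have "((\<lambda>X. integral {1..X} (kernel_g \<rho> G k)) \<longlongrightarrow> of_real (ln 2) * J) at_top"
    by (rule Lim_transform_eventually)
  hence imp: "has_improper_integral (kernel_g \<rho> G k) (of_real (ln 2) * J) 1"
    unfolding has_improper_integral_def
    by (auto intro!: integrable_continuous_real kernel_g_continuous)
  have cP0: "continuous_on {0..1} (P0 \<alpha> \<beta> \<phi> \<rho>)"
  proof -
    have "continuous_on {0..1} (\<lambda>t. 2 powr (- \<rho> * t) * (1 + (\<alpha> + \<beta> - 1) * \<phi> (2 powr t - 1)))"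
      using powr_mono[of _ 1 2]
      by (intro continuous_intros continuous_on_compose2[OF phi_continuous]) (auto simp: ge_one_powr_ge_zero)
    thus ?thesis by (subst continuous_on_cong[OF refl P0_eq]) auto
  qed
  have I: "(\<lambda>t. of_real (P t) * half_char k (- t)) integrable_on {0..1}"
    "(\<lambda>t. of_real (f 1) * (of_real (P0 \<alpha> \<beta> \<phi> \<rho> t) * half_char k (- t))) integrable_on {0..1}"
    by (intro integrable_continuous_real continuous_intros cP0 continuous_on_subset[OF P_continuous[OF assms]]; simp)+
  have "J = integral {0..1} (\<lambda>t. of_real (P t) * half_char k (- t)
        - of_real (f 1) * (of_real (P0 \<alpha> \<beta> \<phi> \<rho> t) * half_char k (- t)))"
    unfolding J_def by (intro integral_cong) (simp add: algebra_simps)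
  also have "\<dots> = Phat P k - of_real (f 1) * integral {0..1} (\<lambda>t. of_real (P0 \<alpha> \<beta> \<phi> \<rho> t) * half_char k (- t))"
    unfolding Phat_eq_half_coeff half_coeff_def using I by (subst integral_diff) auto
  finally have "Phat P k = 1 / of_real (ln 2) * (of_real (ln 2) * J)
      + of_real (f 1) / of_real (ln 2) * integral {0..1} (kernel_1 \<alpha> \<beta> \<phi> \<rho> k)"
    by (simp add: integral_P0 mult.assoc)
  with imp show ?thesis by blast
qed

section \<open>Dyadic bounds and absolutely convergent integrals\<close>

lemma Amax_ge: "n \<in> {2 ^ m..2 ^ (m + 1)} \<Longrightarrow> \<bar>g n\<bar> \<le> Amax g m"
  unfolding Amax_def by (intro Max_ge) auto

lemma Bmax_ge: "n \<in> {2 ^ m..<2 ^ (m + 1)} \<Longrightarrow> \<bar>g (n + 1) - g n\<bar> \<le> Bmax g m"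
  unfolding Bmax_def by (intro Max_ge) auto

lemma Amax_nonneg: "0 \<le> Amax g m"
  using Amax_ge[of "2 ^ m" m] by (intro order.trans[OF abs_ge_zero]) auto

lemma Bmax_nonneg: "0 \<le> Bmax g m"
  using Bmax_ge[of "2 ^ m" m] by (intro order.trans[OF abs_ge_zero]) auto

text \<open>The right end \<open>2 ^ (m + 1)\<close> is written as \<open>n + 1\<close> with
  \<open>n = 2 ^ (m + 1) - 1\<close>, so that \<open>n\<close> stays in the half-open block over
  which \<open>Bmax\<close> is taken.\<close>

lemma dyadic_unit_interval:
  assumes "x \<in> {2 ^ m..2 ^ (m + 1)}"
  obtains n t where "n \<in> {2 ^ m..<2 ^ (m + 1)}" "t \<in> {0..1}" "x = real n + t" "1 \<le> n"
proof (cases "x = 2 ^ (m + 1)")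
  case True
  define n :: nat where "n = 2 ^ (m + 1) - 1"
  have "real n = 2 ^ (m + 1) - 1" by (simp add: n_def of_nat_diff)
  moreover have "2 ^ m \<le> n" "n < 2 ^ (m + 1)" "1 \<le> n"
  proof -
    have "1 \<le> (2::nat) ^ m" by simp
    thus "2 ^ m \<le> n" "n < 2 ^ (m + 1)" "1 \<le> n" unfolding n_def power_add power_one_right by linarith+
  qed
  ultimately show ?thesis using True by (intro that[of n 1]) auto
next
  case False
  have "0 \<le> x" using assms by (auto intro: order.trans[rotated])
  hence x: "x = real (nat \<lfloor>x\<rfloor>) + frac x" by (simp add: frac_def)
  have "real (2 ^ m) \<le> x" "x < real (2 ^ (m + 1))" using assms False by auto
  hence "2 ^ m \<le> nat \<lfloor>x\<rfloor>" "nat \<lfloor>x\<rfloor> < 2 ^ (m + 1)"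
    using le_nat_floor[of "2 ^ m" x] \<open>0 \<le> x\<close> by (auto simp: nat_less_iff floor_less_iff)
  moreover from this have "1 \<le> nat \<lfloor>x\<rfloor>"
    using one_le_power[of "2::nat" m] by linarith
  ultimately show ?thesis using x frac_lt_1[of x]
    by (intro that[of "nat \<lfloor>x\<rfloor>" "frac x"]) (auto simp del: One_nat_def)
qed

lemma G_le_Amax:
  assumes "x \<in> {2 ^ m..2 ^ (m + 1)}"
  shows "\<bar>G x\<bar> \<le> Amax g m"
proof -
  obtain n t where n: "n \<in> {2 ^ m..<2 ^ (m + 1)}" "t \<in> {0..1}" "x = real n + t" "1 \<le> n"
    using dyadic_unit_interval[OF assms] by metis
  have "\<bar>G x\<bar> \<le> \<bar>1 - \<phi> t\<bar> * \<bar>g n\<bar> + \<bar>\<phi> t\<bar> * \<bar>g (n + 1)\<bar>"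
    unfolding n(3) G_add[OF n(4,2)] by (metis abs_mult abs_triangle_ineq)
  also have "\<dots> \<le> \<bar>1 - \<phi> t\<bar> * Amax g m + \<bar>\<phi> t\<bar> * Amax g m"
    using n by (intro add_mono mult_left_mono Amax_ge) auto
  also have "\<dots> = Amax g m" using phi_range[OF n(2)] by (simp add: left_diff_distrib)
  finally show ?thesis .
qed

lemma sum_power_abs: "\<bar>\<alpha> + \<beta>\<bar> ^ m = 2 powr (\<rho> * real m)"
  unfolding sum_eq by (simp add: powr_powr flip: powr_realpow)

lemma Qterm_le_Amax:
  assumes "y \<in> {1..2}"
  shows "\<bar>Qterm \<rho> G m y\<bar> \<le> 2 powr (- \<rho> * real m) * Amax g m"
proof -
  have "\<bar>Qterm \<rho> G m y\<bar> = 2 powr (- \<rho> * real m) * \<bar>G (2 ^ m * y)\<bar>"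
    unfolding Qterm_div abs_divide power_abs sum_power_abs by (simp add: powr_minus field_simps)
  also have "\<dots> \<le> 2 powr (- \<rho> * real m) * Amax g m"
    using assms by (intro mult_left_mono G_le_Amax) auto
  finally show ?thesis .
qed

lemma uniform_series_if_Amax_summable:
  assumes "summable (\<lambda>m. 2 powr (- \<rho> * real m) * Amax g m)"
  shows uniform_series
proof -
  have "summable (\<lambda>m. 2 powr (- \<rho> * real (Suc m)) * Amax g (Suc m))"
    using assms by (subst summable_Suc_iff[of "\<lambda>m. 2 powr (- \<rho> * real m) * Amax g m"])
  hence "uniformly_convergent_on {1..2} (\<lambda>n x. \<Sum>i<n. Qterm \<rho> G (Suc i) x)"
    by (rule Weierstrass_m_test'[rotated]) (unfold real_norm_def, rule Qterm_le_Amax)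
  thus ?thesis by (simp add: uniform_series_def sum.atLeast1_atMost_eq)
qed

lemma norm_kernel_g:
  assumes "u > 0"
  shows "norm (kernel_g \<rho> G k u) = \<bar>G u\<bar> * u powr - (\<rho> + 1)"
proof -
  have "norm (complex_of_real u powr (of_real \<rho> + chi' k + 1)) = u powr (\<rho> + 1)"
    using assms by (subst norm_powr_real_powr) (auto simp: chi'_def)
  moreover have "u powr - (\<rho> + 1) = 1 / u powr (\<rho> + 1)" by (simp only: powr_minus inverse_eq_divide)
  ultimately show ?thesis by (simp only: kernel_g_def norm_divide norm_of_real) simp
qed

text \<open>On the block from \<open>2 ^ m\<close> to \<open>2 ^ (m + 1)\<close> the power of
  \<open>u\<close> is at most \<open>C * 2 powr (- \<rho> * m) / 2 ^ m\<close>; the length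
  \<open>2 ^ m\<close> of the block cancels the denominator, and the integrals over the blocks are
  dominated by the summable hypothesis.\<close>

lemma kernel_g_absolutely_integrable:
  assumes summ: "summable (\<lambda>m. 2 powr (- \<rho> * real m) * Amax g m)"
  shows "kernel_g \<rho> G k absolutely_integrable_on {1..}"
proof -
  define h where "h = (\<lambda>u. norm (kernel_g \<rho> G k u))"
  define C where "C = max 1 (2 powr - (\<rho> + 1))"
  have C: "C > 0" by (simp add: C_def)
  define J where "J = (\<lambda>X. integral {1..X} h)"
  define b where "b = (\<lambda>m. C * (2 powr (- \<rho> * real m) * Amax g m))"
  have cont: "continuous_on {a..X} h" if "a > 0" for a X
    unfolding h_def using that by (intro continuous_intros kernel_g_continuous)
  have int: "h integrable_on {1..X}" for X
    by (intro integrable_continuous_real cont) auto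
  have h0: "0 \<le> h u" for u by (simp add: h_def)
  have mono: "mono J"
  proof
    fix x y :: real assume "x \<le> y"
    thus "J x \<le> J y" unfolding J_def using h0 int by (intro integral_subset_le) auto
  qed
  have piece: "integral {2 ^ m..2 ^ (m + 1)} h \<le> b m" for m
  proof -
    have bound: "h u \<le> b m / 2 ^ m" if u: "u \<in> {2 ^ m..2 ^ (m + 1)}" for u
    proof -
      have upos: "u > 0" using u by (auto intro: less_le_trans[rotated])
      define y where "y = u / 2 ^ m"
      have y: "y \<in> {1..2}" using u by (auto simp: y_def field_simps)
      have "u powr - (\<rho> + 1) = (2 ^ m) powr - (\<rho> + 1) * y powr - (\<rho> + 1)"
        using y by (subst powr_mult[symmetric]) (auto simp: y_def)
      also have "y powr - (\<rho> + 1) \<le> C"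
      proof (cases "- (\<rho> + 1) \<ge> 0")
        case True
        hence "y powr - (\<rho> + 1) \<le> 2 powr - (\<rho> + 1)" using y by (intro powr_mono2) auto
        thus ?thesis by (simp add: C_def)
      next
        case False
        hence "y powr - (\<rho> + 1) \<le> 1" using y powr_mono2'[of "- (\<rho> + 1)" 1 y] by auto
        thus ?thesis by (simp add: C_def)
      qed
      also have "(2 ^ m) powr - (\<rho> + 1) = 2 powr (- \<rho> * real m) / 2 ^ m"
        by (simp add: powr_powr powr_diff powr_minus field_simps flip: powr_realpow)
      finally have "u powr - (\<rho> + 1) \<le> 2 powr (- \<rho> * real m) / 2 ^ m * C" by (simp add: mult_left_mono)
      hence "h u \<le> Amax g m * (2 powr (- \<rho> * real m) / 2 ^ m * C)"
        unfolding h_def norm_kernel_g[OF upos] using G_le_Amax[OF u] Amax_nonneg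
        by (intro mult_mono) auto
      thus ?thesis by (simp add: b_def mult_ac)
    qed
    have "integral {2 ^ m..2 ^ (m + 1)} h \<le> integral {2 ^ m..2 ^ (m + 1) :: real} (\<lambda>_. b m / 2 ^ m)"
      using bound by (intro integral_le integrable_continuous_real cont) auto
    thus ?thesis by simp
  qed
  have "J (2 ^ N) \<le> (\<Sum>m<N. b m)" for N
  proof (induction N)
    case (Suc N)
    have "J (2 ^ Suc N) = J (2 ^ N) + integral {2 ^ N..2 ^ Suc N} h"
      unfolding J_def by (intro Henstock_Kurzweil_Integration.integral_combine[symmetric] int) auto
    thus ?case using Suc piece[of N] by simp
  qed (simp add: J_def)
  moreover have "(\<Sum>m<N. b m) \<le> suminf b" for N
    unfolding b_def using summ C Amax_nonneg by (intro sum_le_suminf summable_mult) auto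
  ultimately have J2: "J (2 ^ N) \<le> suminf b" for N using order.trans by blast
  have "J (real n) \<le> suminf b" for n
  proof -
    have "real n \<le> 2 ^ n" using less_exp[of n] by (metis less_imp_le of_nat_le_iff of_nat_numeral of_nat_power)
    thus ?thesis using J2[of n] monoD[OF mono, of "real n" "2 ^ n"] by linarith
  qed
  moreover have "incseq (\<lambda>n. J (real n))" using mono by (auto simp: incseq_def mono_def)
  ultimately obtain l where "(\<lambda>n. J (real n)) \<longlonglongrightarrow> l"
    using incseq_convergent[of "\<lambda>n. J (real n)" "suminf b"] by blast
  hence "(J \<longlongrightarrow> l) at_top" by (rule tendsto_at_topI_sequentially_real[OF mono])
  hence "(h has_integral l) {1..}"
    unfolding J_def using int h0 by (intro has_integral_to_inf) auto
  hence hint: "h integrable_on {1..}" by blast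
  have "continuous_on {1..} (kernel_g \<rho> G k)"
    unfolding kernel_g_def
    by (intro continuous_intros continuous_on_subset[OF G_continuous]) (auto simp: complex_nonpos_Reals_iff)
  hence "kernel_g \<rho> G k \<in> borel_measurable (lebesgue_on {1..})"
    by (intro continuous_imp_measurable_on_sets_lebesgue) auto
  thus ?thesis
    by (rule measurable_bounded_by_integrable_imp_absolutely_integrable[OF _ _ hint]) (auto simp: h_def)
qed

lemma improper_integral_unique:
  assumes abs: "h absolutely_integrable_on {1..}" and imp: "has_improper_integral h I 1"
  shows "integral {1..} h = I"
proof -
  have "((\<lambda>b. set_lebesgue_integral lebesgue {1..b} h) \<longlongrightarrow> set_lebesgue_integral lebesgue {1..} h) at_top"
    using abs by (intro tendsto_set_lebesgue_integral_at_top) auto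
  also have "set_lebesgue_integral lebesgue {1..} h = integral {1..} h"
    using abs by (intro set_lebesgue_integral_eq_integral)
  also have "(\<lambda>b. set_lebesgue_integral lebesgue {1..b} h) = (\<lambda>b. integral {1..b} h)"
    using set_integrable_subset[OF abs] by (intro ext set_lebesgue_integral_eq_integral) auto
  finally show ?thesis
    using imp unfolding has_improper_integral_def by (auto intro: tendsto_unique[rotated])
qed

lemma Phat_formula_absolute:
  assumes "summable (\<lambda>m. 2 powr (- \<rho> * real m) * Amax g m)"
  shows "kernel_g \<rho> G k absolutely_integrable_on {1..}"
    and "kernel_1 \<alpha> \<beta> \<phi> \<rho> k absolutely_integrable_on {0..1}"
    and "Phat P k = 1 / of_real (ln 2) * integral {1..} (kernel_g \<rho> G k)
        + of_real (f 1) / of_real (ln 2) * integral {0..1} (kernel_1 \<alpha> \<beta> \<phi> \<rho> k)"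
proof -
  show abs: "kernel_g \<rho> G k absolutely_integrable_on {1..}"
    using assms by (rule kernel_g_absolutely_integrable)
  show "kernel_1 \<alpha> \<beta> \<phi> \<rho> k absolutely_integrable_on {0..1}"
    by (intro absolutely_integrable_continuous_real kernel_1_continuous)
  show "Phat P k = 1 / of_real (ln 2) * integral {1..} (kernel_g \<rho> G k)
        + of_real (f 1) / of_real (ln 2) * integral {0..1} (kernel_1 \<alpha> \<beta> \<phi> \<rho> k)"
    using Phat_formula[OF uniform_series_if_Amax_summable[OF assms], of k]
      improper_integral_unique[OF abs] by blast
qed

section \<open>Absolute convergence\<close>

lemma phi_mono: "0 \<le> x \<Longrightarrow> x \<le> y \<Longrightarrow> y \<le> 1 \<Longrightarrow> \<phi> x \<le> \<phi> y"
  using is_phi_mono[OF _ _ is_phi] neg by auto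

definition contraction :: real where
  "contraction = max \<bar>\<alpha>\<bar> \<bar>\<beta>\<bar> / (\<bar>\<alpha>\<bar> + \<bar>\<beta>\<bar>)"

lemma contraction: "1/2 \<le> contraction" "contraction < 1"
  using neg by (auto simp: contraction_def field_simps max_def)

text \<open>Through this bound Lipschitz estimates at scale \<open>1 / 2 ^ j\<close> are absorbed in
  the Hoelder modulus \<open>contraction ^ j\<close>.\<close>

lemma contraction_power: "1 / 2 ^ j \<le> contraction ^ j"
  using power_mono[OF contraction(1), of j] by (simp add: power_divide)

lemma phi_modulus:
  "x \<in> {0..1} \<Longrightarrow> y \<in> {0..1} \<Longrightarrow> \<bar>x - y\<bar> \<le> 1 / 2 ^ n \<Longrightarrow> \<bar>\<phi> x - \<phi> y\<bar> \<le> 2 * contraction ^ n"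
  unfolding contraction_def using neg by (intro is_phi_modulus[OF _ _ is_phi]) auto

lemma interp_mono:
  assumes h: "\<And>n. h n \<le> h (Suc n)" and xy: "0 \<le> x" "x \<le> y"
  shows "interp \<phi> h x \<le> interp \<phi> h y"
proof -
  define n t m s where "n = nat \<lfloor>x\<rfloor>" and "t = frac x" and "m = nat \<lfloor>y\<rfloor>" and "s = frac y"
  have x: "x = real n + t" "0 \<le> t" "t \<le> 1" using xy frac_lt_1[of x] by (auto simp: n_def t_def frac_def)
  have y: "y = real m + s" "0 \<le> s" "s \<le> 1" using xy frac_lt_1[of y] by (auto simp: m_def s_def frac_def)
  have nm: "n \<le> m" unfolding n_def m_def using xy by (intro nat_mono floor_mono)
  have hm: "h i \<le> h j" if "i \<le> j" for i j using lift_Suc_mono_le[of h, OF h that] .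
  have ex: "interp \<phi> h x = h n + \<phi> t * (h (n + 1) - h n)"
    unfolding x(1) using x by (subst interp_add) (auto simp: algebra_simps)
  have ey: "interp \<phi> h y = h m + \<phi> s * (h (m + 1) - h m)"
    unfolding y(1) using y by (subst interp_add) (auto simp: algebra_simps)
  show ?thesis
  proof (cases "n = m")
    case True
    have "\<phi> t \<le> \<phi> s" using x y xy True by (intro phi_mono) auto
    thus ?thesis unfolding ex ey True using h[of m] by (intro add_mono mult_right_mono) auto
  next
    case False
    have "interp \<phi> h x \<le> h n + 1 * (h (n + 1) - h n)"
      unfolding ex using phi_range[of t] x h[of n] by (intro add_mono mult_right_mono) auto
    also have "\<dots> = h (n + 1)" by simp
    also have "\<dots> \<le> h m" using False nm by (intro hm) auto
    also have "\<dots> \<le> interp \<phi> h y" unfolding ey using phi_range[of s] y h[of m] by simp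
    finally show ?thesis .
  qed
qed

text \<open>Jordan decomposition: \<open>hp\<close> and \<open>hm\<close> sum the positive and
  negative parts of the increments, interpolation is linear in the sequence and keeps monotonicity,
  and the variations of the two parts add up to a sum of \<open>2 ^ m\<close> absolute
  increments.\<close>

lemma G_variation: "variation_le G (2 ^ m) (2 ^ (m + 1)) (2 ^ m * Bmax g m)"
proof -
  define hp hm where "hp = (\<lambda>n. \<Sum>j<n. max 0 (g (j + 1) - g j))" and "hm = (\<lambda>n. \<Sum>j<n. max 0 (g j - g (j + 1)))"
  have diff: "g n = g 0 + (hp n - hm n)" for n
    by (induction n) (auto simp: hp_def hm_def max_def)
  have eq: "G x = g 0 + (interp \<phi> hp x + (-1) * interp \<phi> hm x)" if "x \<in> {2 ^ m..2 ^ (m + 1)}" for x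
  proof -
    have "(1::real) \<le> 2 ^ m" by simp
    hence "1 \<le> x" using that unfolding atLeastAtMost_iff by linarith
    hence "G x = interp \<phi> g x" by (simp add: G interp0_def)
    thus ?thesis
      unfolding interp_def diff[of "nat \<lfloor>x\<rfloor>"] diff[of "nat \<lfloor>x\<rfloor> + 1"] by (simp add: algebra_simps)
  qed
  have mono: "variation_le (interp \<phi> hp) (2 ^ m) (2 ^ (m + 1)) (interp \<phi> hp (2 ^ (m + 1)) - interp \<phi> hp (2 ^ m))"
    "variation_le (interp \<phi> hm) (2 ^ m) (2 ^ (m + 1)) (interp \<phi> hm (2 ^ (m + 1)) - interp \<phi> hm (2 ^ m))"
    by (intro variation_le_mono interp_mono; force simp: hp_def hm_def intro: order.trans[rotated])+
  have pw: "interp \<phi> h (2 ^ i) = h (2 ^ i)" for h i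
    using interp_of_nat[of \<phi> h "2 ^ i"] by simp
  have inc: "{..<2 ^ (m + 1)} - {..<2 ^ m} = {2 ^ m..<(2::nat) ^ (m + 1)}" by auto
  have "variation_le (\<lambda>x. g 0 + (interp \<phi> hp x + (-1) * interp \<phi> hm x)) (2 ^ m) (2 ^ (m + 1))
      ((hp (2 ^ (m + 1)) - hp (2 ^ m)) + \<bar>-1\<bar> * (hm (2 ^ (m + 1)) - hm (2 ^ m)))"
    using mono unfolding pw by (intro variation_le_const_add variation_le_add variation_le_cmult)
  also have "(hp (2 ^ (m + 1)) - hp (2 ^ m)) + \<bar>-1\<bar> * (hm (2 ^ (m + 1)) - hm (2 ^ m))
      = (\<Sum>j\<in>{2 ^ m..<2 ^ (m + 1)}. \<bar>g (j + 1) - g j\<bar>)"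
  proof -
    have "hp (2 ^ (m + 1)) - hp (2 ^ m) = (\<Sum>j\<in>{2 ^ m..<2 ^ (m + 1)}. max 0 (g (j + 1) - g j))"
      "hm (2 ^ (m + 1)) - hm (2 ^ m) = (\<Sum>j\<in>{2 ^ m..<2 ^ (m + 1)}. max 0 (g j - g (j + 1)))"
      unfolding hp_def hm_def inc[symmetric] by (intro sum_diff[symmetric]; auto)+
    hence "(hp (2 ^ (m + 1)) - hp (2 ^ m)) + \<bar>-1\<bar> * (hm (2 ^ (m + 1)) - hm (2 ^ m))
      = (\<Sum>j\<in>{2 ^ m..<2 ^ (m + 1)}. max 0 (g (j + 1) - g j) + max 0 (g j - g (j + 1)))"
      by (simp add: sum.distrib)
    also have "\<dots> = (\<Sum>j\<in>{2 ^ m..<2 ^ (m + 1)}. \<bar>g (j + 1) - g j\<bar>)"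
      by (intro sum.cong) (auto simp: max_def)
    finally show ?thesis .
  qed
  finally have "variation_le G (2 ^ m) (2 ^ (m + 1)) (\<Sum>j\<in>{2 ^ m..<2 ^ (m + 1)}. \<bar>g (j + 1) - g j\<bar>)"
    using eq by (subst variation_le_cong)
  moreover have "(\<Sum>j\<in>{2 ^ m..<2 ^ (m + 1)}. \<bar>g (j + 1) - g j\<bar>) \<le> (\<Sum>j\<in>{2 ^ m..<(2::nat) ^ (m + 1)}. Bmax g m)"
    by (intro sum_mono Bmax_ge)
  ultimately show ?thesis by (elim variation_le_weaken) simp
qed

lemma g_diff_le_Bmax:
  assumes "n \<in> {2 ^ m..2 ^ (m + 1)}" "n' \<in> {2 ^ m..2 ^ (m + 1)}"
  shows "\<bar>g n - g n'\<bar> \<le> \<bar>real n - real n'\<bar> * Bmax g m"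
proof -
  have *: "\<bar>g (n + d) - g n\<bar> \<le> real d * Bmax g m" if "2 ^ m \<le> n" "n + d \<le> 2 ^ (m + 1)" for n d
    using that
  proof (induction d)
    case (Suc d)
    have "\<bar>g (n + d) - g n\<bar> \<le> real d * Bmax g m" using Suc by auto
    moreover have "\<bar>g (n + d + 1) - g (n + d)\<bar> \<le> Bmax g m" using Suc.prems by (intro Bmax_ge) auto
    ultimately show ?case by (simp add: distrib_right)
  qed auto
  show ?thesis
  proof (cases "n \<le> n'")
    case True
    thus ?thesis using *[of n "n' - n"] assms by (auto simp: of_nat_diff abs_minus_commute)
  next
    case False
    thus ?thesis using *[of n' "n - n'"] assms by (auto simp: of_nat_diff)
  qed
qed

lemma G_unit_diff:
  assumes "n \<in> {2 ^ m..<2 ^ (m + 1)}" "1 \<le> n" "s \<in> {0..1}" "t \<in> {0..1}"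
  shows "\<bar>G (real n + s) - G (real n + t)\<bar> \<le> \<bar>\<phi> s - \<phi> t\<bar> * Bmax g m"
proof -
  have "G (real n + s) - G (real n + t) = (\<phi> s - \<phi> t) * (g (n + 1) - g n)"
    unfolding G_add[OF assms(2,3)] G_add[OF assms(2,4)] by (simp add: algebra_simps)
  thus ?thesis using Bmax_ge[OF assms(1)] by (simp add: abs_mult mult_left_mono)
qed

text \<open>Two regimes. For \<open>j \<le> m\<close> the allowed distance is at least 1 and
  increments of \<open>g\<close> are counted; for \<open>j > m\<close> the points lie in at most two
  adjacent cells, where the modulus of \<open>\<phi>\<close> at level \<open>j - m\<close>
  decides.\<close>

lemma G_modulus:
  assumes x: "x \<in> {2 ^ m..2 ^ (m + 1)}" and y: "y \<in> {2 ^ m..2 ^ (m + 1)}"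
    and xy: "\<bar>x - y\<bar> \<le> 2 ^ m / 2 ^ j"
  shows "\<bar>G x - G y\<bar> \<le> 4 * (2 ^ m * Bmax g m) * contraction ^ j"
proof -
  define B r where "B = Bmax g m" and "r = contraction"
  have B: "0 \<le> B" by (simp add: B_def Bmax_nonneg)
  have r: "1/2 \<le> r" "r < 1" using contraction by (auto simp: r_def)
  have main: "\<bar>G x - G y\<bar> \<le> 4 * (2 ^ m * B) * r ^ j"
    if x: "x \<in> {2 ^ m..2 ^ (m + 1)}" and y: "y \<in> {2 ^ m..2 ^ (m + 1)}"
      and xy: "x \<le> y" "y - x \<le> 2 ^ m / 2 ^ j" for x y
  proof -
    obtain n t where n: "n \<in> {2 ^ m..<2 ^ (m + 1)}" "t \<in> {0..1}" "x = real n + t" "1 \<le> n"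
      using dyadic_unit_interval[OF x] by metis
    obtain n' t' where n': "n' \<in> {2 ^ m..<2 ^ (m + 1)}" "t' \<in> {0..1}" "y = real n' + t'" "1 \<le> n'"
      using dyadic_unit_interval[OF y] by metis
    show ?thesis
    proof (cases "j \<le> m")
      case True
      have pw: "(1::real) \<le> 2 ^ m / 2 ^ j" using True by (simp add: field_simps power_increasing)
      have unit: "\<bar>G (real k + s) - g k\<bar> \<le> B" if "k \<in> {2 ^ m..<2 ^ (m + 1)}" "1 \<le> k" "s \<in> {0..1}" for k s
      proof -
        have "\<bar>G (real k + s) - G (real k + 0)\<bar> \<le> \<bar>\<phi> s - \<phi> 0\<bar> * B"
          unfolding B_def using that by (intro G_unit_diff) auto
        also have "\<dots> \<le> 1 * B" using phi_range[OF that(3)] B by (intro mult_right_mono) auto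
        finally show ?thesis using G_of_nat[OF that(2)] by simp
      qed
      have "\<bar>real n - real n'\<bar> \<le> 2 ^ m / 2 ^ j + 1"
        using n(2,3) n'(2,3) xy by (auto simp: abs_le_iff)
      hence "\<bar>real n - real n'\<bar> * B \<le> (2 ^ m / 2 ^ j + 1) * B" using B by (intro mult_right_mono)
      moreover have "\<bar>g n - g n'\<bar> \<le> \<bar>real n - real n'\<bar> * B"
        unfolding B_def using n(1) n'(1) by (intro g_diff_le_Bmax) auto
      ultimately have "\<bar>g n - g n'\<bar> \<le> (2 ^ m / 2 ^ j + 1) * B" by linarith
      \<comment> \<open>The integers \<open>n\<close> and \<open>n'\<close> differ by at most
        \<open>2 ^ m / 2 ^ j + 1\<close>, and each end costs one more increment; as
        \<open>1 \<le> 2 ^ m / 2 ^ j\<close>, the total of \<open>2 ^ m / 2 ^ j + 3\<close> is at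
        most four times this quotient.\<close>
      hence "\<bar>G x - G y\<bar> \<le> B + (2 ^ m / 2 ^ j + 1) * B + B"
        using unit[OF n(1,4,2)] unit[OF n'(1,4,2)] unfolding n(3) n'(3) by linarith
      also have "\<dots> = (2 ^ m / 2 ^ j + 3) * B" by (simp add: algebra_simps)
      also have "\<dots> \<le> (4 * (2 ^ m / 2 ^ j)) * B" using pw B by (intro mult_right_mono; linarith)
      also have "\<dots> = 4 * (2 ^ m * B) * (1 / 2 ^ j)" by simp
      also have "\<dots> \<le> 4 * (2 ^ m * B) * r ^ j"
        unfolding r_def using B by (intro mult_left_mono contraction_power) auto
      finally show ?thesis .
    next
      case False
      define i where "i = j - m"
      have j: "j = m + i" "i > 0" using False by (auto simp: i_def)
      have d: "y - x \<le> 1 / 2 ^ i" using xy by (simp add: j power_add)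
      have "(1::real) / 2 ^ i \<le> 1 / 2 ^ 1" using j by (intro divide_left_mono power_increasing) auto
      hence d2: "y - x \<le> 1/2" using d unfolding power_one_right by linarith
      have unit: "\<bar>G (real k + s) - G (real k + s')\<bar> \<le> 2 * r ^ i * B"
        if "k \<in> {2 ^ m..<2 ^ (m + 1)}" "1 \<le> k" "s \<in> {0..1}" "s' \<in> {0..1}" "\<bar>s - s'\<bar> \<le> y - x" for k s s'
      proof -
        have "\<bar>\<phi> s - \<phi> s'\<bar> \<le> 2 * r ^ i"
          unfolding r_def using that d by (intro phi_modulus) auto
        hence "\<bar>\<phi> s - \<phi> s'\<bar> * B \<le> 2 * r ^ i * B" using B by (intro mult_right_mono)
        thus ?thesis using G_unit_diff[OF that(1-4)] unfolding B_def by linarith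
      qed
      have "\<bar>G x - G y\<bar> \<le> 4 * r ^ i * B"
      proof -
        consider "n = n'" | "n < n'" | "n' < n" by linarith
        thus ?thesis
        proof cases
          case 1
          have "\<bar>G x - G y\<bar> \<le> 2 * r ^ i * B"
            unfolding n(3) n'(3) 1 using n n' xy 1 by (intro unit) auto
          moreover have "0 \<le> 2 * r ^ i * B" using r B by simp
          ultimately show ?thesis by linarith
        next
          case 2
          have "real n' < real n + 2" using n n' d2 by auto
          hence nn: "n' = n + 1" using 2 by linarith
          have "\<bar>G (real n + t) - G (real n + 1)\<bar> \<le> 2 * r ^ i * B"
            using n n' nn by (intro unit) auto
          moreover have "\<bar>G (real n' + 0) - G (real n' + t')\<bar> \<le> 2 * r ^ i * B"
            using n n' nn by (intro unit) auto
          moreover have "real n + 1 = real n' + 0" using nn by simp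
          ultimately show ?thesis unfolding n(3) n'(3) by (simp only:)
        next
          \<comment> \<open>The integers can come in reversed order only when one boundary point is
            represented in two ways.\<close>
          case 3
          hence "real n' + 1 \<le> real n" by linarith
          hence "x = y" using n n' xy by auto
          thus ?thesis using r B by simp
        qed
      qed
      \<comment> \<open>The \<open>m\<close> missing levels are bought with
        \<open>1 \<le> 2 ^ m * r ^ m\<close>, so that \<open>r ^ i\<close> becomes
        \<open>2 ^ m * r ^ j\<close>.\<close>
      also have "\<dots> \<le> 4 * (r ^ i * (2 ^ m * r ^ m)) * B"
      proof -
        have "1 \<le> 2 ^ m * r ^ m" using contraction_power[of m] by (simp add: r_def field_simps)
        hence "r ^ i * 1 \<le> r ^ i * (2 ^ m * r ^ m)" using r by (intro mult_left_mono) auto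
        thus ?thesis using B by (intro mult_right_mono) auto
      qed
      also have "\<dots> = 4 * (2 ^ m * B) * r ^ j" by (simp add: j power_add)
      finally show ?thesis .
    qed
  qed
  show ?thesis
    using main[OF x y] main[OF y x] xy unfolding B_def r_def
    by (cases "x \<le> y") (auto simp: abs_minus_commute)
qed

text \<open>The summand of the hypothesis in (c). In the form of \<open>scaled_Bmax_eq\<close> it is
  the variation bound for the \<open>m\<close>-th term of the series on {1..2}.\<close>

definition scaled_Bmax :: "nat \<Rightarrow> real" where
  "scaled_Bmax m = 2 powr ((1 - \<rho>) * real m) * Bmax g m"

lemma scaled_Bmax_nonneg: "0 \<le> scaled_Bmax m"
  by (simp add: scaled_Bmax_def Bmax_nonneg)

lemma scaled_Bmax_eq: "scaled_Bmax m = 2 ^ m * Bmax g m / \<bar>\<alpha> + \<beta>\<bar> ^ m"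
  unfolding sum_power_abs scaled_Bmax_def
  by (simp add: left_diff_distrib powr_diff powr_realpow)

lemma Qterm_modulus:
  assumes "x \<in> {1..2}" "y \<in> {1..2}" "\<bar>x - y\<bar> \<le> 1 / 2 ^ j"
  shows "\<bar>Qterm \<rho> G m x - Qterm \<rho> G m y\<bar> \<le> 4 * scaled_Bmax m * contraction ^ j"
proof -
  have "\<bar>Qterm \<rho> G m x - Qterm \<rho> G m y\<bar> = \<bar>G (2 ^ m * x) - G (2 ^ m * y)\<bar> / \<bar>\<alpha> + \<beta>\<bar> ^ m"
    unfolding Qterm_div diff_divide_distrib[symmetric] abs_divide power_abs ..
  also have "\<dots> \<le> (4 * (2 ^ m * Bmax g m) * contraction ^ j) / \<bar>\<alpha> + \<beta>\<bar> ^ m"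
  proof (intro divide_right_mono G_modulus)
    have "\<bar>2 ^ m * x - 2 ^ m * y\<bar> = 2 ^ m * \<bar>x - y\<bar>"
      by (simp add: abs_mult flip: right_diff_distrib)
    also have "\<dots> \<le> 2 ^ m * (1 / 2 ^ j)" using assms by (intro mult_left_mono) auto
    finally show "\<bar>2 ^ m * x - 2 ^ m * y\<bar> \<le> 2 ^ m / 2 ^ j" by simp
  qed (use assms in auto)
  also have "\<dots> = 4 * scaled_Bmax m * contraction ^ j" by (simp add: scaled_Bmax_eq)
  finally show ?thesis .
qed

lemma Qterm_variation: "variation_le (Qterm \<rho> G m) 1 2 (scaled_Bmax m)"
proof -
  have "variation_le (\<lambda>x. G (2 ^ m * x)) 1 2 (2 ^ m * Bmax g m)"
    by (rule variation_le_compose_mono[OF G_variation]) auto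
  from variation_le_cmult[OF this, of "1 / (\<alpha> + \<beta>) ^ m"]
  show ?thesis by (simp add: Qterm_div[abs_def] scaled_Bmax_eq abs_divide power_abs)
qed

text \<open>Passing from one block to the next gives
  \<open>a (Suc m) \<le> q * a m + scaled_Bmax (Suc m)\<close> with
  \<open>q = 2 powr - \<rho>\<close>. The assumption on the weights means \<open>q < 1\<close>, so
  the summed recursion can be solved for the partial sums.\<close>

lemma Amax_summable_if_Bmax_summable:
  assumes s: "\<bar>\<alpha>\<bar> + \<bar>\<beta>\<bar> > 1" and B: "summable scaled_Bmax"
  shows "summable (\<lambda>m. 2 powr (- \<rho> * real m) * Amax g m)"
proof -
  define q where "q = 2 powr - \<rho>"
  have "\<rho> > 0" using s by (simp add: rho)
  hence q: "0 < q" "q < 1" unfolding q_def by (auto simp: powr_less_one)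
  define a where "a = (\<lambda>m. 2 powr (- \<rho> * real m) * Amax g m)"
  have a0: "0 \<le> a m" for m by (simp add: a_def Amax_nonneg)
  have step: "Amax g (Suc m) \<le> Amax g m + 2 ^ Suc m * Bmax g (Suc m)" for m
  proof -
    have "\<bar>g n\<bar> \<le> Amax g m + 2 ^ Suc m * Bmax g (Suc m)" if n: "n \<in> {2 ^ Suc m..2 ^ (Suc m + 1)}" for n
    proof -
      \<comment> \<open>\<open>2 ^ Suc m\<close> is the right end of the preceding block, which
        \<open>Amax\<close> includes.\<close>
      have "\<bar>g (2 ^ Suc m)\<bar> \<le> Amax g m" by (rule Amax_ge) auto
      moreover have "\<bar>g n - g (2 ^ Suc m)\<bar> \<le> \<bar>real n - real (2 ^ Suc m)\<bar> * Bmax g (Suc m)"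
        using n by (intro g_diff_le_Bmax) auto
      moreover have "\<bar>real n - real (2 ^ Suc m)\<bar> * Bmax g (Suc m) \<le> 2 ^ Suc m * Bmax g (Suc m)"
      proof (intro mult_right_mono Bmax_nonneg)
        have "real (2 ^ Suc m) \<le> real n" "real n \<le> real (2 ^ (Suc m + 1))"
          using n unfolding of_nat_le_iff by auto
        thus "\<bar>real n - real (2 ^ Suc m)\<bar> \<le> 2 ^ Suc m" by simp
      qed
      ultimately show ?thesis by linarith
    qed
    thus ?thesis unfolding Amax_def[of g "Suc m"] by (subst Max_le_iff) auto
  qed
  have rec_a: "a (Suc m) \<le> q * a m + scaled_Bmax (Suc m)" for m
  proof -
    have e: "2 powr (- \<rho> * real (Suc m)) = q * 2 powr (- \<rho> * real m)"
      unfolding q_def powr_add[symmetric] by (simp add: algebra_simps)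
    have "a (Suc m) \<le> 2 powr (- \<rho> * real (Suc m)) * (Amax g m + 2 ^ Suc m * Bmax g (Suc m))"
      unfolding a_def by (intro mult_left_mono step) auto
    also have "\<dots> = q * a m + 2 powr (- \<rho> * real (Suc m)) * 2 ^ Suc m * Bmax g (Suc m)"
      unfolding distrib_left a_def e by (simp only: mult.assoc)
    also have "2 powr (- \<rho> * real (Suc m)) * 2 ^ Suc m = 2 powr ((1 - \<rho>) * real (Suc m))"
      by (simp add: left_diff_distrib powr_diff powr_minus powr_realpow divide_inverse mult.commute del: power_Suc of_nat_Suc)
    finally show ?thesis by (simp add: scaled_Bmax_def)
  qed
  have "(\<Sum>m<N. a m) \<le> (a 0 + suminf scaled_Bmax) / (1 - q)" for N
  proof -
    have "(\<Sum>m<N. a m) \<le> (\<Sum>m<Suc N. a m)" using a0 by simp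
    also have "\<dots> = a 0 + (\<Sum>m<N. a (Suc m))" by (rule sum.lessThan_Suc_shift)
    also have "\<dots> \<le> a 0 + (\<Sum>m<N. q * a m + scaled_Bmax (Suc m))" by (intro add_left_mono sum_mono rec_a)
    also have "\<dots> = a 0 + q * (\<Sum>m<N. a m) + (\<Sum>m<N. scaled_Bmax (Suc m))"
      by (simp add: sum.distrib sum_distrib_left)
    also have "(\<Sum>m<N. scaled_Bmax (Suc m)) \<le> (\<Sum>m<Suc N. scaled_Bmax m)"
      unfolding sum.lessThan_Suc_shift[of scaled_Bmax] using scaled_Bmax_nonneg[of 0] by simp
    also have "\<dots> \<le> suminf scaled_Bmax" using B scaled_Bmax_nonneg by (intro sum_le_suminf) auto
    finally have "(1 - q) * (\<Sum>m<N. a m) \<le> a 0 + suminf scaled_Bmax" by (simp add: algebra_simps)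
    thus ?thesis using q by (simp add: field_simps)
  qed
  thus ?thesis unfolding a_def[symmetric] using a0 by (intro summableI_nonneg_bounded) auto
qed

text \<open>The solution of the homogeneous doubling equation; on {0..1}, \<open>P t\<close> is
  \<open>2 powr (- \<rho> * t) * core (2 powr t)\<close>.\<close>

definition core :: "real \<Rightarrow> real" where
  "core x = F x + Qfun \<rho> G x"

lemma core_limit:
  assumes uniform_series "x \<in> {1..2}"
  shows "(\<lambda>N. f 1 * (1 + (\<alpha> + \<beta> - 1) * \<phi> (x - 1)) + (\<Sum>m<N. Qterm \<rho> G m x)) \<longlonglongrightarrow> core x"
proof -
  have "(\<lambda>m. Qterm \<rho> G m x) sums (Qfun \<rho> G x + Qterm \<rho> G 0 x)"
    using Q_uniform_limit(2)[OF assms] unfolding Qfun_def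
    by (subst (asm) summable_sums_iff, subst (asm) sums_Suc_iff)
  hence "(\<lambda>N. \<Sum>m<N. Qterm \<rho> G m x) \<longlonglongrightarrow> Qfun \<rho> G x + G x"
    by (simp add: sums_def Qterm_div)
  hence "(\<lambda>N. f 1 * (1 + (\<alpha> + \<beta> - 1) * \<phi> (x - 1)) + (\<Sum>m<N. Qterm \<rho> G m x))
      \<longlonglongrightarrow> f 1 * (1 + (\<alpha> + \<beta> - 1) * \<phi> (x - 1)) + (Qfun \<rho> G x + G x)"
    by (intro tendsto_intros)
  thus ?thesis using F_base[OF assms(2)] by (simp add: core_def add_ac)
qed

text \<open>\<open>scaled_Bmax\<close> governs the modulus as well as the variation of each term, so
  the partial sums in \<open>core_limit\<close> satisfy both bounds with constants independent of
  \<open>N\<close>, and both bounds pass to the limit.\<close>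

lemma core_regular:
  assumes uniform_series and B: "summable scaled_Bmax"
  obtains C V where "C \<ge> 0"
    "\<And>x y j. x \<in> {1..2} \<Longrightarrow> y \<in> {1..2} \<Longrightarrow> \<bar>x - y\<bar> \<le> 1 / 2 ^ j \<Longrightarrow>
      \<bar>core x - core y\<bar> \<le> C * contraction ^ j"
    "variation_le core 1 2 V"
proof
  define c where "c = f 1 * (\<alpha> + \<beta> - 1)"
  define v where "v = suminf scaled_Bmax"
  define T where "T = (\<lambda>N x. f 1 * (1 + (\<alpha> + \<beta> - 1) * \<phi> (x - 1)) + (\<Sum>m<N. Qterm \<rho> G m x))"
  have partial: "(\<Sum>m<N. scaled_Bmax m) \<le> v" for N
    unfolding v_def using B scaled_Bmax_nonneg by (intro sum_le_suminf) auto
  have v: "0 \<le> v" using partial[of 0] by simp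
  show "0 \<le> 2 * \<bar>c\<bar> + 4 * v" using v by simp
  have r: "0 \<le> contraction ^ j" for j using contraction by simp
  show "\<bar>core x - core y\<bar> \<le> (2 * \<bar>c\<bar> + 4 * v) * contraction ^ j"
    if xy: "x \<in> {1..2}" "y \<in> {1..2}" "\<bar>x - y\<bar> \<le> 1 / 2 ^ j" for x y j
  proof -
    have "(\<lambda>N. \<bar>T N x - T N y\<bar>) \<longlonglongrightarrow> \<bar>core x - core y\<bar>"
      unfolding T_def by (intro tendsto_intros core_limit assms(1) xy)
    moreover have "\<bar>T N x - T N y\<bar> \<le> (2 * \<bar>c\<bar> + 4 * v) * contraction ^ j" for N
    proof -
      have "T N x - T N y = c * (\<phi> (x - 1) - \<phi> (y - 1)) + (\<Sum>m<N. Qterm \<rho> G m x - Qterm \<rho> G m y)"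
        by (simp add: T_def c_def sum_subtractf algebra_simps)
      also have "\<bar>\<dots>\<bar> \<le> \<bar>c\<bar> * \<bar>\<phi> (x - 1) - \<phi> (y - 1)\<bar> + (\<Sum>m<N. \<bar>Qterm \<rho> G m x - Qterm \<rho> G m y\<bar>)"
        by (rule order.trans[OF abs_triangle_ineq]) (auto simp: abs_mult intro: sum_abs)
      also have "\<dots> \<le> \<bar>c\<bar> * (2 * contraction ^ j) + (\<Sum>m<N. 4 * scaled_Bmax m * contraction ^ j)"
        using xy by (intro add_mono mult_left_mono sum_mono Qterm_modulus phi_modulus) auto
      also have "(\<Sum>m<N. 4 * scaled_Bmax m * contraction ^ j) = 4 * (\<Sum>m<N. scaled_Bmax m) * contraction ^ j"
        by (simp add: sum_distrib_left sum_distrib_right mult_ac)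
      also have "\<dots> \<le> 4 * v * contraction ^ j"
        using partial r by (intro mult_right_mono mult_left_mono) auto
      finally show ?thesis by (simp add: algebra_simps)
    qed
    ultimately show ?thesis by (intro LIMSEQ_le_const2) auto
  qed
  show "variation_le core 1 2 (\<bar>c\<bar> * (\<phi> (2 - 1) - \<phi> (1 - 1)) + v)"
  proof (rule variation_le_limit)
    show "(\<lambda>N. T N x) \<longlonglongrightarrow> core x" if "x \<in> {1..2}" for x
      unfolding T_def using assms(1) that by (rule core_limit)
    fix N
    have "variation_le (\<lambda>x. \<phi> (x - 1)) 1 2 (\<phi> (2 - 1) - \<phi> (1 - 1))"
      by (intro variation_le_mono phi_mono) auto
    hence "variation_le (\<lambda>x. f 1 + (c * \<phi> (x - 1) + (\<Sum>m<N. Qterm \<rho> G m x))) 1 2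
        (\<bar>c\<bar> * (\<phi> (2 - 1) - \<phi> (1 - 1)) + (\<Sum>m<N. scaled_Bmax m))"
      by (intro variation_le_const_add variation_le_add variation_le_cmult variation_le_sum Qterm_variation)
    also have "(\<lambda>x. f 1 + (c * \<phi> (x - 1) + (\<Sum>m<N. Qterm \<rho> G m x))) = T N"
      by (simp add: T_def c_def algebra_simps)
    finally show "variation_le (T N) 1 2 (\<bar>c\<bar> * (\<phi> (2 - 1) - \<phi> (1 - 1)) + v)"
      by (rule variation_le_weaken) (use partial in simp)
  qed
qed

text \<open>On {0..1} \<open>P\<close> is the product of a decreasing Lipschitz exponential and
  \<open>core (2 powr t)\<close>, so modulus and variation of \<open>core\<close> carry over and
  Zygmund's theorem applies.\<close>

lemma P_abs_summable:
  assumes s: "\<bar>\<alpha>\<bar> + \<bar>\<beta>\<bar> > 1" and B: "summable scaled_Bmax"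
  shows "(\<lambda>k. norm (Phat P k)) summable_on UNIV"
proof -
  have U: uniform_series
    using Amax_summable_if_Bmax_summable[OF assms] by (rule uniform_series_if_Amax_summable)
  have \<rho>: "\<rho> > 0" using s by (simp add: rho)
  define E where "E = (\<lambda>t. 2 powr (- \<rho> * t))"
  obtain C V where C: "C \<ge> 0" "\<And>x y j. x \<in> {1..2} \<Longrightarrow> y \<in> {1..2} \<Longrightarrow> \<bar>x - y\<bar> \<le> 1 / 2 ^ j \<Longrightarrow>
      \<bar>core x - core y\<bar> \<le> C * contraction ^ j" and V: "variation_le core 1 2 V"
    using core_regular[OF U B] by blast
  have im: "2 powr t \<in> {1..2}" if "t \<in> {0..1}" for t :: real
    using that powr_mono[of t 1 2] by (auto simp: ge_one_powr_ge_zero)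
  have P_eq: "P t = E t * core (2 powr t)" if "t \<in> {0..1}" for t
    using bisummable_Pterm_base(2)[OF U that] by (simp add: E_def core_def)
  have "continuous_on {1..2} core"
    unfolding core_def by (intro continuous_intros Q_continuous[OF U] continuous_on_subset[OF F_continuous]) auto
  hence "bounded (core ` {1..2})" by (intro compact_imp_bounded compact_continuous_image) auto
  then obtain M where M: "M > 0" "\<And>x. x \<in> {1..2} \<Longrightarrow> \<bar>core x\<bar> \<le> M"
    unfolding bounded_pos by auto
  have E1: "\<bar>E t\<bar> \<le> 1" if "t \<in> {0..1}" for t
    using that \<rho> powr_mono[of "- \<rho> * t" 0 2] by (simp add: E_def)
  have E_mono: "- E s \<le> - E t" if "s \<le> t" for s t
    unfolding E_def using that \<rho> by (simp add: mult_left_mono)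
  have le1: "2 powr (- x) \<le> 1" if "0 \<le> x" for x :: real
    using powr_mono[of "- x" 0 2] that by simp
  have E_lip: "\<bar>E s - E t\<bar> \<le> \<rho> * \<bar>s - t\<bar>" if "s \<in> {0..1}" "t \<in> {0..1}" for s t
  proof -
    have *: "\<bar>E s - E t\<bar> \<le> \<rho> * \<bar>s - t\<bar>" if "s \<in> {0..1}" "s \<le> t" for s t
    proof -
      have "E t = E s * 2 powr (- (\<rho> * (t - s)))"
        unfolding E_def powr_add[symmetric] by (simp add: algebra_simps)
      hence "E s - E t = E s * (1 - 2 powr (- (\<rho> * (t - s))))" by (simp add: right_diff_distrib)
      also have "\<dots> \<le> 1 * (\<rho> * (t - s))"
        using that \<rho> E1[OF that(1)] by (intro mult_mono one_minus_powr_le) (auto intro!: le1)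
      finally show ?thesis using E_mono[OF that(2)] that(2) by simp
    qed
    show ?thesis using *[of s t] *[of t s] that by (cases "s \<le> t") (auto simp: abs_minus_commute)
  qed
  have pow_lip: "\<bar>2 powr s - 2 powr t\<bar> \<le> 2 * \<bar>s - t\<bar>" if "s \<in> {0..1}" "t \<in> {0..1}" for s t :: real
  proof -
    have *: "\<bar>2 powr s - 2 powr t\<bar> \<le> 2 * \<bar>s - t\<bar>" if "t \<in> {0..1}" "s \<le> t" for s t :: real
    proof -
      have "2 powr s = 2 powr t * 2 powr (- (t - s))" unfolding powr_add[symmetric] by simp
      hence "2 powr t - 2 powr s = 2 powr t * (1 - 2 powr (- (t - s)))" by (simp add: right_diff_distrib)
      also have "\<dots> \<le> 2 * (t - s)"
        using that im[OF that(1)] le1[of "t - s"] by (intro mult_mono one_minus_powr_le) auto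
      finally show ?thesis using powr_mono[OF that(2), of 2] that(2) by simp
    qed
    show ?thesis using *[of t s] *[of s t] that by (cases "s \<le> t") (auto simp: abs_minus_commute)
  qed
  have r: "0 < contraction" using contraction by simp
  show ?thesis
  proof (rule Phat_abs_summable[OF P_antiperiodic[OF U] P_continuous[OF U] r contraction(2)])
    fix j and s t :: real assume st: "s \<in> {0..1}" "t \<in> {0..1}" "\<bar>s - t\<bar> \<le> 1 / 2 ^ j"
    \<comment> \<open>\<open>2 powr t\<close> expands distances by at most 2 on {0..1}, which costs
      one level of \<open>j\<close> and hence the factor \<open>1 / contraction\<close>. For
      \<open>j = 0\<close> both points lie in {1..2}, already at distance at most 1.\<close>
    have coreb: "\<bar>core (2 powr s) - core (2 powr t)\<bar> \<le> C / contraction * contraction ^ j"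
    proof (cases j)
      case 0
      have "\<bar>core (2 powr s) - core (2 powr t)\<bar> \<le> C * contraction ^ 0"
        using im[OF st(1)] im[OF st(2)] by (intro C(2)) auto
      also have "\<dots> \<le> C / contraction" using C(1) contraction r by (simp add: field_simps mult_left_le)
      finally show ?thesis using 0 by simp
    next
      case (Suc i)
      have "\<bar>2 powr s - 2 powr t\<bar> \<le> 1 / 2 ^ i"
        using pow_lip[OF st(1,2)] st(3) by (simp add: Suc)
      hence "\<bar>core (2 powr s) - core (2 powr t)\<bar> \<le> C * contraction ^ i"
        using im st by (intro C(2)) auto
      thus ?thesis using r Suc by simp
    qed
    have "P s - P t = E s * (core (2 powr s) - core (2 powr t)) + core (2 powr t) * (E s - E t)"
      unfolding P_eq[OF st(1)] P_eq[OF st(2)] by (simp add: algebra_simps)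
    also have "\<bar>\<dots>\<bar> \<le> \<bar>E s\<bar> * \<bar>core (2 powr s) - core (2 powr t)\<bar> + \<bar>core (2 powr t)\<bar> * \<bar>E s - E t\<bar>"
      by (metis abs_mult abs_triangle_ineq)
    also have "\<dots> \<le> 1 * (C / contraction * contraction ^ j) + M * (\<rho> * contraction ^ j)"
    proof (intro add_mono mult_mono coreb E1 st M im)
      have "\<bar>E s - E t\<bar> \<le> \<rho> * \<bar>s - t\<bar>" by (rule E_lip[OF st(1,2)])
      also have "\<dots> \<le> \<rho> * contraction ^ j"
        using \<rho> st(3) contraction_power[of j] by (intro mult_left_mono) auto
      finally show "\<bar>E s - E t\<bar> \<le> \<rho> * contraction ^ j" .
    qed (use M in auto)
    finally show "\<bar>P s - P t\<bar> \<le> (C / contraction + M * \<rho>) * contraction ^ j"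
      by (simp add: algebra_simps)
  next
    fix n and x :: "nat \<Rightarrow> real"
    assume x: "\<And>i. i \<le> n \<Longrightarrow> x i \<in> {0..1}" "\<And>i. i < n \<Longrightarrow> x i \<le> x (Suc i)"
    have "variation_le (\<lambda>t. - E t) 0 1 (- E 1 - - E 0)"
      by (intro variation_le_mono E_mono) auto
    from variation_le_cmult[OF this, of "-1"]
    have VE: "variation_le E 0 1 (E 0 - E 1)" by simp
    have VW: "variation_le (\<lambda>t. core (2 powr t)) 0 1 V"
      by (rule variation_le_compose_mono[OF V im]) auto
    have "variation_le (\<lambda>t. E t * core (2 powr t)) 0 1 (1 * V + M * (E 0 - E 1))"
      using M im E1 by (intro variation_le_mult VE VW) auto
    hence "variation_le P 0 1 (1 * V + M * (E 0 - E 1))"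
      using P_eq by (subst variation_le_cong)
    thus "(\<Sum>i<n. \<bar>P (x (Suc i)) - P (x i)\<bar>) \<le> 1 * V + M * (E 0 - E 1)"
      by (rule variation_leD) (use x in auto)
  qed
qed

lemma P_fourier_series:
  assumes "\<bar>\<alpha>\<bar> + \<bar>\<beta>\<bar> > 1" "summable scaled_Bmax"
  shows "((\<lambda>k. Phat P k * half_char k t) has_sum of_real (P t)) UNIV"
proof -
  have U: uniform_series
    using Amax_summable_if_Bmax_summable[OF assms] by (rule uniform_series_if_Amax_summable)
  show ?thesis unfolding Phat_eq_half_coeff
  proof (rule half_series_inversion)
    show "continuous_on UNIV (\<lambda>t. complex_of_real (P t))"
      by (intro continuous_intros P_continuous[OF U])
    show "complex_of_real (P (t + 1)) = - complex_of_real (P t)" for t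
      using P_antiperiodic[OF U] by (simp add: antiperiodic1_def)
    show "(\<lambda>k. norm (half_coeff (\<lambda>t. complex_of_real (P t)) k)) summable_on UNIV"
      using P_abs_summable[OF assms] unfolding Phat_eq_half_coeff .
  qed
qed

section \<open>Equal weights\<close>

text \<open>\<open>2 * k + 1\<close> is odd, so the imaginary part never vanishes; this keeps the
  denominators \<open>\<rho> + chi' k\<close> and \<open>\<rho> - 1 + chi' k\<close> away from 0 for
  every \<open>\<rho>\<close>.\<close>

lemma chi'_imaginary: "Re (chi' k) = 0" "Im (chi' k) \<noteq> 0"
proof -
  have "real_of_int (2 * k + 1) \<noteq> 0" by (simp only: of_int_eq_0_iff) presburger
  thus "Re (chi' k) = 0" "Im (chi' k) \<noteq> 0" by (simp_all add: chi'_def)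
qed

lemma equal_weights:
  assumes "\<alpha> = \<beta>"
  shows "\<And>t. t \<in> {0..1} \<Longrightarrow> \<phi> t = t" and "2 powr \<rho> = - 2 * \<alpha>"
  using is_phi_equal_weights[of "\<bar>\<alpha>\<bar>" \<phi>] is_phi neg assms sum_eq by auto

text \<open>\<open>2 powr chi' k = -1\<close> and \<open>2 powr \<rho> = - 2 * \<alpha>\<close>,
  hence \<open>2 powr s = \<alpha>\<close> for \<open>s = \<rho> - 1 + chi' k\<close>: the powers in
  the boundary terms at 2 become rational in \<open>\<alpha>\<close>.\<close>

lemma two_powr_chi':
  assumes "\<alpha> = \<beta>"
  shows "(2::complex) powr - (of_real \<rho> - 1 + chi' k) = of_real (1 / \<alpha>)"
    and "(2::complex) powr (- (of_real \<rho> - 1 + chi' k) - 1) = of_real (1 / (2 * \<alpha>))"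
proof -
  define s where "s = of_real \<rho> - 1 + chi' k"
  have "complex_of_real (2 powr 1) powr (of_real \<rho> + chi' k + 1) = of_real (2 powr (\<rho> * 1) * 2 powr 1) * half_char k 1"
    by (rule powr_chi')
  hence "(2::complex) powr (s + 2) = - (2 * of_real (2 powr \<rho>))"
    by (simp add: s_def algebra_simps)
  also have "\<dots> = of_real (4 * \<alpha>)" by (simp add: equal_weights(2)[OF assms])
  finally have p: "(2::complex) powr (s + 2) = of_real (4 * \<alpha>)" .
  have "(2::complex) powr (s + 2) = 2 powr s * 4"
    by (subst powr_add) (simp add: powr_numeral)
  hence "(2::complex) powr s = of_real \<alpha>" using p by simp
  hence 1: "(2::complex) powr - s = of_real (1 / \<alpha>)"
    by (simp add: powr_minus divide_inverse)
  have "(2::complex) powr (- s - 1) = 2 powr - s / 2"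
    by (simp add: powr_diff)
  with 1 show "(2::complex) powr - (of_real \<rho> - 1 + chi' k) = of_real (1 / \<alpha>)"
    "(2::complex) powr (- (of_real \<rho> - 1 + chi' k) - 1) = of_real (1 / (2 * \<alpha>))"
    by (simp_all add: s_def)
qed

lemma kernel_exponent: "of_real u powr (- (of_real \<rho> - 1 + chi' k) - 2) = 1 / of_real u powr (of_real \<rho> + chi' k + 1)"
proof -
  have "- (of_real \<rho> - 1 + chi' k) - 2 = - (of_real \<rho> + chi' k + 1)" by simp
  thus ?thesis by (simp only: powr_minus inverse_eq_divide)
qed

lemma integral_kernel_1_equal_weights:
  assumes eq: "\<alpha> = \<beta>"
  shows "integral {0..1} (kernel_1 \<alpha> \<beta> \<phi> \<rho> k)
    = of_real ((2 * \<alpha> - 1) * (\<alpha> - 1) / \<alpha>) / ((of_real \<rho> - 1 + chi' k) * (of_real \<rho> + chi' k))"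
proof -
  define s where "s = of_real \<rho> - 1 + chi' k"
  have s: "s \<noteq> 0" "s + 1 \<noteq> 0" using chi'_imaginary[of k] by (auto simp: s_def complex_eq_iff)
  \<comment> \<open>After translation by 1 the numerator \<open>1 + (2 * \<alpha> - 1) * u\<close>
    of \<open>kernel_1\<close> is the affine function \<open>p + q * u\<close> on {1..2}, with value
    1 at 1 and \<open>2 * \<alpha>\<close> at 2.\<close>
  define p q where "p = 2 - 2 * \<alpha>" and "q = 2 * \<alpha> - 1"
  define K where "K = (\<lambda>u. of_real (p + q * u) * complex_of_real u powr (- s - 2))"
  have K: "(K has_integral
    (of_real (p + q * 2) * (- (of_real 2 powr (- s - 1)) / (s + 1)) - of_real q * (of_real 2 powr - s / (s * (s + 1)))
     - (of_real (p + q * 1) * (- (of_real 1 powr (- s - 1)) / (s + 1)) - of_real q * (of_real 1 powr - s / (s * (s + 1)))))) {1..2}"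
    unfolding K_def using s by (intro integral_affine_powr) auto
  have "integral {0..1} (kernel_1 \<alpha> \<beta> \<phi> \<rho> k) = integral {0..1} (K \<circ> (\<lambda>u. u + 1))"
  proof (intro integral_cong)
    fix u :: real assume u: "u \<in> {0..1}"
    have "1 + (\<alpha> + \<beta> - 1) * \<phi> u = p + q * (u + 1)"
      using equal_weights(1)[OF eq u] eq by (simp add: p_def q_def algebra_simps)
    thus "kernel_1 \<alpha> \<beta> \<phi> \<rho> k u = (K \<circ> (\<lambda>u. u + 1)) u"
      unfolding kernel_1_def K_def s_def comp_def kernel_exponent by (simp only: add.commute[of 1 u]) simp
  qed
  also have "\<dots> = integral {1..2} K"
  proof -
    have "continuous_on {1..2} K"
      unfolding K_def by (intro continuous_intros) (auto simp: complex_nonpos_Reals_iff)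
    thus ?thesis using integral_shift[of 0 1 1 K] by simp
  qed
  also have "\<dots> = of_real (p + q * 2) * (- (2 powr (- s - 1)) / (s + 1)) - of_real q * (2 powr - s / (s * (s + 1)))
     - (of_real (p + q * 1) * (- 1 / (s + 1)) - of_real q * (1 / (s * (s + 1))))"
    using integral_unique[OF K] by simp
  also have "\<dots> = - (of_real (2 * \<alpha> * (1 / (2 * \<alpha>))) / (s + 1)) - of_real q * (of_real (1 / \<alpha>) / (s * (s + 1)))
     - (- (1 / (s + 1)) - of_real q * (1 / (s * (s + 1))))"
    unfolding s_def two_powr_chi'[OF eq] by (simp add: p_def q_def)
  \<comment> \<open>The value \<open>2 * \<alpha>\<close> at 2 meets the power
    \<open>1 / (2 * \<alpha>)\<close>, so the two boundary terms with \<open>1 / (s + 1)\<close>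
    cancel and only the slope terms remain.\<close>
  also have "2 * \<alpha> * (1 / (2 * \<alpha>)) = 1" using neg by simp
  also have "- (of_real 1 / (s + 1)) - of_real q * (of_real (1 / \<alpha>) / (s * (s + 1)))
     - (- (1 / (s + 1)) - of_real q * (1 / (s * (s + 1)))) = of_real (q * (1 - 1 / \<alpha>)) / (s * (s + 1))"
    by (simp add: diff_divide_distrib algebra_simps)
  also have "q * (1 - 1 / \<alpha>) = (2 * \<alpha> - 1) * (\<alpha> - 1) / \<alpha>" using neg by (simp add: q_def field_simps)
  finally show ?thesis by (simp add: s_def algebra_simps)
qed

lemma integral_kernel_g_unit:
  assumes eq: "\<alpha> = \<beta>" and n: "1 \<le> n" and s: "s = of_real \<rho> - 1 + chi' k"
  shows "integral {real n..real n + 1} (kernel_g \<rho> G k)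
    = of_real (g (n + 1)) * (- (of_real (real n + 1) powr (- s - 1)) / (s + 1))
      - of_real (g n) * (- (of_real (real n) powr (- s - 1)) / (s + 1))
      - of_real (g (n + 1) - g n) * ((of_real (real n + 1) powr - s - of_real (real n) powr - s) / (s * (s + 1)))"
proof -
  have s0: "s \<noteq> 0" "s + 1 \<noteq> 0" using chi'_imaginary[of k] by (auto simp: s complex_eq_iff)
  define q p where "q = g (n + 1) - g n" and "p = g n - q * real n"
  have "integral {real n..real n + 1} (kernel_g \<rho> G k)
      = integral {real n..real n + 1} (\<lambda>u. of_real (p + q * u) * of_real u powr (- s - 2))"
  proof (intro integral_cong)
    fix u :: real assume u: "u \<in> {real n..real n + 1}"
    have "G u = (1 - (u - real n)) * g n + (u - real n) * g (n + 1)"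
      using G_add[OF n, of "u - real n"] equal_weights(1)[OF eq, of "u - real n"] u by simp
    hence "G u = p + q * u" by (simp add: p_def q_def algebra_simps)
    thus "kernel_g \<rho> G k u = of_real (p + q * u) * of_real u powr (- s - 2)"
      unfolding kernel_g_def s kernel_exponent by simp
  qed
  also have "\<dots> = of_real (p + q * (real n + 1)) * (- (of_real (real n + 1) powr (- s - 1)) / (s + 1))
      - of_real q * (of_real (real n + 1) powr - s / (s * (s + 1)))
      - (of_real (p + q * real n) * (- (of_real (real n) powr (- s - 1)) / (s + 1))
      - of_real q * (of_real (real n) powr - s / (s * (s + 1))))"
    using s0 n by (intro integral_unique integral_affine_powr) auto
  also have "p + q * (real n + 1) = g (n + 1)" by (simp add: p_def q_def algebra_simps)
  also have "p + q * real n = g n" by (simp add: p_def)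
  finally show ?thesis by (simp add: q_def right_diff_distrib diff_divide_distrib)
qed

text \<open>Summation by parts over the unit cells: the slope terms of neighbouring cells combine to
  second differences of the power, while the terms with \<open>1 / (s + 1)\<close> telescope. The
  remainder takes back the forward difference that the next cell would have contributed at index
  \<open>N + 1\<close>.\<close>

lemma integral_kernel_g_nat:
  assumes eq: "\<alpha> = \<beta>" and s: "s = of_real \<rho> - 1 + chi' k"
  shows "integral {1..real (N + 1)} (kernel_g \<rho> G k)
    = (\<Sum>n<N. Dterm g s (n + 2)) / (s * (s + 1))
      + of_real (g (N + 1)) * (- (of_real (real (N + 1)) powr (- s - 1)) / (s + 1)
          - (of_real (real N + 2) powr - s - of_real (real N + 1) powr - s) / (s * (s + 1)))"
proof (induction N)
  case 0
  \<comment> \<open>The integral over a point is 0, and the remainder vanishes because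
    \<open>g 1 = 0\<close>.\<close>
  show ?case using g1 by simp
next
  case (Suc N)
  define A where "A = s * (s + 1)"
  define D where "D = (\<lambda>n. - (of_real n powr (- s - 1)) / (s + 1) :: complex)"
  define K where "K = (\<lambda>n. of_real n powr - s / A :: complex)"
  have "integral {1..real (Suc N + 1)} (kernel_g \<rho> G k)
      = integral {1..real (N + 1)} (kernel_g \<rho> G k) + integral {real (N + 1)..real (Suc N + 1)} (kernel_g \<rho> G k)"
    by (intro Henstock_Kurzweil_Integration.integral_combine[symmetric] integrable_continuous_real kernel_g_continuous) auto
  also have "integral {real (N + 1)..real (Suc N + 1)} (kernel_g \<rho> G k)
      = of_real (g (N + 2)) * D (real N + 2) - of_real (g (N + 1)) * D (real N + 1)
        - of_real (g (N + 2) - g (N + 1)) * (K (real N + 2) - K (real N + 1))"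
    using integral_kernel_g_unit[OF eq, of "N + 1" s k] s
    by (simp add: D_def K_def A_def diff_divide_distrib add_ac numeral_2_eq_2)
  also have "integral {1..real (N + 1)} (kernel_g \<rho> G k)
      = (\<Sum>n<N. Dterm g s (n + 2)) / A + of_real (g (N + 1)) * (D (real N + 1) - (K (real N + 2) - K (real N + 1)))"
    using Suc by (simp add: D_def K_def A_def diff_divide_distrib add_ac)
  finally have 1: "integral {1..real (Suc N + 1)} (kernel_g \<rho> G k)
      = (\<Sum>n<N. Dterm g s (n + 2)) / A + of_real (g (N + 2)) * (D (real N + 2) - (K (real N + 2) - K (real N + 1)))"
    by (simp add: algebra_simps)
  have "Dterm g s (N + 2) / A = of_real (g (N + 2)) * (K (real N + 1) - 2 * K (real N + 2) + K (real N + 3))"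
  proof -
    define a b c :: complex where "a = of_real (real N + 1) powr - s" and "b = of_real (real N + 2) powr - s"
      and "c = of_real (real N + 3) powr - s"
    have "Dterm g s (N + 2) = of_real (g (N + 2)) * (a - 2 * b + c)"
      by (simp add: Dterm_def a_def b_def c_def add_ac)
    moreover have "K (real N + 1) = a / A" "K (real N + 2) = b / A" "K (real N + 3) = c / A"
      by (simp_all add: K_def a_def b_def c_def)
    ultimately show ?thesis by (simp only:) (simp add: algebra_simps add_divide_distrib diff_divide_distrib)
  qed
  hence 2: "(\<Sum>n<Suc N. Dterm g s (n + 2)) / A = (\<Sum>n<N. Dterm g s (n + 2)) / A
      + of_real (g (N + 2)) * (K (real N + 1) - 2 * K (real N + 2) + K (real N + 3))"
    by (simp add: add_divide_distrib)
  have "integral {1..real (Suc N + 1)} (kernel_g \<rho> G k)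
      = (\<Sum>n<Suc N. Dterm g s (n + 2)) / A + of_real (g (N + 2)) * (D (real N + 2) - (K (real N + 3) - K (real N + 2)))"
    unfolding 1 2 by (simp add: algebra_simps)
  thus ?case by (simp add: D_def K_def A_def diff_divide_distrib add_ac numeral_2_eq_2 numeral_3_eq_3)
qed

lemma norm_powr_shift:
  assumes s: "s = of_real \<rho> - 1 + chi' k" and u: "u > 0"
  shows "norm (complex_of_real u powr (- s - 1)) = u powr - \<rho>"
  using u chi'_imaginary(1)[of k] by (subst norm_powr_real_powr) (auto simp: s)

text \<open>Written as an integral over a unit interval, the difference gains one power of
  \<open>u\<close> over the size \<open>u powr (1 - \<rho>)\<close> of its two terms; what is left
  can be absorbed by the order of \<open>G\<close>.\<close>

lemma powr_difference_bound:
  assumes s: "s = of_real \<rho> - 1 + chi' k" and u: "u \<ge> 1"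
  shows "norm ((of_real (u + 1) powr - s - complex_of_real u powr - s) / (s * (s + 1)))
    \<le> max 1 (2 powr - \<rho>) * u powr - \<rho> / norm (s + 1)"
proof -
  have s0: "s \<noteq> 0" "s + 1 \<noteq> 0" using chi'_imaginary[of k] by (auto simp: s complex_eq_iff)
  define h where "h = (\<lambda>u. - (complex_of_real u powr (- s - 1)) / (s + 1))"
  have "(h has_integral (of_real (u + 1) powr - s / (s * (s + 1)) - of_real u powr - s / (s * (s + 1)))) {u..u + 1}"
    unfolding h_def using s0 u by (intro fundamental_theorem_of_calculus powr_second_antiderivative(1)) auto
  hence e: "of_real (u + 1) powr - s / (s * (s + 1)) - of_real u powr - s / (s * (s + 1)) = integral {u..u + 1} h"
    by (simp add: integral_unique)
  have "norm (integral {u..u + 1} h) \<le> max 1 (2 powr - \<rho>) * u powr - \<rho> / norm (s + 1) * (u + 1 - u)"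
  proof (rule integral_bound)
    show "continuous_on {u..u + 1} h"
      unfolding h_def using u s0 by (intro continuous_intros) (auto simp: complex_nonpos_Reals_iff)
    show "norm (h v) \<le> max 1 (2 powr - \<rho>) * u powr - \<rho> / norm (s + 1)" if "v \<in> {u..u + 1}" for v
    proof -
      define y where "y = v / u"
      have y: "1 \<le> y" "y \<le> 2" using that u by (auto simp: y_def field_simps)
      have v: "v = u * y" "v > 0" using that u by (auto simp: y_def)
      have "norm (h v) = v powr - \<rho> / norm (s + 1)"
        unfolding h_def norm_divide norm_minus_cancel norm_powr_shift[OF s v(2)] ..
      also have "v powr - \<rho> = y powr - \<rho> * u powr - \<rho>"
        unfolding v(1) using u y by (subst powr_mult) auto
      also have "y powr - \<rho> \<le> max 1 (2 powr - \<rho>)"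
        using y powr_mono2[of "- \<rho>" y 2] powr_mono2'[of "- \<rho>" 1 y] by (cases "\<rho> \<le> 0") (auto simp: le_max_iff_disj)
      finally show ?thesis by (simp add: mult_right_mono divide_right_mono)
    qed
  qed simp
  thus ?thesis by (simp add: diff_divide_distrib flip: e)
qed

text \<open>The remainder of \<open>integral_kernel_g_nat\<close> is at most a constant times the
  modulus of \<open>G u / u powr \<rho>\<close> at \<open>u = N + 1\<close>, which tends to 0 by
  \<open>G_smallo\<close>.\<close>

lemma Dseries_formula:
  assumes U: uniform_series and eq: "\<alpha> = \<beta>" and s: "s = of_real \<rho> - 1 + chi' k"
    and imp: "has_improper_integral (kernel_g \<rho> G k) I 1"
  shows "(\<lambda>n. Dterm g s (n + 2)) sums (s * (s + 1) * I)"
proof -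
  have s0: "s \<noteq> 0" "s + 1 \<noteq> 0" using chi'_imaginary[of k] by (auto simp: s complex_eq_iff)
  define rem where "rem = (\<lambda>N. of_real (g (N + 1)) * (- (of_real (real (N + 1)) powr (- s - 1)) / (s + 1)
          - (of_real (real N + 2) powr - s - of_real (real N + 1) powr - s) / (s * (s + 1))))"
  define C where "C = (1 + max 1 (2 powr - \<rho>)) / norm (s + 1)"
  have bound: "norm (rem N) \<le> \<bar>G (real (N + 1)) / real (N + 1) powr \<rho>\<bar> * C" for N
  proof -
    define u where "u = real (N + 1)"
    have u: "u \<ge> 1" by (simp add: u_def)
    have e: "real N + 2 = u + 1" "real N + 1 = u" by (simp_all add: u_def)
    have "norm (rem N) = \<bar>g (N + 1)\<bar> * norm (- (of_real u powr (- s - 1)) / (s + 1)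
          - (of_real (u + 1) powr - s - of_real u powr - s) / (s * (s + 1)))"
      unfolding rem_def norm_mult norm_of_real e u_def[symmetric] ..
    also have "norm (- (of_real u powr (- s - 1)) / (s + 1)
          - (of_real (u + 1) powr - s - of_real u powr - s) / (s * (s + 1)))
        \<le> norm (- (of_real u powr (- s - 1)) / (s + 1)) + norm ((of_real (u + 1) powr - s - of_real u powr - s) / (s * (s + 1)))"
      by (rule norm_triangle_ineq4)
    also have "\<dots> \<le> u powr - \<rho> / norm (s + 1) + max 1 (2 powr - \<rho>) * u powr - \<rho> / norm (s + 1)"
      using u by (intro add_mono powr_difference_bound[OF s])
        (simp_all add: norm_divide norm_powr_shift[OF s])
    also have "\<dots> = u powr - \<rho> * C" by (simp add: C_def add_divide_distrib algebra_simps)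
    finally have "norm (rem N) \<le> \<bar>g (N + 1)\<bar> * (u powr - \<rho> * C)" by (simp add: mult_left_mono)
    also have "g (N + 1) = G u" unfolding u_def by (rule G_of_nat[symmetric]) simp
    also have "\<bar>G u\<bar> * (u powr - \<rho> * C) = \<bar>G u / u powr \<rho>\<bar> * C"
      by (simp add: powr_minus abs_mult divide_inverse)
    finally show ?thesis by (simp only: u_def)
  qed
  have top: "filterlim (\<lambda>N. real (N + 1)) at_top sequentially"
    by (rule filterlim_compose[OF filterlim_real_sequentially filterlim_add_const_nat_at_top])
  have "(\<lambda>N. \<bar>G (real (N + 1)) / real (N + 1) powr \<rho>\<bar> * C) \<longlonglongrightarrow> 0 * C"
    by (intro tendsto_intros filterlim_compose[OF tendsto_rabs_zero[OF G_smallo[OF U]] top])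
  hence "(\<lambda>N. \<bar>G (real (N + 1)) / real (N + 1) powr \<rho>\<bar> * C) \<longlonglongrightarrow> 0" by simp
  hence rem0: "rem \<longlonglongrightarrow> 0"
    by (rule Lim_null_comparison[rotated]) (use bound in auto)
  have "(\<lambda>N. integral {1..real (N + 1)} (kernel_g \<rho> G k)) \<longlonglongrightarrow> I"
    using imp unfolding has_improper_integral_def by (intro filterlim_compose[OF _ top]) (rule conjunct2)
  hence "(\<lambda>N. s * (s + 1) * (integral {1..real (N + 1)} (kernel_g \<rho> G k) - rem N)) \<longlonglongrightarrow> s * (s + 1) * (I - 0)"
    by (intro tendsto_intros rem0)
  moreover have "s * (s + 1) * (integral {1..real (N + 1)} (kernel_g \<rho> G k) - rem N) = (\<Sum>n<N. Dterm g s (n + 2))" for N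
    unfolding integral_kernel_g_nat[OF eq s] rem_def using s0 by simp
  ultimately show ?thesis unfolding sums_def by simp
qed

lemma Phat_equal_weights:
  assumes U: uniform_series and eq: "\<alpha> = \<beta>"
  shows "summable (\<lambda>n. Dterm g (of_real \<rho> - 1 + chi' k) (n + 2))"
    and "Phat P k = 1 / ((of_real \<rho> + chi' k) * (of_real \<rho> - 1 + chi' k) * of_real (ln 2)) *
          (Dseries g (of_real \<rho> - 1 + chi' k) + of_real ((2 * \<alpha> - 1) * (\<alpha> - 1) / \<alpha> * f 1))"
proof -
  define s where "s = of_real \<rho> - 1 + chi' k"
  have s0: "s \<noteq> 0" "s + 1 \<noteq> 0" using chi'_imaginary[of k] by (auto simp: s_def complex_eq_iff)
  define w where "w = s + 1"
  have w: "of_real \<rho> + chi' k = w" by (simp add: s_def w_def)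
  obtain I where I: "has_improper_integral (kernel_g \<rho> G k) I 1"
    and Ph: "Phat P k = 1 / of_real (ln 2) * I
          + of_real (f 1) / of_real (ln 2) * integral {0..1} (kernel_1 \<alpha> \<beta> \<phi> \<rho> k)"
    using Phat_formula[OF U] by blast
  have D: "(\<lambda>n. Dterm g s (n + 2)) sums (s * (s + 1) * I)"
    by (rule Dseries_formula[OF U eq s_def I])
  thus "summable (\<lambda>n. Dterm g (of_real \<rho> - 1 + chi' k) (n + 2))"
    by (simp add: sums_iff s_def)
  have "Dseries g s = s * (s + 1) * I" using D by (simp add: Dseries_def sums_iff)
  hence "I = Dseries g s / (s * w)" using s0 by (simp add: w_def)
  thus "Phat P k = 1 / ((of_real \<rho> + chi' k) * (of_real \<rho> - 1 + chi' k) * of_real (ln 2)) *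
          (Dseries g (of_real \<rho> - 1 + chi' k) + of_real ((2 * \<alpha> - 1) * (\<alpha> - 1) / \<alpha> * f 1))"
    unfolding Ph integral_kernel_1_equal_weights[OF eq] w s_def[symmetric] of_real_mult[of _ "f 1"]
    by (simp add: add_divide_distrib distrib_left mult_ac)
qed

end

theorem theorem6p1:
  fixes \<alpha> \<beta> \<rho> :: real
    and f g :: "nat \<Rightarrow> real"
    and \<phi> F G P :: "real \<Rightarrow> real"
    and cond_i cond_ii cond_iii :: "(real \<Rightarrow> real) \<Rightarrow> bool"
    and cond_iv coeff_abs :: bool
  assumes neg: "\<alpha> < 0" "\<beta> < 0"
    and rho: "\<rho> = log 2 (\<bar>\<alpha>\<bar> + \<bar>\<beta>\<bar>)"
    and phi: "\<phi> = phi \<bar>\<alpha>\<bar> \<bar>\<beta>\<bar>"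
    and rec: "\<And>n. n \<ge> 2 \<Longrightarrow>
      f n = \<alpha> * f (nat \<lfloor>real n / 2\<rfloor>) + \<beta> * f (nat \<lceil>real n / 2\<rceil>) + g n"
    and g1: "g 1 = 0"
    and F: "F = interp \<phi> f"
    and G: "G = interp0 \<phi> g"
    and P: "P = (\<lambda>t. bisum (Pterm \<rho> G t) + f 1 * P0 \<alpha> \<beta> \<phi> \<rho> t)"
    and cond_i: "cond_i = (\<lambda>R. continuous_on UNIV R \<and> antiperiodic1 R \<and>
      (\<lambda>n::nat. real n powr - \<rho> * f n - R (log 2 (real n))) \<in> o(\<lambda>_. 1))"
    and cond_ii: "cond_ii = (\<lambda>R. continuous_on UNIV R \<and> antiperiodic1 R \<and>
      (\<lambda>x::real. x powr - \<rho> * F x - R (log 2 x)) \<in> o(\<lambda>_. 1))"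
    and cond_iii: "cond_iii = (\<lambda>R. antiperiodic1 R \<and>
      (\<lambda>x::real. x powr - \<rho> * F x - R (log 2 x)) \<in> o(\<lambda>_. 1))"
    and cond_iv: "cond_iv \<longleftrightarrow>
      uniformly_convergent_on {1..2} (\<lambda>N x. \<Sum>m=1..N. Qterm \<rho> G m x)"
    and coeff_abs: "coeff_abs \<longleftrightarrow> (\<forall>k.
      kernel_g \<rho> G k absolutely_integrable_on {1..} \<and>
      kernel_1 \<alpha> \<beta> \<phi> \<rho> k absolutely_integrable_on {0..1} \<and>
      Phat P k = 1 / of_real (ln 2) * integral {1..} (kernel_g \<rho> G k)
        + of_real (f 1) / of_real (ln 2) * integral {0..1} (kernel_1 \<alpha> \<beta> \<phi> \<rho> k))"
  shows
    "\<alpha> + \<beta> = - (2 powr \<rho>) \<and>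
     (\<forall>m x. Qterm \<rho> G m x = (\<alpha> + \<beta>) powi (- int m) * G (2 ^ m * x)) \<and>
     ((\<exists>R. cond_i R) \<longleftrightarrow> (\<exists>R. cond_ii R)) \<and>
     ((\<exists>R. cond_ii R) \<longleftrightarrow> (\<exists>R. cond_iii R)) \<and>
     ((\<exists>R. cond_iii R) \<longleftrightarrow> cond_iv) \<and>
     (cond_iv \<longrightarrow>
        (\<forall>x>0. summable (\<lambda>m. Qterm \<rho> G (Suc m) x)) \<and>
        Qfun \<rho> G \<in> o(\<lambda>x. x powr \<rho>) \<and>
        (\<forall>t. bisummable (Pterm \<rho> G t)) \<and>
        continuous_on UNIV P \<and> antiperiodic1 P \<and>
        (\<forall>x\<ge>1. F x = x powr \<rho> * P (log 2 x) - Qfun \<rho> G x) \<and>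
        cond_i P \<and> cond_ii P \<and> cond_iii P \<and>
        (\<forall>R. cond_i R \<or> cond_ii R \<or> cond_iii R \<longrightarrow> R = P)) \<and>
     (cond_iv \<longrightarrow> (\<forall>k. \<exists>I.
        has_improper_integral (kernel_g \<rho> G k) I 1 \<and>
        kernel_1 \<alpha> \<beta> \<phi> \<rho> k integrable_on {0..1} \<and>
        Phat P k = 1 / of_real (ln 2) * I
          + of_real (f 1) / of_real (ln 2) * integral {0..1} (kernel_1 \<alpha> \<beta> \<phi> \<rho> k))) \<and>
     (summable (\<lambda>m. 2 powr (- \<rho> * real m) * Amax g m) \<longrightarrow> cond_iv \<and> coeff_abs) \<and>
     (\<bar>\<alpha>\<bar> + \<bar>\<beta>\<bar> > 1 \<and> summable (\<lambda>m. 2 powr ((1 - \<rho>) * real m) * Bmax g m) \<longrightarrow>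
        cond_iv \<and>
        (\<lambda>k. norm (Phat P k)) summable_on UNIV \<and>
        (\<forall>t. ((\<lambda>k. Phat P k * exp (of_int (2 * k + 1) * of_real pi * \<i> * of_real t))
                has_sum of_real (P t)) UNIV) \<and>
        coeff_abs) \<and>
     (\<alpha> = \<beta> \<and> cond_iv \<longrightarrow> (\<forall>k.
        summable (\<lambda>n. Dterm g (of_real \<rho> - 1 + chi' k) (n + 2)) \<and>
        Phat P k =
          1 / ((of_real \<rho> + chi' k) * (of_real \<rho> - 1 + chi' k) * of_real (ln 2)) *
          (Dseries g (of_real \<rho> - 1 + chi' k)
            + of_real ((2 * \<alpha> - 1) * (\<alpha> - 1) / \<alpha> * f 1))))"
proof -
  interpret antiperiodic_recurrence \<alpha> \<beta> \<rho> f g \<phi> F G P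
    using neg rho phi rec g1 F G P by unfold_locales
  have i_iff: "cond_i R \<longleftrightarrow> continuous_on UNIV R \<and> antiperiodic1 R \<and> asymptotic_nat R" for R
    by (simp only: cond_i asymptotic_nat_def smallo_one_iff)
  have ii_iff: "cond_ii R \<longleftrightarrow> continuous_on UNIV R \<and> antiperiodic1 R \<and> asymptotic_real R" for R
    by (simp only: cond_ii asymptotic_real_def smallo_one_iff)
  have iii_iff: "cond_iii R \<longleftrightarrow> antiperiodic1 R \<and> asymptotic_real R" for R
    by (simp only: cond_iii asymptotic_real_def smallo_one_iff)
  have iv_iff: "cond_iv \<longleftrightarrow> uniform_series"
    by (simp only: cond_iv uniform_series_def)
  have i_eq_ii: "cond_i R \<longleftrightarrow> cond_ii R" for R
    unfolding i_iff ii_iff using asymptotic_nat_imp_real asymptotic_real_imp_nat by blast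
  have iii_imp_iv: "cond_iii R \<Longrightarrow> cond_iv" for R
    unfolding iii_iff iv_iff using asymptotic_real_imp_uniform_series by blast
  have ii_P: "cond_ii P" if cond_iv
    using that P_continuous P_antiperiodic asymptotic_real_P unfolding ii_iff iv_iff by blast
  have ii_imp_iii: "cond_ii R \<Longrightarrow> cond_iii R" for R
    unfolding ii_iff iii_iff by blast
  have unique: "R = P" if cond_iv "cond_i R \<or> cond_ii R \<or> cond_iii R" for R
  proof -
    have "cond_iii R" using that(2) i_eq_ii ii_imp_iii by blast
    thus ?thesis using that(1) asymptotic_real_unique unfolding iii_iff iv_iff by blast
  qed
  have scaled_Bmax_eq: "(\<lambda>m. 2 powr ((1 - \<rho>) * real m) * Bmax g m) = scaled_Bmax"
    by (simp only: scaled_Bmax_def[abs_def])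
  have abs: "cond_iv \<and> coeff_abs" if "summable (\<lambda>m. 2 powr (- \<rho> * real m) * Amax g m)"
    unfolding coeff_abs iv_iff
    using uniform_series_if_Amax_summable[OF that] Phat_formula_absolute[OF that] by blast
  show ?thesis
  proof (intro conjI allI impI)
    show "\<alpha> + \<beta> = - (2 powr \<rho>)" by (rule sum_eq)
    show "Qterm \<rho> G m x = (\<alpha> + \<beta>) powi (- int m) * G (2 ^ m * x)" for m x by (rule Qterm_eq)
    show "(\<exists>R. cond_i R) \<longleftrightarrow> (\<exists>R. cond_ii R)" by (simp only: i_eq_ii)
    \<comment> \<open>(iv) yields (ii) with the explicit \<open>P\<close> as witness, which closes
      the circle through (ii), (iii) and (iv).\<close>
    show "(\<exists>R. cond_ii R) \<longleftrightarrow> (\<exists>R. cond_iii R)" "(\<exists>R. cond_iii R) \<longleftrightarrow> cond_iv"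
      using ii_imp_iii iii_imp_iv ii_P by blast+
  next
    assume iv: cond_iv
    hence U: uniform_series by (simp only: iv_iff)
    show "summable (\<lambda>m. Qterm \<rho> G (Suc m) x)" if "x > 0" for x using U that by (rule Q_summable)
    show "Qfun \<rho> G \<in> o(\<lambda>x. x powr \<rho>)" using U by (rule Q_smallo)
    show "bisummable (Pterm \<rho> G t)" for t using U by (rule bisummable_Pterm)
    show "continuous_on UNIV P" using U by (rule P_continuous)
    show "antiperiodic1 P" using U by (rule P_antiperiodic)
    show "F x = x powr \<rho> * P (log 2 x) - Qfun \<rho> G x" if "x \<ge> 1" for x
      using U that by (rule F_representation)
    show "cond_i P" "cond_ii P" "cond_iii P" using ii_P[OF iv] i_eq_ii ii_imp_iii by blast+
    show "R = P" if "cond_i R \<or> cond_ii R \<or> cond_iii R" for R using iv that by (rule unique)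
    show "\<exists>I. has_improper_integral (kernel_g \<rho> G k) I 1 \<and> kernel_1 \<alpha> \<beta> \<phi> \<rho> k integrable_on {0..1} \<and>
        Phat P k = 1 / of_real (ln 2) * I
          + of_real (f 1) / of_real (ln 2) * integral {0..1} (kernel_1 \<alpha> \<beta> \<phi> \<rho> k)" for k
      using Phat_formula[OF U, of k] integrable_continuous_real[OF kernel_1_continuous] by blast
  next
    assume "summable (\<lambda>m. 2 powr (- \<rho> * real m) * Amax g m)"
    from abs[OF this] show cond_iv coeff_abs by blast+
  next
    assume "\<bar>\<alpha>\<bar> + \<bar>\<beta>\<bar> > 1 \<and> summable (\<lambda>m. 2 powr ((1 - \<rho>) * real m) * Bmax g m)"
    hence B: "\<bar>\<alpha>\<bar> + \<bar>\<beta>\<bar> > 1" "summable scaled_Bmax" unfolding scaled_Bmax_eq by blast+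
    from abs[OF Amax_summable_if_Bmax_summable[OF B]] show cond_iv coeff_abs by blast+
    show "(\<lambda>k. norm (Phat P k)) summable_on UNIV" using B by (rule P_abs_summable)
    show "((\<lambda>k. Phat P k * exp (of_int (2 * k + 1) * of_real pi * \<i> * of_real t))
                has_sum of_real (P t)) UNIV" for t
      using P_fourier_series[OF B] unfolding half_char_def .
  next
    fix k assume "\<alpha> = \<beta> \<and> cond_iv"
    hence eq: "\<alpha> = \<beta>" and U: uniform_series by (simp_all only: iv_iff)
    show "summable (\<lambda>n. Dterm g (of_real \<rho> - 1 + chi' k) (n + 2))"
      "Phat P k = 1 / ((of_real \<rho> + chi' k) * (of_real \<rho> - 1 + chi' k) * of_real (ln 2)) *
          (Dseries g (of_real \<rho> - 1 + chi' k) + of_real ((2 * \<alpha> - 1) * (\<alpha> - 1) / \<alpha> * f 1))"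
      using Phat_equal_weights[OF U eq] by blast+
  qed
qed

end
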